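(* The $\mathbb F[\partial_1,\partial_2,\partial_3]$-module $RE(3,8)$, with the $\boldsymbol\lambda$-bracket described in the context, is a Lie conformal superalgebra of type $(3,0)$ which satisfies conditions (1)–(4) of the context.
   Context: $\mathbb F$ is an algebraically closed field of characteristic $0$; $\boldsymbol\lambda=(\lambda_1,\lambda_2,\lambda_3)$, $\boldsymbol\mu$, $\boldsymbol\partial$, $\boldsymbol y$ are sets of three even commuting variables; $|M|=\sum m_i$. A Lie conformal superalgebra of type $(3,0)$ is a $\mathbb Z/2$-graded $\mathbb F[\boldsymbol\partial]$-module $R$ with a parity-preserving linear $\boldsymbol\lambda$-bracket $R\otimes R\to\mathbb F[\boldsymbol\lambda]\otimes R$ satisfying (sesquilinearity) $[(\partial_ia)_{\boldsymbol\lambda}b]=-\lambda_i[a_{\boldsymbol\lambda}b]$, $[a_{\boldsymbol\lambda}(\partial_ib)]=(\partial_i+\lambda_i)[a_{\boldsymbol\lambda}b]$; (skew-symmetry) $[b_{\boldsymbol\lambda}a]=-(-1)^{p(a)p(b)}[a_{-\boldsymbol\lambda-\boldsymbol\partial}b]$; (Jacobi) $[a_{\boldsymbol\lambda}[b_{\boldsymbol\mu}c]]=[[a_{\boldsymbol\lambda}b]_{\boldsymbol\lambda+\boldsymbol\mu}c]+(-1)^{p(a)p(b)}[b_{\boldsymbol\mu}[a_{\boldsymbol\lambda}c]]$. Annihilation algebra: $\mathcal A(R)=(R\otimes\mathbb F[[\boldsymbol y]])/\sum_i(\partial_i+\partial_{y_i})(R\otimes\mathbb F[[\boldsymbol y]])$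 with (continuous) bracket $[a\boldsymbol y^M,b\boldsymbol y^N]=\sum_J\frac1{J!}(a_Jb)(\partial_{\boldsymbol y}^J\boldsymbol y^M)\boldsymbol y^N$, where $[a_{\boldsymbol\lambda}b]=\sum_J\frac{\boldsymbol\lambda^J}{J!}(a_Jb)$. $R$ is $\mathbb Z$-graded if $\mathbb F[\boldsymbol\lambda]\otimes R$ is $\mathbb Z$-graded with $\deg(\lambda_ia)=\deg(\partial_ia)=\deg a-2$ and $\deg[a_{\boldsymbol\lambda}b]=\deg a+\deg b$; then $\mathcal A(R)$ is graded by $\deg(a\boldsymbol y^M)=\deg a+2|M|$. Conditions: (1) $R$ is $\mathbb Z$-graded; (2) the induced gradation on $\mathcal A(R)$ has depth at most $3$; (3) $\mathcal A(R)_{-1}$ and $\mathcal A(R)_{-3}$ are purely odd; (4) $\mathrm{ad}:\mathcal A(R)_{-2}\to\mathrm{der}(\mathcal A(R))$ is injective and its image is $D=\langle\partial_{y_1},\partial_{y_2},\partial_{y_3}\rangle$. Notation: for $i\ne j$ in $\{1,2,3\}$, $t_{ij}$ is the third index and $\varepsilon_{ij}$ the sign of the permutation $(i,j,t_{ij})$; $\varepsilon_{ii}=0$ (and any term with factor $\varepsilon_{ii}$ is $0$). The symmetric square of $\mathbb F^2$ is identified with $\mathfrak{sl}_2$ by $E=e_1^2/2$, $F=-e_2^2/2$, $H=-e_1\cdot e_2$. $RE(3,8)$ is the quotient of the free $\mathbb F[\boldsymbol\partial]$-module on: $a_1,a_2,a_3$ (even, degree $-2$); $b_1,b_2,b_3$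 (even, degree $2$); $E,F,H$ (even, degree $0$), identified with the standard basis of $\mathfrak{sl}_2$; $e_1,e_2$ (odd, degree $-3$), identified with the standard basis of $\mathbb F^2$; $d_{hkl}$, $h,k\in\{1,2,3\}$, $l\in\{1,2\}$ (odd, degree $1$); by the relations $\partial_1b_1+\partial_2b_2+\partial_3b_3=0$ and $d_{hkl}=-d_{khl}$. Write $d_{hk}\otimes e_l=d_{hkl}$, extended linearly to $d_{hk}\otimes v$, $v\in\mathbb F^2$. The $\boldsymbol\lambda$-brackets, for $c,c'\in\mathfrak{sl}_2$, are $[{a_i}_{\boldsymbol\lambda}a_j]=-(\lambda_i+\partial_i)a_j-\lambda_ja_i+\frac12\lambda_i(\lambda_j+\partial_j)\sum_k\lambda_kb_k$; $[{a_i}_{\boldsymbol\lambda}c]=-(\partial_i+\lambda_i)c$; $[{a_i}_{\boldsymbol\lambda}b_k]=-(\partial_i+\lambda_i)b_k+\delta_{ki}\sum_r\lambda_rb_r$; $[c_{\boldsymbol\lambda}b_j]=0$; $[{b_i}_{\boldsymbol\lambda}b_k]=0$; $[{e_i}_{\boldsymbol\lambda}e_j]=(j-i)\sum_{h,k}\varepsilon_{hk}\lambda_k\partial_ha_{t_{hk}}$; $[{e_i}_{\boldsymbol\lambda}d_{jkh}]=\varepsilon_{jk}\big((h-i)a_{t_{jk}}+(i-h)(\lambda_{t_{jk}}+\partial_{t_{jk}})\sum_r\lambda_rb_r+\frac12(2\lambda_{t_{jk}}+\partial_{t_{jk}})e_i\cdot e_h\big)$; $[{d_{jkh}}_{\boldsymbol\lambda}d_{jsl}]=\varepsilon_{jk}(l-h)(1-\delta_{ks})b_j$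 for $s\ne j$; $[{a_i}_{\boldsymbol\lambda}e_j]=-(\frac32\lambda_i+\partial_i)e_j-\frac12\sum_{k,r}\lambda_k\lambda_i\partial_rd_{krj}$; $[c_{\boldsymbol\lambda}e_j]=ce_j-\sum_{i,h}\lambda_i\partial_h\,d_{ih}\otimes ce_j$; $[c_{\boldsymbol\lambda}d_{ijh}]=d_{ij}\otimes ce_h$; $[{b_j}_{\boldsymbol\lambda}e_k]=-\sum_i\lambda_id_{ijk}$; $[{b_i}_{\boldsymbol\lambda}d_{jkl}]=0$; $[c_{\boldsymbol\lambda}c']=[c,c']+\mathrm{tr}(cc')\sum_k\lambda_kb_k$; $[{a_i}_{\boldsymbol\lambda}d_{hkl}]=-(\frac32\lambda_i+\partial_i)d_{hkl}+\delta_{ih}\sum_j\lambda_jd_{jkl}-\delta_{ik}\sum_r\lambda_rd_{rhl}$; extended by sesquilinearity and skew-symmetry. *)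

theory Defs
  imports
    "HOL-Analysis.Analysis"
    "HOL-Library.Poly_Mapping"
    "HOL-Library.Z2"
    "HOL-Computational_Algebra.Polynomial"
begin

section \<open>Polynomials and polynomials with values in a module\<close>

text \<open>
  The index set \<open>{1,2,3}\<close> is the numeral type \<^typ>\<open>3\<close>, and \<open>{1,2}\<close> is the numeral type \<^typ>\<open>2\<close>.
  \<open>'f dpoly\<close> is the ring \<open>F[\<partial>\<^sub>1,\<partial>\<^sub>2,\<partial>\<^sub>3]\<close>. An \<open>F[\<partial>]\<close>-module \<open>R\<close> is a type \<open>'r\<close> with an action \<open>act\<close>.
  For a set of variables \<open>'v\<close>, the space \<open>F['v] \<otimes> R\<close> is the type \<open>('v, 'r) rpoly\<close> of polynomials with
  coefficients in \<open>R\<close>; it is a module over the polynomial ring \<open>F[\<partial>]['v]\<close>, which is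
  \<open>('v, 'f dpoly) rpoly\<close>.
\<close>

type_synonym expo = "3 \<Rightarrow>\<^sub>0 nat"
type_synonym 'f dpoly = "expo \<Rightarrow>\<^sub>0 'f"
type_synonym ('v, 'r) rpoly = "('v \<Rightarrow>\<^sub>0 nat) \<Rightarrow>\<^sub>0 'r"

definition pvar :: "'v \<Rightarrow> ('v, 'a::comm_ring_1) rpoly"
  where "pvar i = Poly_Mapping.single (Poly_Mapping.single i 1) 1"

definition pconst :: "'a::zero \<Rightarrow> ('v, 'a) rpoly"
  where "pconst c = Poly_Mapping.single 0 c"

definition msize :: "expo \<Rightarrow> nat"
  where "msize M = (\<Sum>i\<in>UNIV. Poly_Mapping.lookup M i)"

definition mfact :: "expo \<Rightarrow> 'a::field_char_0"
  where "mfact M = (\<Prod>i\<in>UNIV. fact (Poly_Mapping.lookup M i))"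

definition mpower :: "('v::finite \<Rightarrow> 'c::comm_ring_1) \<Rightarrow> ('v \<Rightarrow>\<^sub>0 nat) \<Rightarrow> 'c"
  where "mpower q M = (\<Prod>i\<in>UNIV. q i ^ Poly_Mapping.lookup M i)"

definition pact :: "('a::comm_ring_1 \<Rightarrow> 'r::ab_group_add \<Rightarrow> 'r)
    \<Rightarrow> ('v, 'a) rpoly \<Rightarrow> ('v, 'r) rpoly \<Rightarrow> ('v, 'r) rpoly"
  where "pact act p x = (\<Sum>m\<in>Poly_Mapping.keys p. \<Sum>n\<in>Poly_Mapping.keys x.
     Poly_Mapping.single (m + n) (act (Poly_Mapping.lookup p m) (Poly_Mapping.lookup x n)))"

text \<open>
  Substitution \<open>\<lambda>\<^sub>i := q i\<close> in an element of \<open>F[\<lambda>] \<otimes> R\<close>. The value \<open>q i\<close> may involve \<open>\<partial>\<close>, which then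
  acts on the coefficients: \<open>\<Sum>\<^sub>M \<lambda>\<^sup>M r\<^sub>M\<close> goes to \<open>\<Sum>\<^sub>M q\<^sup>M r\<^sub>M\<close>.
\<close>

definition psubst :: "('a::comm_ring_1 \<Rightarrow> 'r::ab_group_add \<Rightarrow> 'r)
    \<Rightarrow> (3 \<Rightarrow> ('v, 'a) rpoly) \<Rightarrow> (3, 'r) rpoly \<Rightarrow> ('v, 'r) rpoly"
  where "psubst act q x = (\<Sum>M\<in>Poly_Mapping.keys x.
     pact act (mpower q M) (pconst (Poly_Mapping.lookup x M)))"

section \<open>Lie conformal superalgebras of type (3,0)\<close>

text \<open>Parities live in \<open>Z/2\<close>, the type \<^typ>\<open>bit\<close>; \<open>koszul p q x\<close> is \<open>(-1)\<^bsup>pq\<^esup> x\<close>.\<close>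

definition koszul :: "bit \<Rightarrow> bit \<Rightarrow> 'a::uminus \<Rightarrow> 'a"
  where "koszul p q x = (if p = 1 \<and> q = 1 then - x else x)"

definition direct_sum_decomposition :: "('i \<Rightarrow> 'r::ab_group_add set) \<Rightarrow> bool"
  where "direct_sum_decomposition W \<longleftrightarrow>
    (\<forall>x. \<exists>!f :: 'i \<Rightarrow>\<^sub>0 'r. (\<forall>i. Poly_Mapping.lookup f i \<in> W i) \<and>
       x = (\<Sum>i\<in>Poly_Mapping.keys f. Poly_Mapping.lookup f i))"

abbreviation fscale :: "('f::field dpoly \<Rightarrow> 'r::ab_group_add \<Rightarrow> 'r) \<Rightarrow> 'f \<Rightarrow> 'r \<Rightarrow> 'r"
  where "fscale act c \<equiv> act (pconst c)"

type_synonym 'r lbracket = "'r \<Rightarrow> 'r \<Rightarrow> (3, 'r) rpoly"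

definition bilinear_bracket ::
    "('f::field dpoly \<Rightarrow> 'r::ab_group_add \<Rightarrow> 'r) \<Rightarrow> 'r lbracket \<Rightarrow> bool"
  where "bilinear_bracket act br \<longleftrightarrow>
    (\<forall>a b c. br (a + b) c = br a c + br b c) \<and>
    (\<forall>a b c. br a (b + c) = br a b + br a c) \<and>
    (\<forall>k a b. br (fscale act k a) b = pact act (pconst (pconst k)) (br a b)) \<and>
    (\<forall>k a b. br a (fscale act k b) = pact act (pconst (pconst k)) (br a b))"

definition sesquilinear ::
    "('f::field dpoly \<Rightarrow> 'r::ab_group_add \<Rightarrow> 'r) \<Rightarrow> 'r lbracket \<Rightarrow> bool"
  where "sesquilinear act br \<longleftrightarrow>
    (\<forall>i a b. br (act (pvar i) a) b = pact act (- pvar i) (br a b)) \<and>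
    (\<forall>i a b. br a (act (pvar i) b) = pact act (pconst (pvar i) + pvar i) (br a b))"

definition skew_symmetric ::
    "('f::field dpoly \<Rightarrow> 'r::ab_group_add \<Rightarrow> 'r) \<Rightarrow> (bit \<Rightarrow> 'r set) \<Rightarrow> 'r lbracket \<Rightarrow> bool"
  where "skew_symmetric act par br \<longleftrightarrow>
    (\<forall>p q. \<forall>a\<in>par p. \<forall>b\<in>par q.
       br b a = - koszul p q (psubst act (\<lambda>i. - pvar i - pconst (pvar i)) (br a b)))"

text \<open>
  The Jacobi identity holds in \<open>F[\<lambda>,\<mu>] \<otimes> R\<close>, with variables indexed by the sum type \<^typ>\<open>3 + 3\<close>.
  \<open>[x\<^sub>q y]\<close> is extended from \<open>R\<close> to \<open>R\<close>-valued polynomials in either argument by linearity over the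
  polynomial ring \<open>F[\<lambda>,\<mu>]\<close>.
\<close>

abbreviation lamv :: "3 \<Rightarrow> (3 + 3, 'f::field dpoly) rpoly"
  where "lamv i \<equiv> pvar (Inl i)"

abbreviation muv :: "3 \<Rightarrow> (3 + 3, 'f::field dpoly) rpoly"
  where "muv i \<equiv> pvar (Inr i)"

definition jacobi ::
    "('f::field dpoly \<Rightarrow> 'r::ab_group_add \<Rightarrow> 'r) \<Rightarrow> (bit \<Rightarrow> 'r set) \<Rightarrow> 'r lbracket \<Rightarrow> bool"
  where "jacobi act par br \<longleftrightarrow>
    (\<forall>p q. \<forall>a\<in>par p. \<forall>b\<in>par q. \<forall>c.
       (\<Sum>N\<in>Poly_Mapping.keys (br b c).
          pact act (mpower muv N) (psubst act lamv (br a (Poly_Mapping.lookup (br b c) N))))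
     = (\<Sum>M\<in>Poly_Mapping.keys (br a b).
          pact act (mpower lamv M)
            (psubst act (\<lambda>i. lamv i + muv i) (br (Poly_Mapping.lookup (br a b) M) c)))
     + koszul p q (\<Sum>M\<in>Poly_Mapping.keys (br a c).
          pact act (mpower lamv M) (psubst act muv (br b (Poly_Mapping.lookup (br a c) M)))))"

locale lie_conformal_superalgebra = module act
  for act :: "'f::field dpoly \<Rightarrow> 'r::ab_group_add \<Rightarrow> 'r"
    and par :: "bit \<Rightarrow> 'r set"
    and br :: "'r lbracket" +
  assumes parity_submodule: "subspace (par p)"
    and parity_decomposition: "direct_sum_decomposition par"
    and bracket_bilinear: "bilinear_bracket act br"
    and bracket_parity: "a \<in> par p \<Longrightarrow> b \<in> par q \<Longrightarrow> Poly_Mapping.lookup (br a b) M \<in> par (p + q)"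
    and bracket_sesquilinear: "sesquilinear act br"
    and bracket_skew: "skew_symmetric act par br"
    and bracket_jacobi: "jacobi act par br"

text \<open>
  In a gradation of \<open>F[\<lambda>] \<otimes> R\<close> with \<open>deg (\<lambda>\<^sub>i a) = deg a - 2\<close>, an element is homogeneous of degree \<open>n\<close>
  iff its coefficient at each \<open>\<lambda>\<^sup>M\<close> lies in \<open>R\<close> in degree \<open>n + 2|M|\<close>.
\<close>

definition rpoly_degree :: "(int \<Rightarrow> 'r::ab_group_add set) \<Rightarrow> int \<Rightarrow> (3, 'r) rpoly set"
  where "rpoly_degree gr n = {x. \<forall>M. Poly_Mapping.lookup x M \<in> gr (n + 2 * int (msize M))}"

definition Z_graded :: "('f::field dpoly \<Rightarrow> 'r::ab_group_add \<Rightarrow> 'r) \<Rightarrow> 'r lbracket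
    \<Rightarrow> (int \<Rightarrow> 'r set) \<Rightarrow> bool"
  where "Z_graded act br gr \<longleftrightarrow>
    (\<forall>n. module.subspace (fscale act) (gr n)) \<and>
    direct_sum_decomposition gr \<and>
    (\<forall>n i. \<forall>a\<in>gr n. act (pvar i) a \<in> gr (n - 2)) \<and>
    (\<forall>m n. \<forall>a\<in>gr m. \<forall>b\<in>gr n. br a b \<in> rpoly_degree gr (m + n))"

section \<open>The annihilation algebra\<close>

text \<open>\<open>F[[y\<^sub>1,y\<^sub>2,y\<^sub>3]]\<close>, by coefficients.\<close>

type_synonym 'f pser = "expo \<Rightarrow> 'f"

definition ps_mult :: "'f::field pser \<Rightarrow> 'f pser \<Rightarrow> 'f pser"
  where "ps_mult f g = (\<lambda>M. \<Sum>(K, L) \<in> {(K, L). K + L = M}. f K * g L)"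

definition ps_monom :: "expo \<Rightarrow> 'f::field pser"
  where "ps_monom N = (\<lambda>M. if M = N then 1 else 0)"

definition ps_deriv :: "3 \<Rightarrow> 'f::field pser \<Rightarrow> 'f pser"
  where "ps_deriv i f = (\<lambda>M. of_nat (Poly_Mapping.lookup M i + 1) * f (M + Poly_Mapping.single i 1))"

definition ps_mderiv :: "expo \<Rightarrow> 'f::field pser \<Rightarrow> 'f pser"
  where "ps_mderiv J = (ps_deriv 1 ^^ Poly_Mapping.lookup J 1) \<circ>
     (ps_deriv 2 ^^ Poly_Mapping.lookup J 2) \<circ> (ps_deriv 3 ^^ Poly_Mapping.lookup J 3)"

text \<open>
  The algebra \<open>A(R)\<close> is presented as the quotient of the free vector space on the symbols \<open>(a, f)\<close>, with
  \<open>a\<close> in \<open>R\<close> and \<open>f\<close> a power series, by the relations of the tensor product over \<open>F\<close> together with the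
  image of the operators \<open>\<partial>\<^sub>i + \<partial>\<^bsub>y\<^sub>i\<^esub>\<close>.
\<close>

type_synonym ('f, 'r) presym = "('r \<times> 'f pser) \<Rightarrow>\<^sub>0 'f"

definition sym_scale :: "'f::field \<Rightarrow> ('f, 'r) presym \<Rightarrow> ('f, 'r) presym"
  where "sym_scale c x = Poly_Mapping.map ((*) c) x"

definition tsym :: "'r \<Rightarrow> 'f::field pser \<Rightarrow> ('f, 'r) presym"
  where "tsym a f = Poly_Mapping.single (a, f) 1"

definition ann_relations ::
    "('f::field dpoly \<Rightarrow> 'r::ab_group_add \<Rightarrow> 'r) \<Rightarrow> ('f, 'r) presym set"
  where "ann_relations act =
     {tsym (a + b) f - tsym a f - tsym b f | a b f. True} \<union>
     {tsym a (\<lambda>M. f M + g M) - tsym a f - tsym a g | a f g. True} \<union>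
     {tsym (fscale act c a) f - sym_scale c (tsym a f) | c a f. True} \<union>
     {tsym a (\<lambda>M. c * f M) - sym_scale c (tsym a f) | c a f. True} \<union>
     {tsym (act (pvar i) a) f + tsym a (ps_deriv i f) | i a f. True}"

definition ann_class :: "('f::field dpoly \<Rightarrow> 'r::ab_group_add \<Rightarrow> 'r)
    \<Rightarrow> ('f, 'r) presym \<Rightarrow> ('f, 'r) presym set"
  where "ann_class act x = {y. y - x \<in> module.span sym_scale (ann_relations act)}"

definition ann_carrier :: "('f::field dpoly \<Rightarrow> 'r::ab_group_add \<Rightarrow> 'r) \<Rightarrow> ('f, 'r) presym set set"
  where "ann_carrier act = range (ann_class act)"

text \<open>
  Operations on representatives are passed to classes by taking the union over all representatives.
  When the operation respects the congruence, this union is a single class.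
\<close>

definition ann_map :: "('f::field dpoly \<Rightarrow> 'r::ab_group_add \<Rightarrow> 'r)
    \<Rightarrow> (('f, 'r) presym \<Rightarrow> ('f, 'r) presym)
    \<Rightarrow> ('f, 'r) presym set \<Rightarrow> ('f, 'r) presym set"
  where "ann_map act \<phi> X = (\<Union>x\<in>X. ann_class act (\<phi> x))"

definition ann_map2 :: "('f::field dpoly \<Rightarrow> 'r::ab_group_add \<Rightarrow> 'r)
    \<Rightarrow> (('f, 'r) presym \<Rightarrow> ('f, 'r) presym \<Rightarrow> ('f, 'r) presym)
    \<Rightarrow> ('f, 'r) presym set \<Rightarrow> ('f, 'r) presym set \<Rightarrow> ('f, 'r) presym set"
  where "ann_map2 act \<phi> X Y = (\<Union>x\<in>X. \<Union>y\<in>Y. ann_class act (\<phi> x y))"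

definition ann_add :: "('f::field dpoly \<Rightarrow> 'r::ab_group_add \<Rightarrow> 'r)
    \<Rightarrow> ('f, 'r) presym set \<Rightarrow> ('f, 'r) presym set \<Rightarrow> ('f, 'r) presym set"
  where "ann_add act = ann_map2 act (+)"

definition ann_scale :: "('f::field dpoly \<Rightarrow> 'r::ab_group_add \<Rightarrow> 'r)
    \<Rightarrow> 'f \<Rightarrow> ('f, 'r) presym set \<Rightarrow> ('f, 'r) presym set"
  where "ann_scale act c = ann_map act (sym_scale c)"

text \<open>
  The product \<open>a\<^sub>J b\<close> is \<open>J!\<close> times the coefficient of \<open>\<lambda>\<^sup>J\<close> in \<open>[a\<^sub>\<lambda> b]\<close>. The bracket of \<open>A(R)\<close> is
  \<open>[a f, b g] = \<Sum>\<^sub>J (1/J!) (a\<^sub>J b) (\<partial>\<^sub>y\<^sup>J f) g\<close>, a finite sum; this is the continuous extension to power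
  series \<open>f\<close>, \<open>g\<close> of the formula for monomials.
\<close>

definition nprod :: "('f::field_char_0 dpoly \<Rightarrow> 'r::ab_group_add \<Rightarrow> 'r) \<Rightarrow> 'r lbracket
    \<Rightarrow> expo \<Rightarrow> 'r \<Rightarrow> 'r \<Rightarrow> 'r"
  where "nprod act br J a b = fscale act (mfact J) (Poly_Mapping.lookup (br a b) J)"

definition sym_bracket :: "('f::field_char_0 dpoly \<Rightarrow> 'r::ab_group_add \<Rightarrow> 'r) \<Rightarrow> 'r lbracket
    \<Rightarrow> 'r \<times> 'f pser \<Rightarrow> 'r \<times> 'f pser \<Rightarrow> ('f, 'r) presym"
  where "sym_bracket act br = (\<lambda>(a, f) (b, g). \<Sum>J\<in>Poly_Mapping.keys (br a b).
     sym_scale (1 / mfact J) (tsym (nprod act br J a b) (ps_mult (ps_mderiv J f) g)))"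

definition ann_bracket :: "('f::field_char_0 dpoly \<Rightarrow> 'r::ab_group_add \<Rightarrow> 'r) \<Rightarrow> 'r lbracket
    \<Rightarrow> ('f, 'r) presym set \<Rightarrow> ('f, 'r) presym set \<Rightarrow> ('f, 'r) presym set"
  where "ann_bracket act br = ann_map2 act (\<lambda>x y.
     \<Sum>k\<in>Poly_Mapping.keys x. \<Sum>l\<in>Poly_Mapping.keys y.
       sym_scale (Poly_Mapping.lookup x k * Poly_Mapping.lookup y l) (sym_bracket act br k l))"

definition sym_deriv :: "3 \<Rightarrow> ('f::field, 'r) presym \<Rightarrow> ('f, 'r) presym"
  where "sym_deriv i x = (\<Sum>(a, f)\<in>Poly_Mapping.keys x.
     sym_scale (Poly_Mapping.lookup x (a, f)) (tsym a (ps_deriv i f)))"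

definition ann_parity :: "('f::field dpoly \<Rightarrow> 'r::ab_group_add \<Rightarrow> 'r) \<Rightarrow> (bit \<Rightarrow> 'r set)
    \<Rightarrow> bit \<Rightarrow> ('f, 'r) presym set set"
  where "ann_parity act par p =
     ann_class act ` module.span sym_scale {tsym a f | a f. a \<in> par p}"

definition ann_degree :: "('f::field dpoly \<Rightarrow> 'r::ab_group_add \<Rightarrow> 'r) \<Rightarrow> (int \<Rightarrow> 'r set)
    \<Rightarrow> int \<Rightarrow> ('f, 'r) presym set set"
  where "ann_degree act gr d =
     ann_class act ` module.span sym_scale
       {tsym a (ps_monom M) | a M n. a \<in> gr n \<and> n + 2 * int (msize M) = d}"

definition ann_superderivations :: "('f::field_char_0 dpoly \<Rightarrow> 'r::ab_group_add \<Rightarrow> 'r)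
    \<Rightarrow> (bit \<Rightarrow> 'r set) \<Rightarrow> 'r lbracket \<Rightarrow> bit
    \<Rightarrow> (('f, 'r) presym set \<Rightarrow> ('f, 'r) presym set) set"
  where "ann_superderivations act par br p =
     {\<phi> \<in> ann_carrier act \<rightarrow>\<^sub>E ann_carrier act.
        (\<forall>X\<in>ann_carrier act. \<forall>Y\<in>ann_carrier act.
           \<phi> (ann_add act X Y) = ann_add act (\<phi> X) (\<phi> Y)) \<and>
        (\<forall>c. \<forall>X\<in>ann_carrier act. \<phi> (ann_scale act c X) = ann_scale act c (\<phi> X)) \<and>
        (\<forall>q. \<forall>X\<in>ann_parity act par q. \<phi> X \<in> ann_parity act par (p + q)) \<and>
        (\<forall>q. \<forall>X\<in>ann_parity act par q. \<forall>Y\<in>ann_carrier act.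
           \<phi> (ann_bracket act br X Y) =
             ann_add act (ann_bracket act br (\<phi> X) Y)
               (ann_scale act (koszul p q 1) (ann_bracket act br X (\<phi> Y))))}"

definition ann_der :: "('f::field_char_0 dpoly \<Rightarrow> 'r::ab_group_add \<Rightarrow> 'r)
    \<Rightarrow> (bit \<Rightarrow> 'r set) \<Rightarrow> 'r lbracket
    \<Rightarrow> (('f, 'r) presym set \<Rightarrow> ('f, 'r) presym set) set"
  where "ann_der act par br =
     {\<lambda>X\<in>ann_carrier act. ann_add act (\<phi> X) (\<psi> X) | \<phi> \<psi>.
        \<phi> \<in> ann_superderivations act par br 0 \<and> \<psi> \<in> ann_superderivations act par br 1}"

definition ann_ad :: "('f::field_char_0 dpoly \<Rightarrow> 'r::ab_group_add \<Rightarrow> 'r) \<Rightarrow> 'r lbracket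
    \<Rightarrow> ('f, 'r) presym set \<Rightarrow> ('f, 'r) presym set \<Rightarrow> ('f, 'r) presym set"
  where "ann_ad act br X = (\<lambda>Y\<in>ann_carrier act. ann_bracket act br X Y)"

text \<open>The linear span of the operators \<open>a f \<mapsto> a (\<partial>\<^bsub>y\<^sub>i\<^esub> f)\<close> on \<open>A(R)\<close>.\<close>

definition ann_D :: "('f::field dpoly \<Rightarrow> 'r::ab_group_add \<Rightarrow> 'r)
    \<Rightarrow> (('f, 'r) presym set \<Rightarrow> ('f, 'r) presym set) set"
  where "ann_D act =
     {\<lambda>X\<in>ann_carrier act. ann_map act (\<lambda>x. \<Sum>i\<in>UNIV. sym_scale (c i) (sym_deriv i x)) X | c :: 3 \<Rightarrow> 'f. True}"

definition depth_at_most_3 :: "('f::field dpoly \<Rightarrow> 'r::ab_group_add \<Rightarrow> 'r)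
    \<Rightarrow> (int \<Rightarrow> 'r set) \<Rightarrow> bool"
  where "depth_at_most_3 act gr \<longleftrightarrow> (\<forall>d < -3. ann_degree act gr d = {ann_class act 0})"

definition odd_in_degrees_m1_m3 :: "('f::field dpoly \<Rightarrow> 'r::ab_group_add \<Rightarrow> 'r)
    \<Rightarrow> (bit \<Rightarrow> 'r set) \<Rightarrow> (int \<Rightarrow> 'r set) \<Rightarrow> bool"
  where "odd_in_degrees_m1_m3 act par gr \<longleftrightarrow>
     ann_degree act gr (-1) \<subseteq> ann_parity act par 1 \<and>
     ann_degree act gr (-3) \<subseteq> ann_parity act par 1"

definition degree_m2_is_D :: "('f::field_char_0 dpoly \<Rightarrow> 'r::ab_group_add \<Rightarrow> 'r)
    \<Rightarrow> (bit \<Rightarrow> 'r set) \<Rightarrow> 'r lbracket \<Rightarrow> (int \<Rightarrow> 'r set) \<Rightarrow> bool"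
  where "degree_m2_is_D act par br gr \<longleftrightarrow>
     ann_ad act br ` ann_degree act gr (-2) \<subseteq> ann_der act par br \<and>
     inj_on (ann_ad act br) (ann_degree act gr (-2)) \<and>
     ann_ad act br ` ann_degree act gr (-2) = ann_D act"

section \<open>The module RE(3,8)\<close>

datatype re38_gen = Ga 3 | Gb 3 | GE | GF | GH | Ge 2 | Gd 3 3 2

primrec gen_degree :: "re38_gen \<Rightarrow> int" where
  "gen_degree (Ga i) = -2"
| "gen_degree (Gb i) = 2"
| "gen_degree GE = 0"
| "gen_degree GF = 0"
| "gen_degree GH = 0"
| "gen_degree (Ge l) = -3"
| "gen_degree (Gd h k l) = 1"

primrec gen_parity :: "re38_gen \<Rightarrow> bit" where
  "gen_parity (Ga i) = 0"
| "gen_parity (Gb i) = 0"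
| "gen_parity GE = 0"
| "gen_parity GF = 0"
| "gen_parity GH = 0"
| "gen_parity (Ge l) = 1"
| "gen_parity (Gd h k l) = 1"

type_synonym 'f re38_free = "re38_gen \<Rightarrow>\<^sub>0 'f dpoly"

definition free_act :: "'f::field dpoly \<Rightarrow> 'f re38_free \<Rightarrow> 'f re38_free"
  where "free_act p x = Poly_Mapping.map ((*) p) x"

lemma lookup_free_act [simp]:
  "Poly_Mapping.lookup (free_act p x) g = p * Poly_Mapping.lookup x g"
  by (simp add: free_act_def map.rep_eq when_def)

lemma module_free_act: "module free_act"
  by unfold_locales
    (auto intro!: poly_mapping_eqI simp: lookup_add algebra_simps)

definition free_gen :: "re38_gen \<Rightarrow> 'f::field re38_free"
  where "free_gen g = Poly_Mapping.single g 1"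

definition re38_relations :: "'f::field re38_free set"
  where "re38_relations =
     {\<Sum>i\<in>UNIV. free_act (pvar i) (free_gen (Gb i))} \<union>
     {free_gen (Gd h k l) + free_gen (Gd k h l) | h k l. True}"

definition re38_cong :: "'f::field re38_free \<Rightarrow> 'f re38_free \<Rightarrow> bool"
  where "re38_cong x y \<longleftrightarrow> x - y \<in> module.span free_act re38_relations"

lemma equivp_re38_cong: "equivp (re38_cong :: 'f::field re38_free \<Rightarrow> _)"
proof -
  interpret module "free_act :: 'f dpoly \<Rightarrow> _" by (rule module_free_act)
  show ?thesis
  proof (rule equivpI)
    show "reflp (re38_cong :: 'f re38_free \<Rightarrow> _)"
      by (simp add: reflp_def re38_cong_def span_zero)
    show "symp (re38_cong :: 'f re38_free \<Rightarrow> _)"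
    proof (rule sympI)
      fix x y :: "'f re38_free"
      assume "re38_cong x y"
      then have "- (x - y) \<in> span re38_relations"
        unfolding re38_cong_def by (rule span_neg)
      then show "re38_cong y x" by (simp add: re38_cong_def)
    qed
    show "transp (re38_cong :: 'f re38_free \<Rightarrow> _)"
    proof (rule transpI)
      fix x y z :: "'f re38_free"
      assume "re38_cong x y" "re38_cong y z"
      then have "(x - y) + (y - z) \<in> span re38_relations"
        unfolding re38_cong_def by (rule span_add)
      then show "re38_cong x z" by (simp add: re38_cong_def)
    qed
  qed
qed

quotient_type (overloaded) 'f re38 = "'f::field re38_free" / re38_cong
  by (rule equivp_re38_cong)

instantiation re38 :: (field) ab_group_add
begin

lift_definition zero_re38 :: "'a re38" is 0 .

lift_definition plus_re38 :: "'a re38 \<Rightarrow> 'a re38 \<Rightarrow> 'a re38" is "(+)"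
proof -
  fix x y z w :: "'a re38_free"
  interpret module "free_act :: 'a dpoly \<Rightarrow> _" by (rule module_free_act)
  assume "re38_cong x y" "re38_cong z w"
  then have "(x - y) + (z - w) \<in> span re38_relations"
    unfolding re38_cong_def by (rule span_add)
  then show "re38_cong (x + z) (y + w)"
    by (simp add: re38_cong_def algebra_simps)
qed

lift_definition uminus_re38 :: "'a re38 \<Rightarrow> 'a re38" is uminus
proof -
  fix x y :: "'a re38_free"
  interpret module "free_act :: 'a dpoly \<Rightarrow> _" by (rule module_free_act)
  assume "re38_cong x y"
  then have "- (x - y) \<in> span re38_relations"
    unfolding re38_cong_def by (rule span_neg)
  then show "re38_cong (- x) (- y)"
    by (simp add: re38_cong_def algebra_simps)
qed

definition minus_re38 :: "'a re38 \<Rightarrow> 'a re38 \<Rightarrow> 'a re38"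
  where "minus_re38 x y = x + (- y)"

instance
proof
  interpret module "free_act :: 'a dpoly \<Rightarrow> _" by (rule module_free_act)
  fix a b c :: "'a re38"
  show "a + b + c = a + (b + c)"
    by transfer (simp add: re38_cong_def add.assoc span_zero)
  show "a + b = b + a"
    by transfer (simp add: re38_cong_def add.commute span_zero)
  show "0 + a = a"
    by transfer (simp add: re38_cong_def span_zero)
  show "- a + a = 0"
    by transfer (simp add: re38_cong_def span_zero)
  show "a - b = a + - b"
    by (simp add: minus_re38_def)
qed

end

lift_definition re38_act :: "'f::field dpoly \<Rightarrow> 'f re38 \<Rightarrow> 'f re38" is free_act
proof -
  fix p :: "'f dpoly" and x y :: "'f re38_free"
  interpret module "free_act :: 'f dpoly \<Rightarrow> _" by (rule module_free_act)
  assume "re38_cong x y"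
  then have "free_act p (x - y) \<in> span re38_relations"
    unfolding re38_cong_def by (rule span_scale)
  then show "re38_cong (free_act p x) (free_act p y)"
    by (simp add: re38_cong_def scale_right_diff_distrib)
qed

lift_definition gen :: "re38_gen \<Rightarrow> 'f::field re38" is free_gen .

definition re38_parity :: "bit \<Rightarrow> 'f::field re38 set"
  where "re38_parity p = module.span re38_act {gen g | g. gen_parity g = p}"

definition re38_degree :: "int \<Rightarrow> 'f::field re38 set"
  where "re38_degree n = module.span (fscale re38_act)
     {re38_act (Poly_Mapping.single M 1) (gen g) | M g. gen_degree g - 2 * int (msize M) = n}"

section \<open>The bracket of RE(3,8)\<close>

text \<open>
  Arithmetic in \<^typ>\<open>3\<close> is modulo 3, so \<open>(i, j, t)\<close> is an even permutation of \<open>(1, 2, 3)\<close> iff \<open>j = i + 1\<close>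
  and \<open>i \<noteq> j\<close>, and the third index is \<open>- i - j\<close> because \<open>1 + 2 + 3 = 0\<close>.
\<close>

definition third :: "3 \<Rightarrow> 3 \<Rightarrow> 3"
  where "third i j = - i - j"

definition eps :: "3 \<Rightarrow> 3 \<Rightarrow> int"
  where "eps i j = (if j = i + 1 then 1 else if i = j + 1 then -1 else 0)"

lemma third_eps_table:
  "third 1 2 = 3" "third 2 3 = 1" "third 3 1 = 2" "third 2 1 = 3" "third 3 2 = 1" "third 1 3 = 2"
  "eps 1 2 = 1" "eps 2 3 = 1" "eps 3 1 = 1" "eps 2 1 = -1" "eps 3 2 = -1" "eps 1 3 = -1"
  "eps i i = 0"
  by (simp_all add: third_def eps_def)

text \<open>The integer represented by an index in \<open>{1,2}\<close>, used in coefficients such as \<open>j - i\<close>.\<close>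

definition idx :: "2 \<Rightarrow> int"
  where "idx l = (if l = 1 then 1 else 2)"

text \<open>The embeddings of \<open>sl\<^sub>2\<close> (traceless matrices) and of \<open>F\<^sup>2\<close>, and the elements \<open>d\<^sub>h\<^sub>k \<otimes> v\<close>.\<close>

definition sl_elem :: "'f::field^2^2 \<Rightarrow> 'f re38"
  where "sl_elem c = fscale re38_act (c $ 1 $ 2) (gen GE) + fscale re38_act (c $ 2 $ 1) (gen GF)
     + fscale re38_act (c $ 1 $ 1) (gen GH)"

definition e_elem :: "'f::field^2 \<Rightarrow> 'f re38"
  where "e_elem v = (\<Sum>l\<in>UNIV. fscale re38_act (v $ l) (gen (Ge l)))"

definition d_elem :: "3 \<Rightarrow> 3 \<Rightarrow> 'f::field^2 \<Rightarrow> 'f re38"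
  where "d_elem h k v = (\<Sum>l\<in>UNIV. fscale re38_act (v $ l) (gen (Gd h k l)))"

text \<open>
  The product \<open>e\<^sub>i \<cdot> e\<^sub>h\<close> in the symmetric square of \<open>F\<^sup>2\<close>, under the identification \<open>E = e\<^sub>1\<^sup>2/2\<close>,
  \<open>F = - e\<^sub>2\<^sup>2/2\<close>, \<open>H = - e\<^sub>1 \<cdot> e\<^sub>2\<close>.
\<close>

definition e_dot :: "2 \<Rightarrow> 2 \<Rightarrow> 'f::field re38"
  where "e_dot i h =
     (if i = 1 \<and> h = 1 then fscale re38_act 2 (gen GE)
      else if i = 2 \<and> h = 2 then fscale re38_act (-2) (gen GF)
      else - gen GH)"

text \<open>
  The element \<open>P(\<lambda>,\<partial>) r\<close> of \<open>F[\<lambda>] \<otimes> R\<close>, where \<open>\<lambda>\<^sub>i\<close> is \<open>lam i\<close> and \<open>\<partial>\<^sub>i\<close> is \<open>del i\<close>.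
\<close>

definition ptimes :: "(3, 'f::field dpoly) rpoly \<Rightarrow> 'f re38 \<Rightarrow> (3, 'f re38) rpoly"
    (infixr \<open>\<odot>\<close> 72)
  where "P \<odot> r = pact re38_act P (pconst r)"

abbreviation lam :: "3 \<Rightarrow> (3, 'f::field dpoly) rpoly"
  where "lam i \<equiv> pvar i"

abbreviation del :: "3 \<Rightarrow> (3, 'f::field dpoly) rpoly"
  where "del i \<equiv> pconst (pvar i)"

abbreviation num :: "'f::field \<Rightarrow> (3, 'f dpoly) rpoly"
  where "num c \<equiv> pconst (pconst c)"

definition re38_formulas :: "'f::field_char_0 re38 lbracket \<Rightarrow> bool"
  where "re38_formulas br \<longleftrightarrow>
    (\<forall>i j. br (gen (Ga i)) (gen (Ga j)) =
       - (lam i + del i) \<odot> gen (Ga j) - lam j \<odot> gen (Ga i)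
       + (\<Sum>k\<in>UNIV. (num (1/2) * lam i * (lam j + del j) * lam k) \<odot> gen (Gb k))) \<and>
    (\<forall>i c. trace c = 0 \<longrightarrow>
       br (gen (Ga i)) (sl_elem c) = - (del i + lam i) \<odot> sl_elem c) \<and>
    (\<forall>i k. br (gen (Ga i)) (gen (Gb k)) =
       - (del i + lam i) \<odot> gen (Gb k)
       + (\<Sum>r\<in>UNIV. (of_bool (k = i) * lam r) \<odot> gen (Gb r))) \<and>
    (\<forall>c j. trace c = 0 \<longrightarrow> br (sl_elem c) (gen (Gb j)) = 0) \<and>
    (\<forall>i k. br (gen (Gb i)) (gen (Gb k)) = 0) \<and>
    (\<forall>i j. br (gen (Ge i)) (gen (Ge j)) =
       (\<Sum>h\<in>UNIV. \<Sum>k\<in>UNIV.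
          (of_int (idx j - idx i) * of_int (eps h k) * lam k * del h) \<odot> gen (Ga (third h k)))) \<and>
    (\<forall>i j k h. br (gen (Ge i)) (gen (Gd j k h)) =
       (of_int (eps j k) * of_int (idx h - idx i)) \<odot> gen (Ga (third j k))
       + (\<Sum>r\<in>UNIV. (of_int (eps j k) * of_int (idx i - idx h)
            * (lam (third j k) + del (third j k)) * lam r) \<odot> gen (Gb r))
       + (of_int (eps j k) * num (1/2) * (2 * lam (third j k) + del (third j k))) \<odot> e_dot i h) \<and>
    (\<forall>j k h s l. s \<noteq> j \<longrightarrow> br (gen (Gd j k h)) (gen (Gd j s l)) =
       (of_int (eps j k) * of_int (idx l - idx h) * (1 - of_bool (k = s))) \<odot> gen (Gb j)) \<and>
    (\<forall>i j. br (gen (Ga i)) (gen (Ge j)) =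
       - (num (3/2) * lam i + del i) \<odot> gen (Ge j)
       - (\<Sum>k\<in>UNIV. \<Sum>r\<in>UNIV. (num (1/2) * lam k * lam i * del r) \<odot> gen (Gd k r j))) \<and>
    (\<forall>c j. trace c = 0 \<longrightarrow> br (sl_elem c) (gen (Ge j)) =
       1 \<odot> e_elem (c *v axis j 1)
       - (\<Sum>i\<in>UNIV. \<Sum>h\<in>UNIV. (lam i * del h) \<odot> d_elem i h (c *v axis j 1))) \<and>
    (\<forall>c i j h. trace c = 0 \<longrightarrow> br (sl_elem c) (gen (Gd i j h)) =
       1 \<odot> d_elem i j (c *v axis h 1)) \<and>
    (\<forall>j k. br (gen (Gb j)) (gen (Ge k)) = - (\<Sum>i\<in>UNIV. lam i \<odot> gen (Gd i j k))) \<and>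
    (\<forall>i j k l. br (gen (Gb i)) (gen (Gd j k l)) = 0) \<and>
    (\<forall>c c'. trace c = 0 \<longrightarrow> trace c' = 0 \<longrightarrow> br (sl_elem c) (sl_elem c') =
       1 \<odot> sl_elem (c ** c' - c' ** c)
       + (\<Sum>k\<in>UNIV. (num (trace (c ** c')) * lam k) \<odot> gen (Gb k))) \<and>
    (\<forall>i h k l. br (gen (Ga i)) (gen (Gd h k l)) =
       - (num (3/2) * lam i + del i) \<odot> gen (Gd h k l)
       + (\<Sum>j\<in>UNIV. (of_bool (i = h) * lam j) \<odot> gen (Gd j k l))
       - (\<Sum>r\<in>UNIV. (of_bool (i = k) * lam r) \<odot> gen (Gd r h l)))"

text \<open>The formulas on generators, extended by sesquilinearity and skew-symmetry.\<close>

definition re38_bracket :: "'f::field_char_0 re38 lbracket \<Rightarrow> bool"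
  where "re38_bracket br \<longleftrightarrow>
     bilinear_bracket re38_act br \<and> sesquilinear re38_act br \<and>
     skew_symmetric re38_act re38_parity br \<and> re38_formulas br"

end

theory Submission imports Defs begin

text \<open>
  Write an element of \<open>RE(3,8)\<close> through its polynomial coordinates in \<open>\<partial>\<close>, replacing the vector of
  coefficients of \<open>b\<^sub>1, b\<^sub>2, b\<^sub>3\<close> by its curl, which is insensitive to the relation
  \<open>\<Sum> \<partial>\<^sub>i b\<^sub>i = 0\<close>. By sesquilinearity the bracket of \<open>x\<close> and \<open>y\<close> is then a bilinear expression in the
  coordinates of \<open>x\<close> at \<open>\<xi> = - \<lambda>\<close> and of \<open>y\<close> at \<open>\<eta> = \<lambda> + \<partial>\<close>, with polynomial coefficients in
  \<open>\<xi>\<close> and \<open>\<eta>\<close>. Skew-symmetry and the Jacobi identity become polynomial identities for vectors with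
  momenta that add up under the bracket.

  In the annihilation algebra every class of degree \<open>d\<close> is a combination of classes of \<open>g y\<^sup>L\<close> with \<open>g\<close> a
  generator and \<open>deg g + 2 |L| = d\<close>. So degree \<open>-2\<close> is spanned by the constants \<open>a\<^sub>i\<close>, and
  \<open>[a\<^sub>i, b f] = - (\<partial>\<^sub>i b) f = b (\<partial>\<^bsub>y\<^sub>i\<^esub> f)\<close>. The three derivations are separated by a functional
  that reads off the coefficient of \<open>a\<^sub>1\<close>.
\<close>

section \<open>Evaluation of polynomials with values in a module\<close>

locale ring_map =
  fixes h :: "'a::comm_ring_1 \<Rightarrow> 'b::comm_ring_1"
  assumes map_add: "h (x + y) = h x + h y"
    and map_mult: "h (x * y) = h x * h y"
    and map_one: "h 1 = 1"
begin

sublocale Modules.additive h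
  by unfold_locales (rule map_add)

lemma map_prod: "h (prod f A) = (\<Prod>i\<in>A. h (f i))"
  by (induction A rule: infinite_finite_induct) (simp_all add: map_mult map_one)

lemma map_power: "h (x ^ n) = h x ^ n"
  by (induction n) (simp_all add: map_mult map_one)

lemma map_numeral: "h (numeral n) = numeral n"
  by (induction n) (simp_all only: numeral.simps map_add map_one)

lemmas map_simps = map_add map_mult map_one map_prod map_power map_numeral zero minus diff sum

end

lemma ring_map_compose: "ring_map g \<Longrightarrow> ring_map h \<Longrightarrow> ring_map (\<lambda>x. g (h x))"
  by (simp add: ring_map_def)

lemma mpower_0 [simp]: "mpower q 0 = 1"
  by (simp add: mpower_def)

lemma mpower_add: "mpower q (M + N) = mpower q M * mpower q N"
  by (simp add: mpower_def lookup_add power_add prod.distrib)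

lemma mpower_single: "mpower q (Poly_Mapping.single i 1) = q i"
proof -
  have "mpower q (Poly_Mapping.single i 1) = (\<Prod>j\<in>UNIV. if j = i then q j else 1)"
    unfolding mpower_def by (rule prod.cong) (auto simp: lookup_single when_def)
  then show ?thesis by simp
qed

definition ins :: "('a::zero \<Rightarrow> 's::comm_ring_1) \<Rightarrow> ('v::finite \<Rightarrow> 's) \<Rightarrow> ('v, 'a) rpoly \<Rightarrow> 's"
  where "ins f q x = (\<Sum>M\<in>Poly_Mapping.keys x. f (Poly_Mapping.lookup x M) * mpower q M)"

lemma ins_superset:
  assumes "finite A" "Poly_Mapping.keys x \<subseteq> A" "f 0 = 0"
  shows "ins f q x = (\<Sum>M\<in>A. f (Poly_Mapping.lookup x M) * mpower q M)"
  unfolding ins_def using assms by (intro sum.mono_neutral_left) (auto simp: in_keys_iff)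

lemma ins_single: "f 0 = 0 \<Longrightarrow> ins f q (Poly_Mapping.single M c) = f c * mpower q M"
  by (subst ins_superset[where A = "{M}"]) (auto simp: lookup_single)

lemma ins_0 [simp]: "ins f q 0 = 0"
  by (simp add: ins_def)

lemma additive_ins:
  fixes q :: "'v::finite \<Rightarrow> 's::comm_ring_1"
  assumes "Modules.additive f"
  shows "Modules.additive (ins f q)"
proof
  interpret Modules.additive f by fact
  fix x y :: "('v, 'a) rpoly"
  let ?A = "Poly_Mapping.keys x \<union> Poly_Mapping.keys y"
  have "Poly_Mapping.keys (x + y) \<subseteq> ?A" by (rule keys_add)
  then have "ins f q (x + y) = (\<Sum>M\<in>?A. f (Poly_Mapping.lookup (x + y) M) * mpower q M)"
    by (intro ins_superset) (auto simp: zero)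
  also have "\<dots> = (\<Sum>M\<in>?A. f (Poly_Mapping.lookup x M) * mpower q M)
      + (\<Sum>M\<in>?A. f (Poly_Mapping.lookup y M) * mpower q M)"
    by (simp add: lookup_add add distrib_right sum.distrib)
  also have "\<dots> = ins f q x + ins f q y"
    by (subst (1 2) ins_superset[where A = ?A]) (auto simp: zero)
  finally show "ins f q (x + y) = ins f q x + ins f q y" .
qed

lemma poly_mapping_sum_single:
  "x = (\<Sum>M\<in>Poly_Mapping.keys x. Poly_Mapping.single M (Poly_Mapping.lookup x M))"
  by (rule poly_mapping_eqI)
    (auto simp: lookup_sum lookup_single when_def in_keys_iff)

lemma ins_pact:
  assumes "Modules.additive g" "\<And>a r. g (act a r) = f a * g r"
  shows "ins g q (pact act p x) = ins f q p * ins g q x"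
proof -
  interpret Modules.additive g by fact
  interpret I: Modules.additive "ins g q" by (rule additive_ins) fact
  have "ins g q (pact act p x) = (\<Sum>m\<in>Poly_Mapping.keys p. \<Sum>n\<in>Poly_Mapping.keys x.
     (f (Poly_Mapping.lookup p m) * mpower q m) * (g (Poly_Mapping.lookup x n) * mpower q n))"
    by (simp add: pact_def I.sum ins_single zero assms(2) mpower_add mult_ac)
  also have "\<dots> = ins f q p * ins g q x"
    by (simp add: ins_def sum_product)
  finally show ?thesis .
qed

lemma mult_eq_pact: "p * x = pact (*) p (x :: ('v, 'a::comm_ring_1) rpoly)"
proof -
  have "p * x = (\<Sum>m\<in>Poly_Mapping.keys p. Poly_Mapping.single m (Poly_Mapping.lookup p m))
     * (\<Sum>n\<in>Poly_Mapping.keys x. Poly_Mapping.single n (Poly_Mapping.lookup x n))"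
    by (simp flip: poly_mapping_sum_single)
  also have "\<dots> = pact (*) p x"
    by (simp add: pact_def sum_product mult_single)
  finally show ?thesis .
qed

lemma ring_map_ins:
  fixes q :: "'v::finite \<Rightarrow> 's::comm_ring_1"
  assumes "ring_map f"
  shows "ring_map (ins f q)"
proof
  interpret ring_map f by fact
  interpret I: Modules.additive "ins f q" by (rule additive_ins) unfold_locales
  fix x y :: "('v, 'a) rpoly"
  show "ins f q (x + y) = ins f q x + ins f q y" by (rule I.add)
  show "ins f q (x * y) = ins f q x * ins f q y"
    unfolding mult_eq_pact[of x y] by (rule ins_pact) (unfold_locales, simp add: map_mult)
  show "ins f q 1 = 1"
    by (simp add: single_one[symmetric] ins_single zero map_one del: single_one)
qed

lemma (in ring_map) map_mpower: "h (mpower q M) = mpower (\<lambda>i. h (q i)) M"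
  by (simp add: mpower_def map_prod map_power)

lemma (in ring_map) map_ins: "h (ins f q x) = ins (\<lambda>c. h (f c)) (\<lambda>i. h (q i)) x"
  by (simp add: ins_def sum map_mult map_mpower)

lemma ins_pconst: "f 0 = 0 \<Longrightarrow> ins f q (pconst c) = f c"
  by (simp add: pconst_def ins_single)

lemma ins_pvar: "f 0 = 0 \<Longrightarrow> f 1 = 1 \<Longrightarrow> ins f q (pvar i) = q i"
  by (simp add: pvar_def ins_single mpower_single del: One_nat_def)

lemma ins_psubst:
  assumes "Modules.additive g" "\<And>a r. g (act a r) = f a * g r" "ring_map f"
  shows "ins g q (psubst act Q x) = ins g (\<lambda>i. ins f q (Q i)) x"
proof -
  interpret Modules.additive g by fact
  interpret I: Modules.additive "ins g q" by (rule additive_ins) fact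
  have "ins g q (psubst act Q x) = (\<Sum>M\<in>Poly_Mapping.keys x.
     ins f q (mpower Q M) * g (Poly_Mapping.lookup x M))"
    by (simp add: psubst_def I.sum ins_pact[OF assms(1,2)] ins_pconst zero)
  then show ?thesis
    by (simp add: ring_map.map_mpower[OF ring_map_ins[OF assms(3)]] mult.commute ins_def[of g])
qed

lemma ring_map_pconst: "ring_map (pconst :: 'a::comm_ring_1 \<Rightarrow> ('v, 'a) rpoly)"
  by unfold_locales (simp_all add: pconst_def single_add mult_single)

lemma pconst_0 [simp]: "pconst 0 = 0"
  by (simp add: pconst_def)

lemma mpower_pvar: "mpower pvar M = Poly_Mapping.single M (1 :: 'a::comm_ring_1)"
proof -
  have pow: "pvar i ^ n = Poly_Mapping.single (Poly_Mapping.single i n) (1 :: 'a)" for i :: 'b and n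
    by (induction n) (simp_all add: pvar_def mult_single flip: single_add)
  have pr: "(\<Prod>i\<in>A. Poly_Mapping.single (g i) (1 :: 'a)) = Poly_Mapping.single (\<Sum>i\<in>A. g i) 1"
    if "finite A" for A :: "'b set" and g :: "'b \<Rightarrow> 'b \<Rightarrow>\<^sub>0 nat"
    using that by induction (simp_all add: mult_single)
  have "(\<Sum>i\<in>UNIV. Poly_Mapping.single i (Poly_Mapping.lookup M i)) = M"
    by (rule poly_mapping_eqI) (simp add: lookup_sum lookup_single when_def)
  then show ?thesis
    by (simp add: mpower_def pow pr)
qed

lemma lookup_ins_pvar:
  assumes "f 0 = 0"
  shows "Poly_Mapping.lookup (ins (\<lambda>c. pconst (f c)) pvar x) M = f (Poly_Mapping.lookup x M)"
proof -
  have "ins (\<lambda>c. pconst (f c)) pvar x =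
      (\<Sum>N\<in>Poly_Mapping.keys x. Poly_Mapping.single N (f (Poly_Mapping.lookup x N)))"
    by (simp add: ins_def mpower_pvar pconst_def mult_single)
  then show ?thesis
    using assms by (auto simp: lookup_sum lookup_single when_def in_keys_iff)
qed

lemma ins_pconst_pvar: "ins pconst pvar x = (x :: ('v::finite, 'a::comm_ring_1) rpoly)"
  by (rule poly_mapping_eqI) (use lookup_ins_pvar[of "\<lambda>c. c" x] in simp)

section \<open>Coordinates on RE(3,8)\<close>

lemma index3 [simp]: "(4::3) = 1" "(5::3) = 2"
  by simp_all

datatype coord = CA 3 | CB 3 | CE | CF | CH | CV 2 | CD 3 2

lemma all_coord:
  "(\<forall>c. Q c) \<longleftrightarrow> Q (CA 1) \<and> Q (CA 2) \<and> Q (CA 3) \<and> Q (CB 1) \<and> Q (CB 2) \<and> Q (CB 3)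
    \<and> Q CE \<and> Q CF \<and> Q CH \<and> Q (CV 1) \<and> Q (CV 2)
    \<and> Q (CD 1 1) \<and> Q (CD 2 1) \<and> Q (CD 3 1) \<and> Q (CD 1 2) \<and> Q (CD 2 2) \<and> Q (CD 3 2)"
proof (intro iffI allI)
  fix c
  assume Q: "Q (CA 1) \<and> Q (CA 2) \<and> Q (CA 3) \<and> Q (CB 1) \<and> Q (CB 2) \<and> Q (CB 3)
    \<and> Q CE \<and> Q CF \<and> Q CH \<and> Q (CV 1) \<and> Q (CV 2)
    \<and> Q (CD 1 1) \<and> Q (CD 2 1) \<and> Q (CD 3 1) \<and> Q (CD 1 2) \<and> Q (CD 2 2) \<and> Q (CD 3 2)"
  have "Q (CA i)" "Q (CB i)" "Q (CV l)" "Q (CD i l)" for i l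
    using exhaust_3[of i] exhaust_2[of l] Q by auto
  then show "Q c" using Q by (cases c) simp_all
qed blast

definition crs :: "(3 \<Rightarrow> 's::comm_ring_1) \<Rightarrow> (3 \<Rightarrow> 's) \<Rightarrow> 3 \<Rightarrow> 's"
  where "crs x y i = x (i + 1) * y (i + 2) - x (i + 2) * y (i + 1)"

lemma crs_simps [simp]:
  "crs x y 1 = x 2 * y 3 - x 3 * y 2"
  "crs x y 2 = x 3 * y 1 - x 1 * y 3"
  "crs x y 3 = x 1 * y 2 - x 2 * y 1"
  by (simp_all add: crs_def)

definition cb :: "(coord \<Rightarrow> 's) \<Rightarrow> 3 \<Rightarrow> 's"
  where "cb X i = X (CB i)"

definition curl :: "(3 \<Rightarrow> 's::comm_ring_1) \<Rightarrow> (coord \<Rightarrow> 's) \<Rightarrow> coord \<Rightarrow> 's"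
  where "curl p X c = (case c of CB i \<Rightarrow> crs p (cb X) i | _ \<Rightarrow> X c)"

lemma curl_add: "curl p (\<lambda>c. X c + Y c) c = curl p X c + curl p Y c"
  by (cases c) (simp_all add: curl_def crs_def cb_def algebra_simps)

lemma curl_mult: "curl p (\<lambda>c. k * X c) c = k * curl p X c"
  by (cases c) (simp_all add: curl_def crs_def cb_def algebra_simps)

lemma (in ring_map) map_crs: "h (crs x y i) = crs (\<lambda>i. h (x i)) (\<lambda>i. h (y i)) i"
  by (simp add: crs_def map_simps)

lemma (in ring_map) map_curl: "h (curl p X c) = curl (\<lambda>i. h (p i)) (\<lambda>c. h (X c)) c"
  by (cases c) (simp_all add: curl_def crs_def cb_def map_simps)

text \<open>
  The relation \<open>\<Sum> \<partial>\<^sub>i b\<^sub>i = 0\<close> is removed by recording the curl \<open>\<partial> \<times> b\<close> instead of \<open>b\<close>: the curl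
  vanishes exactly on the multiples of \<open>\<partial>\<close>.
\<close>

definition raw_coord :: "'f::field re38_free \<Rightarrow> coord \<Rightarrow> 'f dpoly"
  where "raw_coord x c = (case c of
      CA i \<Rightarrow> Poly_Mapping.lookup x (Ga i)
    | CB i \<Rightarrow> Poly_Mapping.lookup x (Gb i)
    | CE \<Rightarrow> Poly_Mapping.lookup x GE
    | CF \<Rightarrow> Poly_Mapping.lookup x GF
    | CH \<Rightarrow> Poly_Mapping.lookup x GH
    | CV l \<Rightarrow> Poly_Mapping.lookup x (Ge l)
    | CD t l \<Rightarrow> Poly_Mapping.lookup x (Gd (t + 1) (t + 2) l)
        - Poly_Mapping.lookup x (Gd (t + 2) (t + 1) l))"

lemma raw_coord_add: "raw_coord (x + y) = (\<lambda>c. raw_coord x c + raw_coord y c)"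
  by (rule ext) (simp add: raw_coord_def lookup_add split: coord.split)

lemma raw_coord_act: "raw_coord (free_act p x) = (\<lambda>c. p * raw_coord x c)"
  by (rule ext) (simp add: raw_coord_def algebra_simps split: coord.split)

lemma module_re38_act: "module (re38_act :: 'f::field dpoly \<Rightarrow> _)"
proof
  interpret module "free_act :: 'f dpoly \<Rightarrow> _" by (rule module_free_act)
  fix a b :: "'f dpoly" and x y :: "'f re38"
  show "re38_act a (x + y) = re38_act a x + re38_act a y"
    by transfer (simp add: re38_cong_def scale_right_distrib span_zero)
  show "re38_act (a + b) x = re38_act a x + re38_act b x"
    by transfer (simp add: re38_cong_def scale_left_distrib span_zero)
  show "re38_act a (re38_act b x) = re38_act (a * b) x"
    by transfer (simp add: re38_cong_def span_zero)
  show "re38_act 1 x = x"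
    by transfer (simp add: re38_cong_def span_zero)
qed

global_interpretation re38: module "re38_act :: 'f::field dpoly \<Rightarrow> _"
  by (rule module_re38_act)

lift_definition coord :: "'f::field re38 \<Rightarrow> coord \<Rightarrow> 'f dpoly"
  is "\<lambda>x. curl pvar (raw_coord x)"
proof
  fix x y :: "'f re38_free" and c
  interpret module "free_act :: 'f dpoly \<Rightarrow> _" by (rule module_free_act)
  let ?\<kappa> = "\<lambda>x. curl pvar (raw_coord x)"
  have add: "?\<kappa> (x + y) c = ?\<kappa> x c + ?\<kappa> y c" for x y :: "'f re38_free"
    by (simp add: raw_coord_add curl_add)
  have act: "?\<kappa> (free_act p x) c = p * ?\<kappa> x c" for p and x :: "'f re38_free"
    by (simp add: raw_coord_act curl_mult)
  have rel: "\<forall>c. ?\<kappa> r c = 0" if "r \<in> re38_relations" for r :: "'f re38_free"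
    using that unfolding re38_relations_def all_coord
    by (auto simp: raw_coord_def curl_def cb_def free_gen_def lookup_add
        lookup_single sum_3 when_def mult.commute)
  have zero: "?\<kappa> r c = 0" if "r \<in> span re38_relations" for r
    using that by (induction rule: span_induct_alt) (simp_all add: add act rel, simp add: raw_coord_def curl_def crs_def cb_def split: coord.split)
  assume "re38_cong x y"
  then have "?\<kappa> (x - y) c = 0"
    by (simp add: re38_cong_def zero)
  moreover have "?\<kappa> x c = ?\<kappa> (x - y) c + ?\<kappa> y c"
    by (simp flip: add)
  ultimately show "?\<kappa> x c = ?\<kappa> y c" by simp
qed

lemma coord_add: "coord (x + y) c = coord x c + coord y c"
  by transfer (simp add: raw_coord_add curl_add)

lemma coord_act: "coord (re38_act p x) c = p * coord x c"
  by transfer (simp add: raw_coord_act curl_mult)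

lemma additive_coord: "Modules.additive (\<lambda>x. coord x c)"
  by unfold_locales (rule coord_add)

global_interpretation coord: Modules.additive "\<lambda>x. coord x c" for c
  by (rule additive_coord)

lemma coord_gen:
  "coord (gen g) c = curl pvar (raw_coord (free_gen g)) c"
  by transfer simp

lemma re38_induct [case_names zero add act]:
  fixes x :: "'f::field re38"
  assumes zero: "P 0" and add: "\<And>x y. P x \<Longrightarrow> P y \<Longrightarrow> P (x + y)"
    and act: "\<And>p g. P (re38_act p (gen g))"
  shows "P x"
proof -
  have P_sum: "P (abs_re38 (\<Sum>g\<in>A. Poly_Mapping.single g (f g)))" if "finite A" for A and f :: "_ \<Rightarrow> 'f dpoly"
    using that
  proof induction
    case empty
    then show ?case using zero by (simp add: zero_re38_def)
  next
    case (insert g A)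
    have "free_act (f g) (free_gen g) = Poly_Mapping.single g (f g)"
      by (rule poly_mapping_eqI) (simp add: free_gen_def lookup_single when_def)
    then have "re38_act (f g) (gen g) = abs_re38 (Poly_Mapping.single g (f g))"
      by (simp add: gen_def re38_act.abs_eq)
    then have "P (abs_re38 (Poly_Mapping.single g (f g)))"
      using act by metis
    then show ?case using insert add by (simp flip: plus_re38.abs_eq)
  qed
  obtain y where "x = abs_re38 y" using Quotient_abs_rep[OF Quotient_re38] by metis
  then show ?thesis
    using P_sum[of "Poly_Mapping.keys y" "Poly_Mapping.lookup y"] by (simp flip: poly_mapping_sum_single)
qed

lemma relation_b: "(\<Sum>i\<in>UNIV. re38_act (pvar i) (gen (Gb i))) = (0 :: 'f::field re38)"
proof -
  interpret module "free_act :: 'f dpoly \<Rightarrow> _" by (rule module_free_act)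
  have "re38_act (pvar 1) (gen (Gb 1)) + re38_act (pvar 2) (gen (Gb 2)) + re38_act (pvar 3) (gen (Gb 3)) = (0 :: 'f re38)"
    by transfer (auto simp: re38_cong_def re38_relations_def sum_3 intro!: span_base)
  then show ?thesis by (simp add: sum_3)
qed

lemma gen_d_swap: "gen (Gd k h l) = - (gen (Gd h k l) :: 'f::field re38)"
proof -
  interpret module "free_act :: 'f dpoly \<Rightarrow> _" by (rule module_free_act)
  have "gen (Gd k h l) + gen (Gd h k l) = (0 :: 'f re38)"
    by transfer (auto simp: re38_cong_def re38_relations_def intro!: span_base)
  then show ?thesis by (simp add: eq_neg_iff_add_eq_0)
qed

lemma gen_d_diag: "gen (Gd h h l) = (0 :: 'f::field_char_0 re38)"
proof -
  let ?g = "gen (Gd h h l) :: 'f re38"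
  have "pconst (1/2) + pconst (1/2) = (1 :: 'f dpoly)"
    by (simp add: pconst_def flip: single_add)
  then have "?g = re38_act (pconst (1/2) + pconst (1/2)) ?g" by simp
  also have "\<dots> = re38_act (pconst (1/2)) (?g + ?g)"
    by (simp only: re38.scale_left_distrib re38.scale_right_distrib)
  also have "?g + ?g = 0"
    using gen_d_swap[of h h l] by (simp add: eq_neg_iff_add_eq_0)
  finally show ?thesis by simp
qed

definition lin :: "(coord \<Rightarrow> 'f dpoly) \<Rightarrow> 'f::field re38"
  where "lin P = (\<Sum>i\<in>UNIV. re38_act (P (CA i)) (gen (Ga i))) + (\<Sum>i\<in>UNIV. re38_act (P (CB i)) (gen (Gb i)))
    + re38_act (P CE) (gen GE) + re38_act (P CF) (gen GF) + re38_act (P CH) (gen GH)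
    + (\<Sum>l\<in>UNIV. re38_act (P (CV l)) (gen (Ge l)))
    + (\<Sum>t\<in>UNIV. \<Sum>l\<in>UNIV. re38_act (P (CD t l)) (gen (Gd (t + 1) (t + 2) l)))"

lemma lin_add: "lin (\<lambda>c. P c + Q c) = lin P + lin Q"
  by (simp add: lin_def re38.scale_left_distrib sum.distrib)

lemma lin_act: "lin (\<lambda>c. p * P c) = re38_act p (lin P)"
  by (simp add: lin_def re38.scale_right_distrib re38.scale_sum_right re38.scale_scale)

lemma coord_lin: "coord (lin P) c = curl pvar P c"
proof -
  have "\<forall>c. coord (lin P) c = curl pvar P c"
    unfolding all_coord
    by (simp add: lin_def coord.add coord.sum coord_act coord_gen curl_def cb_def raw_coord_def
      free_gen_def lookup_single when_def sum_3 sum_2 algebra_simps)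
  then show ?thesis ..
qed

lemma ex_lin: "\<exists>P. x = (lin P :: 'f::field_char_0 re38)"
proof (induction x rule: re38_induct)
  case zero
  have "lin (\<lambda>c. 0) = (0 :: 'f re38)" by (simp add: lin_def)
  then show ?case by metis
next
  case (add x y)
  then show ?case by (metis lin_add)
next
  case (act p g)
  have lin_gen: "\<exists>P. gen g = (lin P :: 'f re38)" if "lin (\<lambda>d. k * of_bool (d = c)) = (gen g :: 'f re38)" for k c
    using that by metis
  have d: "gen (Gd h k l) = (lin (\<lambda>d. of_bool (d = CD t l)) :: 'f re38)" if "h = t + 1" "k = t + 2" for h k l t
    using that exhaust_3[of t] exhaust_2[of l] by (auto simp: lin_def sum_3 sum_2)
  have neg: "(\<exists>P. gen (Gd h k l) = (lin P :: 'f re38)) \<longleftrightarrow> (\<exists>P. gen (Gd k h l) = (lin P :: 'f re38))" for h k l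
    by (metis gen_d_swap lin_act re38.scale_minus_left re38.scale_one)
  have "\<exists>P. gen g = (lin P :: 'f re38)"
  proof (cases g)
    case (Ga i)
    then have "gen g = (lin (\<lambda>d. of_bool (d = CA i)) :: 'f re38)"
      using exhaust_3[of i] by (auto simp: lin_def sum_3 sum_2)
    then show ?thesis by blast
  next
    case (Gb i)
    then have "gen g = (lin (\<lambda>d. of_bool (d = CB i)) :: 'f re38)"
      using exhaust_3[of i] by (auto simp: lin_def sum_3 sum_2)
    then show ?thesis by blast
  next
    case GE
    then have "gen g = (lin (\<lambda>d. of_bool (d = CE)) :: 'f re38)"
      by (auto simp: lin_def sum_3 sum_2)
    then show ?thesis by blast
  next
    case GF
    then have "gen g = (lin (\<lambda>d. of_bool (d = CF)) :: 'f re38)"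
      by (auto simp: lin_def sum_3 sum_2)
    then show ?thesis by blast
  next
    case GH
    then have "gen g = (lin (\<lambda>d. of_bool (d = CH)) :: 'f re38)"
      by (auto simp: lin_def sum_3 sum_2)
    then show ?thesis by blast
  next
    case (Ge l)
    then have "gen g = (lin (\<lambda>d. of_bool (d = CV l)) :: 'f re38)"
      using exhaust_2[of l] by (auto simp: lin_def sum_3 sum_2)
    then show ?thesis by blast
  next
    case (Gd h k l)
    consider "h = k" | "k = h + 1" | "h = k + 1"
      using exhaust_3[of h] exhaust_3[of k] by auto
    then show ?thesis
    proof cases
      case 1
      have "lin (\<lambda>c. 0) = (0 :: 'f re38)" by (simp add: lin_def)
      with 1 Gd show ?thesis by (metis gen_d_diag)
    next
      case 2
      then show ?thesis
        unfolding Gd using exhaust_3[of h] by (intro exI) (rule d[of _ "h + 2"], auto)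
    next
      case 3
      then show ?thesis
        unfolding Gd neg[of h k] using exhaust_3[of k] by (intro exI) (rule d[of _ "k + 2"], auto)
    qed
  qed
  then show ?case by (metis lin_act)
qed

lemma lookup_mult_pvar:
  "Poly_Mapping.lookup (p * pvar i) M =
    (if Poly_Mapping.lookup M i = 0 then 0
     else Poly_Mapping.lookup (p :: ('v, 'a::comm_ring_1) rpoly) (M - Poly_Mapping.single i 1))"
proof -
  have eq: "N + Poly_Mapping.single i 1 = M \<longleftrightarrow>
      Poly_Mapping.lookup M i \<noteq> 0 \<and> N = M - Poly_Mapping.single i 1" for N
    by (auto simp: poly_mapping_eq_iff fun_eq_iff lookup_add lookup_minus lookup_single when_def split: if_splits)
  have "p * pvar i = (\<Sum>N\<in>Poly_Mapping.keys p. Poly_Mapping.single N (Poly_Mapping.lookup p N)) * pvar i"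
    by (simp flip: poly_mapping_sum_single)
  also have "\<dots> = (\<Sum>N\<in>Poly_Mapping.keys p. Poly_Mapping.single (N + Poly_Mapping.single i 1) (Poly_Mapping.lookup p N))"
    by (simp add: pvar_def sum_distrib_right mult_single)
  finally show ?thesis
    by (auto simp: lookup_sum lookup_single when_def eq in_keys_iff simp del: One_nat_def)
qed

lemma pvar_dvd:
  fixes p :: "('v, 'a::comm_ring_1) rpoly"
  assumes "\<And>M. Poly_Mapping.lookup M i = 0 \<Longrightarrow> Poly_Mapping.lookup p M = 0"
  shows "\<exists>u. p = u * pvar i"
proof
  have "M - Poly_Mapping.single i 1 + Poly_Mapping.single i 1 = M" if "M \<in> Poly_Mapping.keys p" for M
    using assms[of M] that
    by (intro poly_mapping_eqI) (auto simp: lookup_add lookup_minus lookup_single when_def in_keys_iff intro!: Suc_pred)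
  then have "(\<Sum>M\<in>Poly_Mapping.keys p. Poly_Mapping.single (M - Poly_Mapping.single i 1) (Poly_Mapping.lookup p M)) * pvar i
      = (\<Sum>M\<in>Poly_Mapping.keys p. Poly_Mapping.single M (Poly_Mapping.lookup p M))"
    by (simp add: sum_distrib_right mult_single pvar_def)
  then show "p = (\<Sum>M\<in>Poly_Mapping.keys p. Poly_Mapping.single (M - Poly_Mapping.single i 1) (Poly_Mapping.lookup p M)) * pvar i"
    by (simp flip: poly_mapping_sum_single)
qed

lemma pvar_neq_0: "pvar i \<noteq> (0 :: ('v, 'a::comm_ring_1) rpoly)"
  unfolding pvar_def by (metis lookup_single_eq lookup_zero zero_neq_one)

lemma crs_pvar_eq_0:
  fixes y :: "3 \<Rightarrow> 'f::field dpoly"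
  assumes "\<And>i. crs pvar y i = 0"
  shows "\<exists>u. \<forall>i. y i = u * pvar i"
proof -
  have 12: "y 1 * pvar 2 = y 2 * pvar 1" and 13: "y 1 * pvar 3 = y 3 * pvar 1"
    using assms[of 3] assms[of 2] by (simp_all add: mult.commute)
  have "\<exists>u. y 1 = u * pvar 1"
  proof (rule pvar_dvd)
    show "Poly_Mapping.lookup (y 1) M = 0" if "Poly_Mapping.lookup M 1 = 0" for M :: expo
    proof -
      have "Poly_Mapping.lookup (y 1) M = Poly_Mapping.lookup (y 1 * pvar 2) (M + Poly_Mapping.single 2 1)"
        by (simp add: lookup_mult_pvar lookup_add)
      also have "\<dots> = 0"
        unfolding 12 using that by (simp add: lookup_mult_pvar lookup_add lookup_single)
      finally show ?thesis .
    qed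
  qed
  then obtain u where u: "y 1 = u * pvar 1" ..
  have "pvar 1 \<noteq> (0 :: 'f dpoly)" by (rule pvar_neq_0)
  moreover have "y 2 * pvar 1 = (u * pvar 2) * pvar 1" "y 3 * pvar 1 = (u * pvar 3) * pvar 1"
    unfolding 12[symmetric] 13[symmetric] u by (simp_all only: mult_ac)
  ultimately have "y 2 = u * pvar 2" "y 3 = u * pvar 3"
    by (metis mult_cancel_right)+
  with u have "\<forall>i. y i = u * pvar i" by (metis exhaust_3)
  then show ?thesis ..
qed

lemma coord_eq_0:
  fixes x :: "'f::field_char_0 re38"
  assumes "\<And>c. coord x c = 0"
  shows "x = 0"
proof -
  obtain P where x: "x = lin P" using ex_lin by blast
  have curl: "curl pvar P c = 0" for c
    using assms[of c] by (simp add: x coord_lin)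
  have P: "P (CA i) = 0" "P CE = 0" "P CF = 0" "P CH = 0" "P (CV l) = 0" "P (CD i l) = 0" for i l
    using curl[of "CA i"] curl[of CE] curl[of CF] curl[of CH] curl[of "CV l"] curl[of "CD i l"]
    by (simp_all add: curl_def)
  have "crs pvar (cb P) i = 0" for i
    using curl[of "CB i"] by (simp add: curl_def)
  then obtain u where "\<And>i. P (CB i) = u * pvar i"
    using crs_pvar_eq_0 unfolding cb_def by blast
  then have "x = re38_act u (\<Sum>i\<in>UNIV. re38_act (pvar i) (gen (Gb i)))"
    by (simp add: x lin_def P re38.scale_sum_right re38.scale_scale)
  then show ?thesis by (simp add: relation_b)
qed

lemma coord_eqI: "(\<And>c. coord x c = coord y c) \<Longrightarrow> x = (y :: 'f::field_char_0 re38)"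
  using coord_eq_0[of "x - y"] by (simp add: coord.diff)

lemma coord_CB: "\<exists>\<beta>. \<forall>i. coord (x :: 'f::field_char_0 re38) (CB i) = crs pvar \<beta> i"
proof -
  obtain P where "x = lin P" using ex_lin by blast
  then have "\<forall>i. coord x (CB i) = crs pvar (cb P) i"
    by (simp add: coord_lin curl_def)
  then show ?thesis by (intro exI[of _ "cb P"])
qed

section \<open>The bracket in coordinates\<close>

definition dt :: "(3 \<Rightarrow> 's::comm_ring_1) \<Rightarrow> (3 \<Rightarrow> 's) \<Rightarrow> 's"
  where "dt x y = x 1 * y 1 + x 2 * y 2 + x 3 * y 3"

definition om :: "(2 \<Rightarrow> 's::comm_ring_1) \<Rightarrow> (2 \<Rightarrow> 's) \<Rightarrow> 's"
  where "om v w = v 1 * w 2 - v 2 * w 1"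

definition ca :: "(coord \<Rightarrow> 's) \<Rightarrow> 3 \<Rightarrow> 's"
  where "ca X i = X (CA i)"

definition cv :: "(coord \<Rightarrow> 's) \<Rightarrow> 2 \<Rightarrow> 's"
  where "cv X l = X (CV l)"

definition cd :: "(coord \<Rightarrow> 's) \<Rightarrow> 3 \<Rightarrow> 2 \<Rightarrow> 's"
  where "cd X i l = X (CD i l)"

definition sl_act :: "(coord \<Rightarrow> 's::comm_ring_1) \<Rightarrow> (2 \<Rightarrow> 's) \<Rightarrow> 2 \<Rightarrow> 's"
  where "sl_act X v l = (if l = 1 then X CH * v 1 + X CE * v 2 else X CF * v 1 - X CH * v 2)"

definition bkt_ee :: "(3 \<Rightarrow> 's::comm_ring_1) \<Rightarrow> (3 \<Rightarrow> 's) \<Rightarrow> (coord \<Rightarrow> 's) \<Rightarrow> (coord \<Rightarrow> 's) \<Rightarrow> coord \<Rightarrow> 's"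
  where "bkt_ee \<xi> \<eta> X Y c = (let l = \<lambda>k. 2 * dt (ca Y) \<xi> * X k - 2 * dt (ca X) \<eta> * Y k in case c of
     CA i \<Rightarrow> l (CA i)
   | CE \<Rightarrow> l CE + 4 * (X CH * Y CE - X CE * Y CH)
   | CF \<Rightarrow> l CF + 4 * (X CF * Y CH - X CH * Y CF)
   | CH \<Rightarrow> l CH + 2 * (X CE * Y CF - X CF * Y CE)
   | CB i \<Rightarrow> (dt (ca X) \<xi> * dt (ca Y) \<eta> - 2 * (X CE * Y CF + X CF * Y CE + 2 * (X CH * Y CH))) * \<xi> i
        + 2 * crs (ca X) (cb Y) i - 2 * crs (ca Y) (cb X) i
   | _ \<Rightarrow> 0)"

definition bkt_eo :: "(3 \<Rightarrow> 's::comm_ring_1) \<Rightarrow> (3 \<Rightarrow> 's) \<Rightarrow> (coord \<Rightarrow> 's) \<Rightarrow> (coord \<Rightarrow> 's) \<Rightarrow> coord \<Rightarrow> 's"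
  where "bkt_eo \<xi> \<eta> X Y c = (case c of
     CV l \<Rightarrow> (dt (ca X) \<xi> - 2 * dt (ca X) \<eta>) * Y (CV l) + 2 * sl_act X (cv Y) l
   | CD i l \<Rightarrow> 2 * crs \<xi> \<eta> i * sl_act X (cv Y) l - dt (ca X) \<xi> * crs \<xi> \<eta> i * Y (CV l)
       + 2 * sl_act X (cd Y i) l + 2 * X (CB i) * Y (CV l)
       - (dt (ca X) \<xi> + 2 * dt (ca X) \<eta>) * Y (CD i l)
       + 2 * X (CA i) * dt \<xi> (\<lambda>t. Y (CD t l))
   | _ \<Rightarrow> 0)"

definition bkt_oo :: "(3 \<Rightarrow> 's::comm_ring_1) \<Rightarrow> (3 \<Rightarrow> 's) \<Rightarrow> (coord \<Rightarrow> 's) \<Rightarrow> (coord \<Rightarrow> 's) \<Rightarrow> coord \<Rightarrow> 's"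
  where "bkt_oo \<xi> \<eta> X Y c = (let vy = \<lambda>i. om (cv X) (cd Y i); vx = \<lambda>i. om (cv Y) (cd X i) in case c of
     CA i \<Rightarrow> 2 * (om (cv X) (cv Y) * crs \<xi> \<eta> i + vy i + vx i)
   | CE \<Rightarrow> 2 * dt (\<lambda>i. \<eta> i - \<xi> i) (\<lambda>i. X (CV 1) * Y (CD i 1) - Y (CV 1) * X (CD i 1))
   | CF \<Rightarrow> 2 * dt (\<lambda>i. \<eta> i - \<xi> i) (\<lambda>i. Y (CV 2) * X (CD i 2) - X (CV 2) * Y (CD i 2))
   | CH \<Rightarrow> dt (\<lambda>i. \<eta> i - \<xi> i) (\<lambda>i. Y (CV 1) * X (CD i 2) + Y (CV 2) * X (CD i 1)
          - X (CV 1) * Y (CD i 2) - X (CV 2) * Y (CD i 1))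
   | CB i \<Rightarrow> 2 * (dt vy \<eta> - dt vx \<xi>) * \<xi> i
        + 2 * om (cd X (i + 1)) (cd Y (i + 2)) - 2 * om (cd X (i + 2)) (cd Y (i + 1))
   | _ \<Rightarrow> 0)"

text \<open>
  In \<open>[x\<^sub>\<lambda> y]\<close> the coefficients of \<open>x\<close> are evaluated at \<open>\<xi> = - \<lambda>\<close>, those of \<open>y\<close> at \<open>\<eta> = \<lambda> + \<partial>\<close>,
  and the result lives at \<open>\<partial> = \<xi> + \<eta>\<close>: the \<open>\<lambda>\<close>-bracket becomes an ordinary bracket of vectors that carry
  additive momenta. The factor 2 clears denominators; the output at \<open>CB i\<close> is a coefficient
  of \<open>b\<^sub>i\<close>, whereas the input there is a curl.
\<close>

definition bkt :: "(3 \<Rightarrow> 's::comm_ring_1) \<Rightarrow> (3 \<Rightarrow> 's) \<Rightarrow> (coord \<Rightarrow> 's) \<Rightarrow> (coord \<Rightarrow> 's) \<Rightarrow> coord \<Rightarrow> 's"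
  where "bkt \<xi> \<eta> X Y c = bkt_ee \<xi> \<eta> X Y c + bkt_eo \<xi> \<eta> X Y c - bkt_eo \<eta> \<xi> Y X c + bkt_oo \<xi> \<eta> X Y c"

definition cbkt :: "(3 \<Rightarrow> 's::comm_ring_1) \<Rightarrow> (3 \<Rightarrow> 's) \<Rightarrow> (coord \<Rightarrow> 's) \<Rightarrow> (coord \<Rightarrow> 's) \<Rightarrow> coord \<Rightarrow> 's"
  where "cbkt \<xi> \<eta> X Y = curl (\<lambda>i. \<xi> i + \<eta> i) (bkt \<xi> \<eta> X Y)"

lemmas bkt_defs = bkt_def bkt_ee_def bkt_eo_def bkt_oo_def ca_def cb_def cv_def cd_def
  dt_def om_def sl_act_def Let_def

lemmas cbkt_defs = cbkt_def curl_def bkt_defs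

definition coord_parity :: "coord \<Rightarrow> bit"
  where "coord_parity c = (case c of CV l \<Rightarrow> 1 | CD t l \<Rightarrow> 1 | _ \<Rightarrow> 0)"

definition parity_vec :: "bit \<Rightarrow> (coord \<Rightarrow> 's::zero) \<Rightarrow> bool"
  where "parity_vec p X \<longleftrightarrow> (\<forall>c. coord_parity c \<noteq> p \<longrightarrow> X c = 0)"

lemma parity_vec_0: "parity_vec 0 X \<longleftrightarrow> (\<forall>l. X (CV l) = 0) \<and> (\<forall>t l. X (CD t l) = 0)"
  by (auto simp: parity_vec_def coord_parity_def split: coord.splits)

lemma parity_vec_1: "parity_vec 1 X \<longleftrightarrow> (\<forall>i. X (CA i) = 0) \<and> (\<forall>i. X (CB i) = 0) \<and> X CE = 0 \<and> X CF = 0 \<and> X CH = 0"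
  by (auto simp: parity_vec_def coord_parity_def split: coord.splits)

lemma bkt_add_left: "bkt \<xi> \<eta> (\<lambda>c. X c + X' c) Y c = bkt \<xi> \<eta> X Y c + bkt \<xi> \<eta> X' Y c"
proof -
  have "\<forall>c. bkt \<xi> \<eta> (\<lambda>c. X c + X' c) Y c = bkt \<xi> \<eta> X Y c + bkt \<xi> \<eta> X' Y c"
    unfolding all_coord by (intro conjI; simp add: bkt_defs algebra_simps)
  then show ?thesis ..
qed

lemma bkt_add_right: "bkt \<xi> \<eta> X (\<lambda>c. Y c + Y' c) c = bkt \<xi> \<eta> X Y c + bkt \<xi> \<eta> X Y' c"
proof -
  have "\<forall>c. bkt \<xi> \<eta> X (\<lambda>c. Y c + Y' c) c = bkt \<xi> \<eta> X Y c + bkt \<xi> \<eta> X Y' c"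
    unfolding all_coord by (intro conjI; simp add: bkt_defs algebra_simps)
  then show ?thesis ..
qed

lemma bkt_mult_left: "bkt \<xi> \<eta> (\<lambda>c. k * X c) Y c = k * bkt \<xi> \<eta> X Y c"
proof -
  have "\<forall>c. bkt \<xi> \<eta> (\<lambda>c. k * X c) Y c = k * bkt \<xi> \<eta> X Y c"
    unfolding all_coord by (intro conjI; simp add: bkt_defs algebra_simps)
  then show ?thesis ..
qed

lemma bkt_mult_right: "bkt \<xi> \<eta> X (\<lambda>c. k * Y c) c = k * bkt \<xi> \<eta> X Y c"
proof -
  have "\<forall>c. bkt \<xi> \<eta> X (\<lambda>c. k * Y c) c = k * bkt \<xi> \<eta> X Y c"
    unfolding all_coord by (intro conjI; simp add: bkt_defs algebra_simps)
  then show ?thesis ..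
qed

lemma (in ring_map) map_bkt:
  "h (bkt \<xi> \<eta> X Y c) = bkt (\<lambda>i. h (\<xi> i)) (\<lambda>i. h (\<eta> i)) (\<lambda>c. h (X c)) (\<lambda>c. h (Y c)) c"
  by (cases c) (simp_all add: bkt_defs crs_def map_simps)

lemma cbkt_add_left: "cbkt \<xi> \<eta> (\<lambda>c. X c + X' c) Y c = cbkt \<xi> \<eta> X Y c + cbkt \<xi> \<eta> X' Y c"
  unfolding cbkt_def curl_add[symmetric] by (simp add: bkt_add_left[abs_def])

lemma cbkt_add_right: "cbkt \<xi> \<eta> X (\<lambda>c. Y c + Y' c) c = cbkt \<xi> \<eta> X Y c + cbkt \<xi> \<eta> X Y' c"
  unfolding cbkt_def curl_add[symmetric] by (simp add: bkt_add_right[abs_def])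

lemma cbkt_mult_left: "cbkt \<xi> \<eta> (\<lambda>c. k * X c) Y c = k * cbkt \<xi> \<eta> X Y c"
  unfolding cbkt_def curl_mult[symmetric] by (simp add: bkt_mult_left[abs_def])

lemma cbkt_mult_right: "cbkt \<xi> \<eta> X (\<lambda>c. k * Y c) c = k * cbkt \<xi> \<eta> X Y c"
  unfolding cbkt_def curl_mult[symmetric] by (simp add: bkt_mult_right[abs_def])

lemma cbkt_skew:
  assumes "parity_vec p X" "parity_vec q Y"
  shows "cbkt \<eta> \<xi> Y X c = - koszul p q (cbkt \<xi> \<eta> X Y c)"
proof -
  have "\<forall>c. cbkt \<eta> \<xi> Y X c = - koszul p q (cbkt \<xi> \<eta> X Y c)"
    using assms unfolding all_coord
    by (cases p; cases q; clarsimp simp: parity_vec_0 parity_vec_1 koszul_def cbkt_defs algebra_simps)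
  then show ?thesis ..
qed

lemma cbkt_parity:
  assumes "parity_vec p X" "parity_vec q Y"
  shows "parity_vec (p + q) (cbkt \<xi> \<eta> X Y)"
  using assms
  by (cases p; cases q) (auto simp: parity_vec_0 parity_vec_1 cbkt_defs crs_def)

lemma cbkt_jacobi_ee:
  fixes X Y Z :: "coord \<Rightarrow> 's::idom"
  assumes "parity_vec 0 X" "parity_vec 0 Y"
    and [simp]: "\<And>i. X (CB i) = crs \<xi> bx i" "\<And>i. Y (CB i) = crs \<eta> by i" "\<And>i. Z (CB i) = crs \<zeta> bz i"
  shows "cbkt \<xi> (\<lambda>i. \<eta> i + \<zeta> i) X (cbkt \<eta> \<zeta> Y Z) c =
     cbkt (\<lambda>i. \<xi> i + \<eta> i) \<zeta> (cbkt \<xi> \<eta> X Y) Z c + cbkt \<eta> (\<lambda>i. \<xi> i + \<zeta> i) Y (cbkt \<xi> \<zeta> X Z) c"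
proof -
  have [simp]: "X (CV l) = 0" "X (CD t l) = 0" "Y (CV l) = 0" "Y (CD t l) = 0" for t l
    using assms(1,2) by (simp_all add: parity_vec_0)
  have "\<forall>c. cbkt \<xi> (\<lambda>i. \<eta> i + \<zeta> i) X (cbkt \<eta> \<zeta> Y Z) c =
     cbkt (\<lambda>i. \<xi> i + \<eta> i) \<zeta> (cbkt \<xi> \<eta> X Y) Z c + cbkt \<eta> (\<lambda>i. \<xi> i + \<zeta> i) Y (cbkt \<xi> \<zeta> X Z) c"
    unfolding all_coord by (intro conjI; simp add: cbkt_defs; algebra)
  then show ?thesis ..
qed

lemma cbkt_jacobi_eo:
  fixes X Y Z :: "coord \<Rightarrow> 's::idom"
  assumes "parity_vec 0 X" "parity_vec 1 Y"
    and [simp]: "\<And>i. X (CB i) = crs \<xi> bx i" "\<And>i. Z (CB i) = crs \<zeta> bz i"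
  shows "cbkt \<xi> (\<lambda>i. \<eta> i + \<zeta> i) X (cbkt \<eta> \<zeta> Y Z) c =
     cbkt (\<lambda>i. \<xi> i + \<eta> i) \<zeta> (cbkt \<xi> \<eta> X Y) Z c + cbkt \<eta> (\<lambda>i. \<xi> i + \<zeta> i) Y (cbkt \<xi> \<zeta> X Z) c"
proof -
  have [simp]: "X (CV l) = 0" "X (CD t l) = 0" "Y (CA t) = 0" "Y (CB t) = 0" "Y CE = 0" "Y CF = 0" "Y CH = 0" for t l
    using assms(1,2) by (simp_all add: parity_vec_0 parity_vec_1)
  have "\<forall>c. cbkt \<xi> (\<lambda>i. \<eta> i + \<zeta> i) X (cbkt \<eta> \<zeta> Y Z) c =
     cbkt (\<lambda>i. \<xi> i + \<eta> i) \<zeta> (cbkt \<xi> \<eta> X Y) Z c + cbkt \<eta> (\<lambda>i. \<xi> i + \<zeta> i) Y (cbkt \<xi> \<zeta> X Z) c"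
    unfolding all_coord by (intro conjI; simp add: cbkt_defs; algebra)
  then show ?thesis ..
qed

lemma cbkt_jacobi_oo:
  fixes X Y Z :: "coord \<Rightarrow> 's::idom"
  assumes "parity_vec 1 X" "parity_vec 1 Y"
    and [simp]: "\<And>i. Z (CB i) = crs \<zeta> bz i"
  shows "cbkt \<xi> (\<lambda>i. \<eta> i + \<zeta> i) X (cbkt \<eta> \<zeta> Y Z) c =
     cbkt (\<lambda>i. \<xi> i + \<eta> i) \<zeta> (cbkt \<xi> \<eta> X Y) Z c - cbkt \<eta> (\<lambda>i. \<xi> i + \<zeta> i) Y (cbkt \<xi> \<zeta> X Z) c"
proof -
  have [simp]: "X (CA t) = 0" "X (CB t) = 0" "X CE = 0" "X CF = 0" "X CH = 0"
      "Y (CA t) = 0" "Y (CB t) = 0" "Y CE = 0" "Y CF = 0" "Y CH = 0" for t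
    using assms(1,2) by (simp_all add: parity_vec_1)
  have "\<forall>c. cbkt \<xi> (\<lambda>i. \<eta> i + \<zeta> i) X (cbkt \<eta> \<zeta> Y Z) c =
     cbkt (\<lambda>i. \<xi> i + \<eta> i) \<zeta> (cbkt \<xi> \<eta> X Y) Z c - cbkt \<eta> (\<lambda>i. \<xi> i + \<zeta> i) Y (cbkt \<xi> \<zeta> X Z) c"
    unfolding all_coord by (intro conjI; simp add: cbkt_defs; algebra)
  then show ?thesis ..
qed

section \<open>The bracket of RE(3,8)\<close>

global_interpretation pconst: ring_map "pconst :: 'a::comm_ring_1 \<Rightarrow> ('v, 'a) rpoly"
  by (rule ring_map_pconst)

abbreviation numv :: "'f::field \<Rightarrow> ('v, 'f dpoly) rpoly"
  where "numv c \<equiv> pconst (pconst c)"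

lemma ring_map_numv: "ring_map (numv :: 'f::field \<Rightarrow> ('v, 'f dpoly) rpoly)"
  by (rule ring_map_compose[OF ring_map_pconst ring_map_pconst])

abbreviation delv :: "3 \<Rightarrow> ('v, 'f::field dpoly) rpoly"
  where "delv i \<equiv> pconst (pvar i)"

text \<open>Coordinates of \<open>x\<close> at \<open>\<partial> = p\<close> and at the value \<open>q\<close> of its variables, with scalars mapped by \<open>\<phi>\<close>.\<close>

definition ev :: "('f::field \<Rightarrow> 's::comm_ring_1) \<Rightarrow> (3 \<Rightarrow> 's) \<Rightarrow> ('v::finite \<Rightarrow> 's) \<Rightarrow> ('v, 'f re38) rpoly \<Rightarrow> coord \<Rightarrow> 's"
  where "ev \<phi> p q x c = ins (\<lambda>r. ins \<phi> p (coord r c)) q x"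

definition plin :: "(coord \<Rightarrow> (3, 'f::field dpoly) rpoly) \<Rightarrow> (3, 'f re38) rpoly"
  where "plin P = (\<Sum>i\<in>UNIV. P (CA i) \<odot> gen (Ga i)) + (\<Sum>i\<in>UNIV. P (CB i) \<odot> gen (Gb i))
    + P CE \<odot> gen GE + P CF \<odot> gen GF + P CH \<odot> gen GH
    + (\<Sum>l\<in>UNIV. P (CV l) \<odot> gen (Ge l))
    + (\<Sum>t\<in>UNIV. \<Sum>l\<in>UNIV. P (CD t l) \<odot> gen (Gd (t + 1) (t + 2) l))"

definition rbr :: "'f::field_char_0 re38 lbracket"
  where "rbr a b = plin (\<lambda>c. num (1/2) * bkt (\<lambda>i. - lam i) (\<lambda>i. del i + lam i)
     (\<lambda>c. ins numv (\<lambda>i. - lam i) (coord a c)) (\<lambda>c. ins numv (\<lambda>i. del i + lam i) (coord b c)) c)"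

definition gcoord :: "re38_gen \<Rightarrow> coord \<Rightarrow> 's::comm_ring_1"
  where "gcoord g c = (case c of
      CA i \<Rightarrow> of_bool (g = Ga i)
    | CB i \<Rightarrow> of_bool (g = Gb i)
    | CE \<Rightarrow> of_bool (g = GE)
    | CF \<Rightarrow> of_bool (g = GF)
    | CH \<Rightarrow> of_bool (g = GH)
    | CV l \<Rightarrow> of_bool (g = Ge l)
    | CD t l \<Rightarrow> of_bool (g = Gd (t + 1) (t + 2) l) - of_bool (g = Gd (t + 2) (t + 1) l))"

lemma (in ring_map) map_of_bool: "h (of_bool b) = of_bool b"
  by (cases b) (simp_all add: map_one zero)

lemma (in ring_map) map_gcoord: "h (gcoord g c) = gcoord g c"
  by (cases c) (simp_all add: gcoord_def map_of_bool diff)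

lemma coord_gen_gcoord: "coord (gen g) c = curl pvar (gcoord g) c"
proof -
  have "raw_coord (free_gen g) = (gcoord g :: coord \<Rightarrow> 'a dpoly)"
    by (rule ext) (auto simp: raw_coord_def gcoord_def free_gen_def lookup_single when_def split: coord.split)
  then show ?thesis by (simp add: coord_gen)
qed

locale scalar_map = ring_map h
  for h :: "'f::field_char_0 \<Rightarrow> 's::comm_ring_1"
begin

lemma additive_ins_coord: "Modules.additive (\<lambda>r. ins h p (coord r c))"
  by (rule Modules.additive.intro)
    (simp add: coord_add Modules.additive.add[OF additive_ins[OF local.additive_axioms]])

lemma additive_ev: "Modules.additive (\<lambda>x. ev h p q x c)"
  unfolding ev_def by (rule additive_ins[OF additive_ins_coord])

lemma ring_map_ins_self: "ring_map (ins h p)"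
  by (rule ring_map_ins) unfold_locales

lemma ins_coord_act: "ins h p (coord (re38_act a r) c) = ins h p a * ins h p (coord r c)"
  by (simp add: coord_act ring_map.map_mult[OF ring_map_ins_self])

lemma ev_pact: "ev h p q (pact re38_act P x) c = ins (ins h p) q P * ev h p q x c"
  unfolding ev_def by (rule ins_pact[OF additive_ins_coord ins_coord_act])

lemma ev_psubst: "ev h p q (psubst re38_act Q x) c = ev h p (\<lambda>i. ins (ins h p) q (Q i)) x c"
  unfolding ev_def by (rule ins_psubst[OF additive_ins_coord ins_coord_act ring_map_ins_self])

lemma ev_pconst: "ev h p q (pconst r) c = ins h p (coord r c)"
  unfolding ev_def by (rule ins_pconst) (simp add: coord.zero)

lemma ev_ptimes: "ev h p q (P \<odot> r) c = ins (ins h p) q P * ins h p (coord r c)"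
  by (simp add: ptimes_def ev_pact ev_pconst)

lemma ins_coord_gen: "ins h p (coord (gen g) c) = curl p (gcoord g) c"
  by (simp add: coord_gen_gcoord ring_map.map_curl[OF ring_map_ins_self]
      ring_map.map_gcoord[OF ring_map_ins_self] ins_pvar zero map_one)

lemma ev_plin: "ev h p q (plin P) c = curl p (\<lambda>c. ins (ins h p) q (P c)) c"
proof -
  interpret E: Modules.additive "\<lambda>x. ev h p q x c" for c by (rule additive_ev)
  have "\<forall>c. ev h p q (plin P) c = curl p (\<lambda>c. ins (ins h p) q (P c)) c"
    unfolding all_coord
    by (simp add: plin_def E.add E.sum ev_ptimes ins_coord_gen curl_def cb_def gcoord_def sum_3 sum_2
        algebra_simps)
  then show ?thesis ..
qed

lemma ins_ins_numv: "ins (ins h p) q (numv a) = h a"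
  by (simp add: ins_pconst zero)

lemma ins_ins_pvar: "ins (ins h p) q (pvar i) = q i"
  by (rule ins_pvar) (simp_all add: ring_map.map_one[OF ring_map_ins_self])

lemma ins_ins_delv: "ins (ins h p) q (delv i) = p i"
  by (simp add: ins_pconst ins_pvar zero map_one)

lemma ev_rbr:
  "ev h p q (rbr a b) c = h (1/2) * cbkt (\<lambda>i. - q i) (\<lambda>i. p i + q i)
     (\<lambda>c. ins h (\<lambda>i. - q i) (coord a c)) (\<lambda>c. ins h (\<lambda>i. p i + q i) (coord b c)) c"
proof -
  interpret I: ring_map "ins (ins h p) q"
    by (rule ring_map_ins[OF ring_map_ins_self])
  show ?thesis
    by (simp add: rbr_def ev_plin I.map_mult I.map_bkt I.map_ins I.minus I.add ins_ins_numv
        ins_ins_pvar ins_ins_delv cbkt_def curl_mult)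
qed

end

text \<open>Evaluation at the generic point separates the elements of \<open>F[v] \<otimes> R\<close>.\<close>

abbreviation gev :: "('v::finite, 'f::field_char_0 re38) rpoly \<Rightarrow> coord \<Rightarrow> ('v, 'f dpoly) rpoly"
  where "gev \<equiv> ev numv delv pvar"

lemma ins_numv_delv: "ins numv delv x = pconst x"
  by (simp add: ins_pconst_pvar flip: pconst.map_ins)

lemma lookup_gev: "Poly_Mapping.lookup (gev x c) M = coord (Poly_Mapping.lookup x M) c"
  by (simp add: ev_def ins_numv_delv lookup_ins_pvar coord.zero)

lemma gev_eqI: "(\<And>c. gev x c = gev y c) \<Longrightarrow> x = (y :: ('v::finite, 'f::field_char_0 re38) rpoly)"
  by (rule poly_mapping_eqI, rule coord_eqI) (simp flip: lookup_gev)

global_interpretation numv: scalar_map "numv :: 'f::field_char_0 \<Rightarrow> ('v, 'f dpoly) rpoly"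
  by (rule scalar_map.intro[OF ring_map_numv])

global_interpretation gev: Modules.additive "\<lambda>x :: ('v::finite, 'f::field_char_0 re38) rpoly. gev x c" for c
  by (rule numv.additive_ev)

lemma rbr_bilinear: "bilinear_bracket re38_act (rbr :: 'f::field_char_0 re38 lbracket)"
proof -
  have ins_add: "ins numv p (coord (a + b) c) = ins numv p (coord a c) + ins numv p (coord b c)"
    for p :: "3 \<Rightarrow> (3, 'f dpoly) rpoly" and a b :: "'f re38" and c
    by (rule Modules.additive.add[OF numv.additive_ins_coord])
  show ?thesis
    unfolding bilinear_bracket_def
    by (intro conjI allI; rule gev_eqI)
      (simp_all add: gev.add numv.ev_rbr numv.ev_pact numv.ins_ins_numv ins_add cbkt_add_left cbkt_add_right
        numv.ins_coord_act cbkt_mult_left cbkt_mult_right ins_pconst algebra_simps)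
qed

lemma rbr_sesquilinear: "sesquilinear re38_act (rbr :: 'f::field_char_0 re38 lbracket)"
proof -
  interpret I: ring_map "ins (ins numv delv) pvar :: (3, 'f dpoly) rpoly \<Rightarrow> (3, 'f dpoly) rpoly"
    by (rule ring_map_ins[OF numv.ring_map_ins_self])
  have left: "cbkt \<xi> \<eta> (\<lambda>c. ins numv p (coord (re38_act (pvar i) a) c)) Y c = p i * cbkt \<xi> \<eta> (\<lambda>c. ins numv p (coord a c)) Y c"
    and right: "cbkt \<xi> \<eta> Y (\<lambda>c. ins numv p (coord (re38_act (pvar i) a) c)) c = p i * cbkt \<xi> \<eta> Y (\<lambda>c. ins numv p (coord a c)) c"
    for \<xi> \<eta> p :: "3 \<Rightarrow> (3, 'f dpoly) rpoly" and i Y c and a :: "'f re38"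
    by (simp_all add: numv.ins_coord_act ins_pvar pconst.map_one cbkt_mult_left cbkt_mult_right)
  show ?thesis
    unfolding sesquilinear_def
    by (intro conjI allI; rule gev_eqI)
      (simp_all add: numv.ev_rbr numv.ev_pact left right I.add I.minus numv.ins_ins_pvar numv.ins_ins_delv)
qed

lemma coord_parity_gen: "coord_parity c \<noteq> gen_parity g \<Longrightarrow> coord (gen g) c = 0"
  by (cases g; cases c) (simp_all add: coord_gen_gcoord curl_def crs_def cb_def gcoord_def coord_parity_def)

lemma parity_vec_coord: "a \<in> re38_parity p \<Longrightarrow> parity_vec p (coord a)"
  unfolding re38_parity_def
  by (induction rule: re38.span_induct_alt)
    (auto simp: parity_vec_def coord.zero coord.add coord_act coord_parity_gen)

lemma (in scalar_map) parity_vec_ins: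
  "a \<in> re38_parity p \<Longrightarrow> parity_vec p (\<lambda>c. ins h q (coord a c))"
  using parity_vec_coord[of a p] by (simp add: parity_vec_def)

lemma rbr_skew: "skew_symmetric re38_act re38_parity (rbr :: 'f::field_char_0 re38 lbracket)"
  unfolding skew_symmetric_def
proof (intro allI ballI gev_eqI)
  interpret I: ring_map "ins (ins numv delv) pvar :: (3, 'f dpoly) rpoly \<Rightarrow> (3, 'f dpoly) rpoly"
    by (rule ring_map_ins[OF numv.ring_map_ins_self])
  fix p q and a b :: "'f re38" and c
  assume "a \<in> re38_parity p" "b \<in> re38_parity q"
  then have *: "cbkt \<eta> \<xi> (\<lambda>c. ins numv \<eta> (coord b c)) (\<lambda>c. ins numv \<xi> (coord a c)) c =
      - koszul p q (cbkt \<xi> \<eta> (\<lambda>c. ins numv \<xi> (coord a c)) (\<lambda>c. ins numv \<eta> (coord b c)) c)"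
    for \<xi> \<eta> :: "3 \<Rightarrow> (3, 'f dpoly) rpoly"
    by (intro cbkt_skew numv.parity_vec_ins)
  have "gev (- koszul p q x) c = - koszul p q (gev x c)" for x :: "(3, 'f re38) rpoly"
    by (simp add: koszul_def gev.minus)
  then show "gev (rbr b a) c = gev (- koszul p q (psubst re38_act (\<lambda>i. - pvar i - pconst (pvar i)) (rbr a b))) c"
    by (simp add: numv.ev_psubst numv.ev_rbr I.minus I.diff numv.ins_ins_pvar numv.ins_ins_delv *[of "\<lambda>i. - pvar i"])
      (simp add: koszul_def add.commute)
qed

definition slcoord :: "'f::field^2^2 \<Rightarrow> coord \<Rightarrow> 'f"
  where "slcoord m c = (case c of CE \<Rightarrow> m $ 1 $ 2 | CF \<Rightarrow> m $ 2 $ 1 | CH \<Rightarrow> m $ 1 $ 1 | _ \<Rightarrow> 0)"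

lemma slcoord_simps:
  "slcoord m (CA i) = 0" "slcoord m (CB i) = 0" "slcoord m CE = m $ 1 $ 2" "slcoord m CF = m $ 2 $ 1"
  "slcoord m CH = m $ 1 $ 1" "slcoord m (CV l) = 0" "slcoord m (CD i l) = 0"
  by (simp_all add: slcoord_def)

lemma gcoord_simps:
  "gcoord g (CA i) = of_bool (g = Ga i)"
  "gcoord g (CB i) = of_bool (g = Gb i)"
  "gcoord g CE = of_bool (g = GE)"
  "gcoord g CF = of_bool (g = GF)"
  "gcoord g CH = of_bool (g = GH)"
  "gcoord g (CV l) = of_bool (g = Ge l)"
  "gcoord g (CD t l) = of_bool (g = Gd (t + 1) (t + 2) l) - of_bool (g = Gd (t + 2) (t + 1) l)"
  by (simp_all add: gcoord_def)

lemma curl_simps: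
  "curl p X (CA i) = X (CA i)" "curl p X (CB i) = crs p (cb X) i" "curl p X CE = X CE" "curl p X CF = X CF"
  "curl p X CH = X CH" "curl p X (CV l) = X (CV l)" "curl p X (CD i l) = X (CD i l)"
  by (simp_all add: curl_def)

lemma (in scalar_map) ins_coord_sl: "ins h p (coord (sl_elem m) c) = h (slcoord m c)"
proof -
  interpret I: ring_map "ins h p" by (rule ring_map_ins_self)
  have "\<forall>c. ins h p (coord (sl_elem m) c) = h (slcoord m c)"
    unfolding all_coord
    by (simp add: sl_elem_def coord_add I.add ins_coord_act ins_coord_gen ins_pconst zero
        slcoord_def curl_def cb_def gcoord_def)
  then show ?thesis ..
qed

lemma trace_0_22: "trace m = 0 \<Longrightarrow> (m :: 'f::field^2^2) $ 2 $ 2 = - m $ 1 $ 1"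
  by (simp add: trace_def sum_2 add_eq_0_iff)

lemma (in ring_map) map_of_int: "h (of_int k) = of_int k"
proof (cases k rule: int_cases2)
  case (nonneg n)
  have "h (of_nat n) = of_nat n"
    by (induction n) (simp_all add: zero map_add map_one)
  with nonneg show ?thesis by simp
next
  case (nonpos n)
  have "h (of_nat n) = of_nat n"
    by (induction n) (simp_all add: zero map_add map_one)
  with nonpos show ?thesis by (simp add: minus)
qed

text \<open>
  The formulas are checked for an evaluation in an arbitrary integral domain, where they are ring
  identities in the values of the variables.
\<close>

locale generic_point = scalar_map \<phi>
  for \<phi> :: "'f::field_char_0 \<Rightarrow> 's::idom" +
  fixes p q :: "3 \<Rightarrow> 's"
begin

sublocale coef: ring_map "ins (ins \<phi> p) q"
  by (rule ring_map_ins[OF ring_map_ins_self])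

sublocale e: Modules.additive "\<lambda>x. ev \<phi> p q x c" for c
  by (rule additive_ev)

sublocale d: ring_map "ins \<phi> p"
  by (rule ring_map_ins_self)

lemma two_half: "2 * \<phi> (1/2) = 1"
  using map_mult[of 2 "1/2"] by (simp add: map_numeral map_one)

lemma three_halves: "\<phi> (3/2) = 3 * \<phi> (1/2)"
  using map_mult[of 3 "1/2"] by (simp add: map_numeral)

lemmas formula_simps = ev_rbr e.add e.diff e.minus e.sum e.zero ev_ptimes
  coef.map_simps coef.map_of_int coef.map_of_bool d.map_simps ins_ins_pvar ins_ins_delv ins_ins_numv
  ins_coord_gen ins_coord_sl ins_coord_act ins_pconst map_simps
  cbkt_def curl_simps bkt_defs cb_def gcoord_simps slcoord_simps
  e_elem_def d_elem_def coord.add coord.sum coord.minus three_halves sum_2 sum_3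

lemma formula_aa:
  shows "ev \<phi> p q (rbr (gen (Ga i)) (gen (Ga j) :: 'f re38)) c0 =
     ev \<phi> p q (- (lam i + del i) \<odot> gen (Ga j) - lam j \<odot> gen (Ga i)
       + (\<Sum>k\<in>UNIV. (num (1/2) * lam i * (lam j + del j) * lam k) \<odot> gen (Gb k))) c0"
proof -
  have "\<forall>c0. ev \<phi> p q (rbr (gen (Ga i)) (gen (Ga j) :: 'f re38)) c0 =
     ev \<phi> p q (- (lam i + del i) \<odot> gen (Ga j) - lam j \<odot> gen (Ga i)
       + (\<Sum>k\<in>UNIV. (num (1/2) * lam i * (lam j + del j) * lam k) \<odot> gen (Gb k))) c0"
  unfolding all_coord
  by (insert exhaust_3[of i] exhaust_3[of j]; elim disjE; hypsubst_thin; intro conjI; simp add: formula_simps del: mult_cancel_left mult_cancel_right mult_eq_0_iff; (algebra | (insert two_half; algebra)))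
  then show ?thesis ..
qed

lemma formula_ac:
  assumes "trace c = 0"
  shows "ev \<phi> p q (rbr (gen (Ga i)) (sl_elem c :: 'f re38)) c0 =
     ev \<phi> p q (- (del i + lam i) \<odot> sl_elem c) c0"
proof -
  have "\<forall>c0. ev \<phi> p q (rbr (gen (Ga i)) (sl_elem c :: 'f re38)) c0 =
     ev \<phi> p q (- (del i + lam i) \<odot> sl_elem c) c0"
  unfolding all_coord
  by (insert exhaust_3[of i]; elim disjE; hypsubst_thin; intro conjI; simp add: formula_simps trace_0_22[OF assms] del: mult_cancel_left mult_cancel_right mult_eq_0_iff; (algebra | (insert two_half; algebra)))
  then show ?thesis ..
qed

lemma formula_ab:
  shows "ev \<phi> p q (rbr (gen (Ga i)) (gen (Gb k) :: 'f re38)) c0 =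
     ev \<phi> p q (- (del i + lam i) \<odot> gen (Gb k)
       + (\<Sum>r\<in>UNIV. (of_bool (k = i) * lam r) \<odot> gen (Gb r))) c0"
proof -
  have "\<forall>c0. ev \<phi> p q (rbr (gen (Ga i)) (gen (Gb k) :: 'f re38)) c0 =
     ev \<phi> p q (- (del i + lam i) \<odot> gen (Gb k)
       + (\<Sum>r\<in>UNIV. (of_bool (k = i) * lam r) \<odot> gen (Gb r))) c0"
  unfolding all_coord
  by (insert exhaust_3[of i] exhaust_3[of k]; elim disjE; hypsubst_thin; intro conjI; simp add: formula_simps del: mult_cancel_left mult_cancel_right mult_eq_0_iff; (algebra | (insert two_half; algebra)))
  then show ?thesis ..
qed

lemma formula_cb:
  assumes "trace c = 0"
  shows "ev \<phi> p q (rbr (sl_elem c) (gen (Gb j) :: 'f re38)) c0 =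
     ev \<phi> p q (0) c0"
proof -
  have "\<forall>c0. ev \<phi> p q (rbr (sl_elem c) (gen (Gb j) :: 'f re38)) c0 =
     ev \<phi> p q (0) c0"
  unfolding all_coord
  by (insert exhaust_3[of j]; elim disjE; hypsubst_thin; intro conjI; simp add: formula_simps del: mult_cancel_left mult_cancel_right mult_eq_0_iff; (algebra | (insert two_half; algebra)))
  then show ?thesis ..
qed

lemma formula_bb:
  shows "ev \<phi> p q (rbr (gen (Gb i)) (gen (Gb k) :: 'f re38)) c0 =
     ev \<phi> p q (0) c0"
proof -
  have "\<forall>c0. ev \<phi> p q (rbr (gen (Gb i)) (gen (Gb k) :: 'f re38)) c0 =
     ev \<phi> p q (0) c0"
  unfolding all_coord
  by (insert exhaust_3[of i] exhaust_3[of k]; elim disjE; hypsubst_thin; intro conjI; simp add: formula_simps del: mult_cancel_left mult_cancel_right mult_eq_0_iff; (algebra | (insert two_half; algebra)))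
  then show ?thesis ..
qed

lemma formula_ee:
  shows "ev \<phi> p q (rbr (gen (Ge i)) (gen (Ge j) :: 'f re38)) c0 =
     ev \<phi> p q ((\<Sum>h\<in>UNIV. \<Sum>k\<in>UNIV.
          (of_int (idx j - idx i) * of_int (eps h k) * lam k * del h) \<odot> gen (Ga (third h k)))) c0"
proof -
  have "\<forall>c0. ev \<phi> p q (rbr (gen (Ge i)) (gen (Ge j) :: 'f re38)) c0 =
     ev \<phi> p q ((\<Sum>h\<in>UNIV. \<Sum>k\<in>UNIV.
          (of_int (idx j - idx i) * of_int (eps h k) * lam k * del h) \<odot> gen (Ga (third h k)))) c0"
  unfolding all_coord
  by (insert exhaust_2[of i] exhaust_2[of j]; elim disjE; hypsubst_thin; intro conjI; simp add: formula_simps third_eps_table idx_def del: mult_cancel_left mult_cancel_right mult_eq_0_iff; (algebra | (insert two_half; algebra)))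
  then show ?thesis ..
qed

lemma formula_ed:
  shows "ev \<phi> p q (rbr (gen (Ge i)) (gen (Gd j k h) :: 'f re38)) c0 =
     ev \<phi> p q ((of_int (eps j k) * of_int (idx h - idx i)) \<odot> gen (Ga (third j k))
       + (\<Sum>r\<in>UNIV. (of_int (eps j k) * of_int (idx i - idx h)
            * (lam (third j k) + del (third j k)) * lam r) \<odot> gen (Gb r))
       + (of_int (eps j k) * num (1/2) * (2 * lam (third j k) + del (third j k))) \<odot> e_dot i h) c0"
proof -
  have "\<forall>c0. ev \<phi> p q (rbr (gen (Ge i)) (gen (Gd j k h) :: 'f re38)) c0 =
     ev \<phi> p q ((of_int (eps j k) * of_int (idx h - idx i)) \<odot> gen (Ga (third j k))
       + (\<Sum>r\<in>UNIV. (of_int (eps j k) * of_int (idx i - idx h)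
            * (lam (third j k) + del (third j k)) * lam r) \<odot> gen (Gb r))
       + (of_int (eps j k) * num (1/2) * (2 * lam (third j k) + del (third j k))) \<odot> e_dot i h) c0"
  unfolding all_coord
  by (insert exhaust_3[of j] exhaust_3[of k] exhaust_2[of i] exhaust_2[of h]; elim disjE; hypsubst_thin; intro conjI; simp add: formula_simps third_eps_table idx_def e_dot_def del: mult_cancel_left mult_cancel_right mult_eq_0_iff; (algebra | (insert two_half; algebra)))
  then show ?thesis ..
qed

lemma formula_dd:
  assumes "s \<noteq> j"
  shows "ev \<phi> p q (rbr (gen (Gd j k h)) (gen (Gd j s l) :: 'f re38)) c0 =
     ev \<phi> p q ((of_int (eps j k) * of_int (idx l - idx h) * (1 - of_bool (k = s))) \<odot> gen (Gb j)) c0"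
proof (cases c0)
  case (CB i)
  let ?X = "gcoord (Gd j k h) :: coord \<Rightarrow> 's" and ?Y = "gcoord (Gd j s l) :: coord \<Rightarrow> 's"
  have cross: "om (cd ?X (m + 1)) (cd ?Y (m + 2)) - om (cd ?X (m + 2)) (cd ?Y (m + 1)) =
      of_int (eps j k) * of_int (idx l - idx h) * (1 - of_bool (k = s)) * of_bool (j = m)" for m
    by (insert exhaust_3[of j] exhaust_3[of k] exhaust_3[of s] exhaust_3[of m] assms; elim disjE; hypsubst_thin;
      insert exhaust_2[of h] exhaust_2[of l]; elim disjE; hypsubst_thin;
      simp add: om_def cd_def gcoord_simps third_eps_table idx_def)
  have "ev \<phi> p q (rbr (gen (Gd j k h)) (gen (Gd j s l) :: 'f re38)) (CB i) = \<phi> (1/2) * crs p (\<lambda>m.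
      2 * (om (cd ?X (m + 1)) (cd ?Y (m + 2)) - om (cd ?X (m + 2)) (cd ?Y (m + 1)))) i"
    by (simp add: ev_rbr ins_coord_gen cbkt_def curl_simps cb_def crs_def bkt_def bkt_ee_def bkt_eo_def bkt_oo_def
        om_def cd_def cv_def ca_def dt_def sl_act_def gcoord_simps algebra_simps)
  also have "\<dots> = (2 * \<phi> (1/2)) * crs p (\<lambda>m. of_int (eps j k) * of_int (idx l - idx h) * (1 - of_bool (k = s)) * of_bool (j = m)) i"
    unfolding cross by (simp add: crs_def algebra_simps)
  also have "\<dots> = ev \<phi> p q ((of_int (eps j k) * of_int (idx l - idx h) * (1 - of_bool (k = s))) \<odot> gen (Gb j)) (CB i)"
    unfolding two_half
    by (simp add: ev_ptimes ins_coord_gen curl_simps cb_def crs_def gcoord_simps coef.map_simps coef.map_of_int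
        coef.map_of_bool algebra_simps)
  finally show ?thesis by (simp add: CB)
qed (simp_all add: formula_simps)

lemma formula_ae:
  shows "ev \<phi> p q (rbr (gen (Ga i)) (gen (Ge j) :: 'f re38)) c0 =
     ev \<phi> p q (- (num (3/2) * lam i + del i) \<odot> gen (Ge j)
       - (\<Sum>k\<in>UNIV. \<Sum>r\<in>UNIV. (num (1/2) * lam k * lam i * del r) \<odot> gen (Gd k r j))) c0"
proof -
  have "\<forall>c0. ev \<phi> p q (rbr (gen (Ga i)) (gen (Ge j) :: 'f re38)) c0 =
     ev \<phi> p q (- (num (3/2) * lam i + del i) \<odot> gen (Ge j)
       - (\<Sum>k\<in>UNIV. \<Sum>r\<in>UNIV. (num (1/2) * lam k * lam i * del r) \<odot> gen (Gd k r j))) c0"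
  unfolding all_coord
  by (insert exhaust_3[of i] exhaust_2[of j]; elim disjE; hypsubst_thin; intro conjI; simp add: formula_simps del: mult_cancel_left mult_cancel_right mult_eq_0_iff; (algebra | (insert two_half; algebra)))
  then show ?thesis ..
qed

lemma formula_ce:
  assumes "trace c = 0"
  shows "ev \<phi> p q (rbr (sl_elem c) (gen (Ge j) :: 'f re38)) c0 =
     ev \<phi> p q (1 \<odot> e_elem (c *v axis j 1)
       - (\<Sum>i\<in>UNIV. \<Sum>h\<in>UNIV. (lam i * del h) \<odot> d_elem i h (c *v axis j 1))) c0"
proof -
  have "\<forall>c0. ev \<phi> p q (rbr (sl_elem c) (gen (Ge j) :: 'f re38)) c0 =
     ev \<phi> p q (1 \<odot> e_elem (c *v axis j 1)
       - (\<Sum>i\<in>UNIV. \<Sum>h\<in>UNIV. (lam i * del h) \<odot> d_elem i h (c *v axis j 1))) c0"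
  unfolding all_coord
  by (insert exhaust_2[of j]; elim disjE; hypsubst_thin; intro conjI; simp add: formula_simps matrix_vector_mult_def axis_def trace_0_22[OF assms] del: mult_cancel_left mult_cancel_right mult_eq_0_iff; (algebra | (insert two_half; algebra)))
  then show ?thesis ..
qed

lemma formula_cd:
  assumes "trace c = 0"
  shows "ev \<phi> p q (rbr (sl_elem c) (gen (Gd i j h) :: 'f re38)) c0 =
     ev \<phi> p q (1 \<odot> d_elem i j (c *v axis h 1)) c0"
proof -
  have "\<forall>c0. ev \<phi> p q (rbr (sl_elem c) (gen (Gd i j h) :: 'f re38)) c0 =
     ev \<phi> p q (1 \<odot> d_elem i j (c *v axis h 1)) c0"
  unfolding all_coord
  by (insert exhaust_3[of i] exhaust_3[of j] exhaust_2[of h]; elim disjE; hypsubst_thin; intro conjI; simp add: formula_simps matrix_vector_mult_def axis_def trace_0_22[OF assms] del: mult_cancel_left mult_cancel_right mult_eq_0_iff; (algebra | (insert two_half; algebra)))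
  then show ?thesis ..
qed

lemma formula_be:
  shows "ev \<phi> p q (rbr (gen (Gb j)) (gen (Ge k) :: 'f re38)) c0 =
     ev \<phi> p q (- (\<Sum>i\<in>UNIV. lam i \<odot> gen (Gd i j k))) c0"
proof -
  have "\<forall>c0. ev \<phi> p q (rbr (gen (Gb j)) (gen (Ge k) :: 'f re38)) c0 =
     ev \<phi> p q (- (\<Sum>i\<in>UNIV. lam i \<odot> gen (Gd i j k))) c0"
  unfolding all_coord
  by (insert exhaust_3[of j] exhaust_2[of k]; elim disjE; hypsubst_thin; intro conjI; simp add: formula_simps del: mult_cancel_left mult_cancel_right mult_eq_0_iff; (algebra | (insert two_half; algebra)))
  then show ?thesis ..
qed

lemma formula_bd:
  shows "ev \<phi> p q (rbr (gen (Gb i)) (gen (Gd j k l) :: 'f re38)) c0 =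
     ev \<phi> p q (0) c0"
proof -
  have "\<forall>c0. ev \<phi> p q (rbr (gen (Gb i)) (gen (Gd j k l) :: 'f re38)) c0 =
     ev \<phi> p q (0) c0"
  unfolding all_coord
  by (insert exhaust_3[of i] exhaust_3[of j] exhaust_3[of k] exhaust_2[of l]; elim disjE; hypsubst_thin; intro conjI; simp add: formula_simps del: mult_cancel_left mult_cancel_right mult_eq_0_iff; (algebra | (insert two_half; algebra)))
  then show ?thesis ..
qed

lemma formula_cc:
  assumes "trace c = 0" "trace c' = 0"
  shows "ev \<phi> p q (rbr (sl_elem c) (sl_elem c' :: 'f re38)) c0 =
     ev \<phi> p q (1 \<odot> sl_elem (c ** c' - c' ** c)
       + (\<Sum>k\<in>UNIV. (num (trace (c ** c')) * lam k) \<odot> gen (Gb k))) c0"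
proof -
  have "\<forall>c0. ev \<phi> p q (rbr (sl_elem c) (sl_elem c' :: 'f re38)) c0 =
     ev \<phi> p q (1 \<odot> sl_elem (c ** c' - c' ** c)
       + (\<Sum>k\<in>UNIV. (num (trace (c ** c')) * lam k) \<odot> gen (Gb k))) c0"
  unfolding all_coord
  by (intro conjI; simp add: formula_simps matrix_matrix_mult_def trace_def trace_0_22[OF assms(1)] trace_0_22[OF assms(2)] del: mult_cancel_left mult_cancel_right mult_eq_0_iff; (algebra | (insert two_half; algebra)))
  then show ?thesis ..
qed

lemma formula_ad:
  "ev \<phi> p q (rbr (gen (Ga i)) (gen (Gd h k l) :: 'f re38)) c0 =
     ev \<phi> p q (- (num (3/2) * lam i + del i) \<odot> gen (Gd h k l)
       + (\<Sum>j\<in>UNIV. (of_bool (i = h) * lam j) \<odot> gen (Gd j k l))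
       - (\<Sum>r\<in>UNIV. (of_bool (i = k) * lam r) \<odot> gen (Gd r h l))) c0"
proof (cases c0)
  case (CD t m)
  show ?thesis
    unfolding CD
    by (cases "m = l"; insert exhaust_3[of i] exhaust_3[of h] exhaust_3[of k] exhaust_3[of t]; elim disjE; hypsubst_thin;
      simp add: formula_simps eq_commute[of l m] del: mult_cancel_left mult_cancel_right mult_eq_0_iff; (algebra | (insert two_half; algebra)))
qed (simp_all add: formula_simps crs_def)

end

lemma rbr_formulas: "re38_formulas (rbr :: 'f::field_char_0 re38 lbracket)"
proof -
  interpret generic_point "numv :: 'f \<Rightarrow> (3, 'f dpoly) rpoly" delv pvar ..
  show ?thesis
    unfolding re38_formulas_def
    by (intro conjI allI impI; rule gev_eqI;
      rule formula_aa formula_ac formula_ab formula_cb formula_bb formula_ee formula_ed formula_dd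
        formula_ae formula_ce formula_cd formula_be formula_bd formula_cc formula_ad; assumption)
qed

theorem rbr_re38_bracket: "re38_bracket rbr"
  by (simp add: re38_bracket_def rbr_bilinear rbr_sesquilinear rbr_skew rbr_formulas)

lemma single_eq_monom: "Poly_Mapping.single M c = pconst c * mpower pvar M"
  by (simp add: mpower_pvar pconst_def mult_single)

lemma dpoly_induct [case_names const add mult]:
  fixes p :: "'f::comm_ring_1 dpoly"
  assumes const: "\<And>c. P (pconst c)" and add: "\<And>p q. P p \<Longrightarrow> P q \<Longrightarrow> P (p + q)"
    and mult: "\<And>i p. P p \<Longrightarrow> P (pvar i * p)"
  shows "P p"
proof -
  have power: "P (pvar i ^ n * p)" if "P p" for i n p
    by (induction n) (simp_all add: that mult mult.assoc)
  have prod: "P ((\<Prod>i\<in>A. pvar i ^ k i) * p)" if "finite A" "P p" for A k p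
    using that by (induction A) (simp_all add: power mult.assoc)
  have single: "P (Poly_Mapping.single M c)" for M c
    using prod[OF finite const] by (simp add: single_eq_monom mpower_def mult.commute)
  have "P 0" using const[of 0] by simp
  then have "P (\<Sum>M\<in>A. Poly_Mapping.single M (f M))" if "finite A" for A f
    by (rule rev_mp) (use that in \<open>induction A, simp_all add: add single\<close>)
  then show ?thesis
    by (subst poly_mapping_sum_single) simp
qed

lemma additive_left: "bilinear_bracket act br \<Longrightarrow> Modules.additive (\<lambda>a. br a b)"
  unfolding bilinear_bracket_def by (intro Modules.additive.intro) blast

lemma additive_right: "bilinear_bracket act br \<Longrightarrow> Modules.additive (\<lambda>b. br a b)"
  unfolding bilinear_bracket_def by (intro Modules.additive.intro) blast

lemma bracket_eqI:
  fixes br br' :: "'f::field_char_0 re38 lbracket"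
  assumes br: "bilinear_bracket re38_act br" "sesquilinear re38_act br"
    and br': "bilinear_bracket re38_act br'" "sesquilinear re38_act br'"
    and gen: "\<And>g g'. br (gen g) (gen g') = br' (gen g) (gen g')"
  shows "br = br'"
proof (intro ext)
  note B = br[unfolded bilinear_bracket_def sesquilinear_def] br'[unfolded bilinear_bracket_def sesquilinear_def]
  have right_act: "br a (re38_act p b) = br' a (re38_act p b)" if "br a b = br' a b" for a b p
  proof (induction p rule: dpoly_induct)
    case (mult i p)
    then show ?case using B by (simp flip: re38.scale_scale)
  qed (use that B in \<open>simp_all add: re38.scale_left_distrib\<close>)
  have left_act: "br (re38_act p a) b = br' (re38_act p a) b" if "br a b = br' a b" for a b p
  proof (induction p rule: dpoly_induct)
    case (mult i p)
    then show ?case using B by (simp flip: re38.scale_scale)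
  qed (use that B in \<open>simp_all add: re38.scale_left_distrib\<close>)
  have zero: "br a 0 = br' a 0" "br 0 b = br' 0 b" for a b
    using B by (metis add_cancel_right_right)+
  have right: "br (gen g) b = br' (gen g) b" for g b
    by (induction b rule: re38_induct) (use B in \<open>simp_all add: zero right_act gen\<close>)
  show "br a b = br' a b" for a b
    by (induction a rule: re38_induct) (use B in \<open>simp_all add: zero left_act right\<close>)
qed

lemma gen_sl:
  assumes "g \<in> {GE, GF, GH}"
  shows "\<exists>m. trace m = 0 \<and> (gen g :: 'f::field re38) = sl_elem m"
proof -
  let ?m = "(\<chi> i j. if i = 1 \<and> j = 2 then of_bool (g = GE) else if i = 2 \<and> j = 1 then of_bool (g = GF)
    else if i = 1 then of_bool (g = GH) else - of_bool (g = GH)) :: 'f^2^2"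
  have "trace ?m = 0"
    by (simp add: trace_def sum_2)
  moreover have "gen g = sl_elem ?m"
    using assms by (auto simp: sl_elem_def pconst.map_one)
  ultimately show ?thesis by (intro exI[of _ ?m] conjI)
qed

lemma skew_symmetricD:
  "skew_symmetric act par br \<Longrightarrow> a \<in> par p \<Longrightarrow> b \<in> par q \<Longrightarrow>
    br b a = - koszul p q (psubst act (\<lambda>i. - pvar i - pconst (pvar i)) (br a b))"
  unfolding skew_symmetric_def by blast

lemmas re38_formulas_aa = iffD1[OF re38_formulas_def, THEN conjunct1, THEN spec, THEN spec]
lemmas re38_formulas_ac = iffD1[OF re38_formulas_def, THEN conjunct2, THEN conjunct1, THEN spec, THEN spec, THEN mp]
lemmas re38_formulas_ab = iffD1[OF re38_formulas_def, THEN conjunct2, THEN conjunct2, THEN conjunct1, THEN spec, THEN spec]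
lemmas re38_formulas_cb = iffD1[OF re38_formulas_def, THEN conjunct2, THEN conjunct2, THEN conjunct2, THEN conjunct1, THEN spec, THEN spec, THEN mp]
lemmas re38_formulas_bb = iffD1[OF re38_formulas_def, THEN conjunct2, THEN conjunct2, THEN conjunct2, THEN conjunct2, THEN conjunct1, THEN spec, THEN spec]
lemmas re38_formulas_ee = iffD1[OF re38_formulas_def, THEN conjunct2, THEN conjunct2, THEN conjunct2, THEN conjunct2, THEN conjunct2, THEN conjunct1, THEN spec, THEN spec]
lemmas re38_formulas_ed = iffD1[OF re38_formulas_def, THEN conjunct2, THEN conjunct2, THEN conjunct2, THEN conjunct2, THEN conjunct2, THEN conjunct2, THEN conjunct1, THEN spec, THEN spec, THEN spec, THEN spec]
lemmas re38_formulas_dd = iffD1[OF re38_formulas_def, THEN conjunct2, THEN conjunct2, THEN conjunct2, THEN conjunct2, THEN conjunct2, THEN conjunct2, THEN conjunct2, THEN conjunct1, THEN spec, THEN spec, THEN spec, THEN spec, THEN spec, THEN mp]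
lemmas re38_formulas_ae = iffD1[OF re38_formulas_def, THEN conjunct2, THEN conjunct2, THEN conjunct2, THEN conjunct2, THEN conjunct2, THEN conjunct2, THEN conjunct2, THEN conjunct2, THEN conjunct1, THEN spec, THEN spec]
lemmas re38_formulas_ce = iffD1[OF re38_formulas_def, THEN conjunct2, THEN conjunct2, THEN conjunct2, THEN conjunct2, THEN conjunct2, THEN conjunct2, THEN conjunct2, THEN conjunct2, THEN conjunct2, THEN conjunct1, THEN spec, THEN spec, THEN mp]
lemmas re38_formulas_cd = iffD1[OF re38_formulas_def, THEN conjunct2, THEN conjunct2, THEN conjunct2, THEN conjunct2, THEN conjunct2, THEN conjunct2, THEN conjunct2, THEN conjunct2, THEN conjunct2, THEN conjunct2, THEN conjunct1, THEN spec, THEN spec, THEN spec, THEN spec, THEN mp]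
lemmas re38_formulas_be = iffD1[OF re38_formulas_def, THEN conjunct2, THEN conjunct2, THEN conjunct2, THEN conjunct2, THEN conjunct2, THEN conjunct2, THEN conjunct2, THEN conjunct2, THEN conjunct2, THEN conjunct2, THEN conjunct2, THEN conjunct1, THEN spec, THEN spec]
lemmas re38_formulas_bd = iffD1[OF re38_formulas_def, THEN conjunct2, THEN conjunct2, THEN conjunct2, THEN conjunct2, THEN conjunct2, THEN conjunct2, THEN conjunct2, THEN conjunct2, THEN conjunct2, THEN conjunct2, THEN conjunct2, THEN conjunct2, THEN conjunct1, THEN spec, THEN spec, THEN spec, THEN spec]
lemmas re38_formulas_cc = iffD1[OF re38_formulas_def, THEN conjunct2, THEN conjunct2, THEN conjunct2, THEN conjunct2, THEN conjunct2, THEN conjunct2, THEN conjunct2, THEN conjunct2, THEN conjunct2, THEN conjunct2, THEN conjunct2, THEN conjunct2, THEN conjunct2, THEN conjunct1, THEN spec, THEN spec, THEN mp, THEN mp]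
lemmas re38_formulas_ad = iffD1[OF re38_formulas_def, THEN conjunct2, THEN conjunct2, THEN conjunct2, THEN conjunct2, THEN conjunct2, THEN conjunct2, THEN conjunct2, THEN conjunct2, THEN conjunct2, THEN conjunct2, THEN conjunct2, THEN conjunct2, THEN conjunct2, THEN conjunct2, THEN spec, THEN spec, THEN spec, THEN spec]

lemma re38_bracket_unique:
  assumes "re38_bracket br"
  shows "br = (rbr :: 'f::field_char_0 re38 lbracket)"
proof (rule bracket_eqI)
  show "bilinear_bracket re38_act br" "sesquilinear re38_act br"
    using assms by (simp_all add: re38_bracket_def)
  show "bilinear_bracket re38_act (rbr :: 'f re38 lbracket)" "sesquilinear re38_act (rbr :: 'f re38 lbracket)"
    by (rule rbr_bilinear rbr_sesquilinear)+
  let ?eq = "\<lambda>x y. br x y = rbr x y"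
  have skew: "?eq (gen g') (gen g)" if "?eq (gen g) (gen g')" for g g'
  proof -
    have "gen g \<in> re38_parity (gen_parity g)" for g
      unfolding re38_parity_def by (auto intro: re38.span_base)
    note par = this[of g] this[of g']
    have "skew_symmetric re38_act re38_parity br"
      using assms by (simp only: re38_bracket_def)
    from skew_symmetricD[OF this par, unfolded that] skew_symmetricD[OF rbr_skew par, symmetric]
    show ?thesis by (rule trans)
  qed
  have F: "re38_formulas br" "re38_formulas (rbr :: 'f re38 lbracket)"
    using assms rbr_formulas by (simp_all add: re38_bracket_def)
  have aa: "?eq (gen (Ga i)) (gen (Ga j))" for i j
    by (simp only: re38_formulas_aa[OF F(1)] re38_formulas_aa[OF F(2)])
  have ab: "?eq (gen (Ga i)) (gen (Gb j))" for i j
    by (simp only: re38_formulas_ab[OF F(1)] re38_formulas_ab[OF F(2)])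
  have bb: "?eq (gen (Gb i)) (gen (Gb j))" for i j
    by (simp only: re38_formulas_bb[OF F(1)] re38_formulas_bb[OF F(2)])
  have ee: "?eq (gen (Ge k)) (gen (Ge l))" for k l
    by (simp only: re38_formulas_ee[OF F(1)] re38_formulas_ee[OF F(2)])
  have ed: "?eq (gen (Ge k)) (gen (Gd h j l))" for h j k l
    by (simp only: re38_formulas_ed[OF F(1)] re38_formulas_ed[OF F(2)])
  have ae: "?eq (gen (Ga i)) (gen (Ge k))" for i k
    by (simp only: re38_formulas_ae[OF F(1)] re38_formulas_ae[OF F(2)])
  have be: "?eq (gen (Gb i)) (gen (Ge k))" for i k
    by (simp only: re38_formulas_be[OF F(1)] re38_formulas_be[OF F(2)])
  have bd: "?eq (gen (Gb i)) (gen (Gd h j l))" for h i j l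
    by (simp only: re38_formulas_bd[OF F(1)] re38_formulas_bd[OF F(2)])
  have ad: "?eq (gen (Ga i)) (gen (Gd h j l))" for h i j l
    by (simp only: re38_formulas_ad[OF F(1)] re38_formulas_ad[OF F(2)])
  have dd1: "?eq (gen (Gd j k h)) (gen (Gd j s l))" if "s \<noteq> j" for j k h s l
    by (simp only: re38_formulas_dd[OF F(1) that] re38_formulas_dd[OF F(2) that])
  have ac: "?eq (gen (Ga i)) (sl_elem m)" if "trace m = 0" for i m
    by (simp only: re38_formulas_ac[OF F(1) that] re38_formulas_ac[OF F(2) that])
  have cb: "?eq (sl_elem m) (gen (Gb j))" if "trace m = 0" for j m
    by (simp only: re38_formulas_cb[OF F(1) that] re38_formulas_cb[OF F(2) that])
  have ce: "?eq (sl_elem m) (gen (Ge k))" if "trace m = 0" for k m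
    by (simp only: re38_formulas_ce[OF F(1) that] re38_formulas_ce[OF F(2) that])
  have cd: "?eq (sl_elem m) (gen (Gd i j k))" if "trace m = 0" for i j k m
    by (simp only: re38_formulas_cd[OF F(1) that] re38_formulas_cd[OF F(2) that])
  have cc: "?eq (sl_elem m) (sl_elem m')" if "trace m = 0" "trace m' = 0" for m m'
    by (simp only: re38_formulas_cc[OF F(1) that] re38_formulas_cc[OF F(2) that])
  have sl: "?eq (gen (Ga i)) (gen c)" "?eq (gen c) (gen (Gb i))" "?eq (gen c) (gen (Ge k))" "?eq (gen c) (gen (Gd i j k))"
    if c: "c \<in> {GE, GF, GH}" for c i j k
  proof -
    obtain m where m: "trace m = 0" "gen c = (sl_elem m :: 'f re38)"
      using gen_sl[OF c] by blast
    show "?eq (gen (Ga i)) (gen c)" "?eq (gen c) (gen (Gb i))" "?eq (gen c) (gen (Ge k))" "?eq (gen c) (gen (Gd i j k))"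
      unfolding m(2) by (rule ac cb ce cd, rule m(1))+
  qed
  have slsl: "?eq (gen c) (gen c')" if c: "c \<in> {GE, GF, GH}" "c' \<in> {GE, GF, GH}" for c c'
  proof -
    obtain m m' where m: "trace m = 0" "gen c = (sl_elem m :: 'f re38)" "trace m' = 0" "gen c' = (sl_elem m' :: 'f re38)"
      using gen_sl[OF c(1)] gen_sl[OF c(2)] by blast
    show ?thesis
      unfolding m(2,4) by (rule cc) (rule m)+
  qed
  have B: "bilinear_bracket re38_act br" "bilinear_bracket re38_act (rbr :: 'f re38 lbracket)"
    using assms rbr_bilinear by (simp_all only: re38_bracket_def)
  have minus_left: "?eq (- x) y" if "?eq x y" for x y
    by (simp only: additive_left[OF B(1), THEN Modules.additive.minus] additive_left[OF B(2), THEN Modules.additive.minus] that)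
  have minus_right: "?eq y (- x)" if "?eq y x" for x y
    by (simp only: additive_right[OF B(1), THEN Modules.additive.minus] additive_right[OF B(2), THEN Modules.additive.minus] that)
  have zero: "?eq 0 y" "?eq y 0" for y
    by (simp_all only: additive_left[OF B(1), THEN Modules.additive.zero] additive_left[OF B(2), THEN Modules.additive.zero]
      additive_right[OF B(1), THEN Modules.additive.zero] additive_right[OF B(2), THEN Modules.additive.zero])
  have dd: "?eq (gen (Gd i j h)) (gen (Gd k s l))" for i j h k s l
  proof -
    have swap: "gen (Gd i j h) = - (gen (Gd j i h) :: 'f re38)" for i j h
      by (rule gen_d_swap)
    consider "i = j" | "k = s" | "i \<noteq> j" "k \<noteq> s" "i = k" | "i \<noteq> j" "k \<noteq> s" "i = s" | "i \<noteq> j" "k \<noteq> s" "j = k"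
      | "i \<noteq> j" "k \<noteq> s" "j = s"
      using exhaust_3[of i] exhaust_3[of j] exhaust_3[of k] exhaust_3[of s] by auto
    then show ?thesis
    proof cases
      case 1
      then show ?thesis by (simp add: gen_d_diag zero)
    next
      case 2
      then show ?thesis by (simp add: gen_d_diag zero)
    next
      case 3
      then show ?thesis by (auto intro!: dd1)
    next
      case 4
      then show ?thesis
        by (subst (1 2) swap[of k s l]) (auto intro!: minus_right dd1)
    next
      case 5
      then show ?thesis
        by (subst (1 2) swap[of i j h]) (auto intro!: minus_left dd1)
    next
      case 6
      then show ?thesis
        by (subst (1 2) swap[of i j h], subst (1 2) swap[of k s l]) (auto intro!: minus_left minus_right dd1)
    qed
  qed
  note direct = aa ab bb ae be ee ad bd ed dd
    skew[OF ab] skew[OF ae] skew[OF be] skew[OF ad] skew[OF bd] skew[OF ed]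
  note sl_direct = slsl sl skew[OF sl(1)] skew[OF sl(2)] skew[OF sl(3)] skew[OF sl(4)]
  show "?eq (gen g) (gen g')" for g g'
    by (cases g; cases g'; hypsubst; (rule direct | (rule sl_direct; simp; fail)))
qed

section \<open>The Jacobi identity\<close>

instantiation sum :: (linorder, linorder) linorder
begin

definition less_eq_sum :: "'a + 'b \<Rightarrow> 'a + 'b \<Rightarrow> bool"
  where "x \<le> y \<longleftrightarrow> (case x of
      Inl a \<Rightarrow> (case y of Inl b \<Rightarrow> a \<le> b | Inr _ \<Rightarrow> True)
    | Inr a \<Rightarrow> (case y of Inl _ \<Rightarrow> False | Inr b \<Rightarrow> a \<le> b))"

definition less_sum :: "'a + 'b \<Rightarrow> 'a + 'b \<Rightarrow> bool"
  where "x < y \<longleftrightarrow> x \<le> y \<and> \<not> y \<le> (x :: 'a + 'b)"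

instance
  by standard (auto simp: less_eq_sum_def less_sum_def split: sum.splits)

end

lemma cbkt_minus_left: "cbkt \<xi> \<eta> (\<lambda>c. - X c) Y c = - cbkt \<xi> \<eta> X Y c"
  using cbkt_mult_left[of \<xi> \<eta> "-1" X Y c] by simp

lemma cbkt_jacobi:
  fixes X Y Z :: "coord \<Rightarrow> 's::idom"
  assumes X: "parity_vec p X" "\<And>i. X (CB i) = crs \<xi> bx i"
    and Y: "parity_vec q Y" "\<And>i. Y (CB i) = crs \<eta> by i"
    and Z: "\<And>i. Z (CB i) = crs \<zeta> bz i"
  shows "cbkt \<xi> (\<lambda>i. \<eta> i + \<zeta> i) X (cbkt \<eta> \<zeta> Y Z) c =
     cbkt (\<lambda>i. \<xi> i + \<eta> i) \<zeta> (cbkt \<xi> \<eta> X Y) Z c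
     + koszul p q (cbkt \<eta> (\<lambda>i. \<xi> i + \<zeta> i) Y (cbkt \<xi> \<zeta> X Z) c)"
proof -
  consider "p = 0" "q = 0" | "p = 0" "q = 1" | "p = 1" "q = 0" | "p = 1" "q = 1"
    by (cases p; cases q) auto
  then show ?thesis
  proof cases
    case 1
    then have k: "koszul p q x = x" for x :: 's by (simp add: koszul_def)
    show ?thesis
      unfolding k by (rule cbkt_jacobi_ee) (use 1 X Y Z in auto)
  next
    case 2
    then have k: "koszul p q x = x" for x :: 's by (simp add: koszul_def)
    show ?thesis
      unfolding k by (rule cbkt_jacobi_eo) (use 2 X Y Z in auto)
  next
    case 3
    then have k: "koszul p q x = x" for x :: 's by (simp add: koszul_def)
    have "cbkt \<eta> (\<lambda>i. \<xi> i + \<zeta> i) Y (cbkt \<xi> \<zeta> X Z) c =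
       cbkt (\<lambda>i. \<eta> i + \<xi> i) \<zeta> (cbkt \<eta> \<xi> Y X) Z c + cbkt \<xi> (\<lambda>i. \<eta> i + \<zeta> i) X (cbkt \<eta> \<zeta> Y Z) c"
      by (rule cbkt_jacobi_eo) (use 3 X Y Z in auto)
    moreover have "cbkt \<eta> \<xi> Y X = (\<lambda>c. - cbkt \<xi> \<eta> X Y c)"
      unfolding cbkt_skew[OF X(1) Y(1), of \<eta> \<xi>, abs_def] k ..
    ultimately show ?thesis
      unfolding k by (simp only: cbkt_minus_left add.commute[of "\<eta> _"]) simp
  next
    case 4
    then have k: "koszul p q x = - x" for x :: 's by (simp add: koszul_def)
    show ?thesis
      unfolding k using cbkt_jacobi_oo[of X Y Z \<zeta> bz \<xi> \<eta> c] 4 X Y Z by auto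
  qed
qed

lemma cbkt_sum_right:
  assumes "finite A"
  shows "cbkt \<xi> \<eta> X (\<lambda>c. \<Sum>N\<in>A. k N * Y N c) c = (\<Sum>N\<in>A. k N * cbkt \<xi> \<eta> X (Y N) c)"
  using assms
proof induction
  case empty
  show ?case using cbkt_mult_right[of \<xi> \<eta> X 0 "\<lambda>_. 0" c] by simp
qed (simp add: cbkt_add_right cbkt_mult_right)

lemma cbkt_sum_left:
  assumes "finite A"
  shows "cbkt \<xi> \<eta> (\<lambda>c. \<Sum>N\<in>A. k N * X N c) Y c = (\<Sum>N\<in>A. k N * cbkt \<xi> \<eta> (X N) Y c)"
  using assms
proof induction
  case empty
  show ?case using cbkt_mult_left[of \<xi> \<eta> 0 "\<lambda>_. 0" Y c] by simp
qed (simp add: cbkt_add_left cbkt_mult_left)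

context scalar_map
begin

lemma nested_right:
  "(\<Sum>N\<in>Poly_Mapping.keys x. mpower r N * ev h p q (rbr a (Poly_Mapping.lookup x N)) c) =
    h (1/2) * cbkt (\<lambda>i. - q i) (\<lambda>i. p i + q i) (\<lambda>c. ins h (\<lambda>i. - q i) (coord a c)) (ev h (\<lambda>i. p i + q i) r x) c"
proof -
  have "ev h (\<lambda>i. p i + q i) r x =
      (\<lambda>c. \<Sum>N\<in>Poly_Mapping.keys x. mpower r N * ins h (\<lambda>i. p i + q i) (coord (Poly_Mapping.lookup x N) c))"
    by (rule ext) (simp add: ev_def ins_def[of "\<lambda>r. ins h (\<lambda>i. p i + q i) (coord r _)"] mult.commute)
  then show ?thesis
    by (simp add: ev_rbr cbkt_sum_right sum_distrib_left mult_ac)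
qed

lemma nested_left:
  "(\<Sum>N\<in>Poly_Mapping.keys x. mpower r N * ev h p q (rbr (Poly_Mapping.lookup x N) b) c) =
    h (1/2) * cbkt (\<lambda>i. - q i) (\<lambda>i. p i + q i) (ev h (\<lambda>i. - q i) r x) (\<lambda>c. ins h (\<lambda>i. p i + q i) (coord b c)) c"
proof -
  have "ev h (\<lambda>i. - q i) r x =
      (\<lambda>c. \<Sum>N\<in>Poly_Mapping.keys x. mpower r N * ins h (\<lambda>i. - q i) (coord (Poly_Mapping.lookup x N) c))"
    by (rule ext) (simp add: ev_def ins_def[of "\<lambda>r. ins h (\<lambda>i. - q i) (coord r _)"] mult.commute)
  then show ?thesis
    by (simp add: ev_rbr cbkt_sum_left sum_distrib_left mult_ac)
qed

lemma ins_coord_CB: "\<exists>\<beta>. \<forall>i. ins h p (coord a (CB i)) = crs p \<beta> i"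
proof -
  interpret I: ring_map "ins h p" by (rule ring_map_ins_self)
  obtain \<beta> where "\<forall>i. coord a (CB i) = crs pvar \<beta> i" using coord_CB by blast
  then have "\<forall>i. ins h p (coord a (CB i)) = crs p (\<lambda>i. ins h p (\<beta> i)) i"
    by (simp add: I.map_crs ins_pvar zero map_one)
  then show ?thesis by (intro exI[of _ "\<lambda>i. ins h p (\<beta> i)"])
qed

end

lemma ins_ins_generic: "ins (ins numv delv) pvar P = (P :: ('v::finite, 'f::field_char_0 dpoly) rpoly)"
  by (simp add: ins_numv_delv[abs_def] ins_pconst_pvar)

lemma rbr_jacobi: "jacobi re38_act re38_parity (rbr :: 'f::field_char_0 re38 lbracket)"
  unfolding jacobi_def
proof (intro allI ballI gev_eqI)
  fix p q and a b c :: "'f re38" and d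
  assume ab: "a \<in> re38_parity p" "b \<in> re38_parity q"
  let ?lam = "lamv :: 3 \<Rightarrow> (3 + 3, 'f dpoly) rpoly" and ?mu = "muv :: 3 \<Rightarrow> (3 + 3, 'f dpoly) rpoly"
    and ?del = "delv :: 3 \<Rightarrow> (3 + 3, 'f dpoly) rpoly"
  define \<xi> \<eta> \<zeta> where "\<xi> i = - ?lam i" and "\<eta> i = - ?mu i" and "\<zeta> i = ?del i + ?lam i + ?mu i" for i
  define X Y Z where "X e = ins numv \<xi> (coord a e)" and "Y e = ins numv \<eta> (coord b e)"
    and "Z e = ins numv \<zeta> (coord c e)" for e
  obtain bx "by" bz where bxyz: "X (CB i) = crs \<xi> bx i" "Y (CB i) = crs \<eta> by i" "Z (CB i) = crs \<zeta> bz i" for i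
    unfolding X_def Y_def Z_def using numv.ins_coord_CB by metis
  let ?h = "numv (1/2) :: (3 + 3, 'f dpoly) rpoly"
  have mom: "(\<lambda>i. ?del i + ?lam i) = (\<lambda>i. \<eta> i + \<zeta> i)" "(\<lambda>i. \<eta> i + \<zeta> i + ?mu i) = \<zeta>" "(\<lambda>i. ?del i + ?mu i) = (\<lambda>i. \<xi> i + \<zeta> i)"
    "(\<lambda>i. \<xi> i + \<zeta> i + ?lam i) = \<zeta>" "(\<lambda>i. - ?lam i - ?mu i) = (\<lambda>i. \<xi> i + \<eta> i)"
    "(\<lambda>i. ?del i + (?lam i + ?mu i)) = \<zeta>" "(\<lambda>i. \<xi> i + \<eta> i + ?lam i) = \<eta>" "(\<lambda>i. - ?lam i) = \<xi>" "(\<lambda>i. - ?mu i) = \<eta>"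
    by (simp_all add: \<xi>_def \<eta>_def \<zeta>_def fun_eq_iff)
  have 1: "gev (\<Sum>N\<in>Poly_Mapping.keys (rbr b c). pact re38_act (mpower muv N) (psubst re38_act lamv (rbr a (Poly_Mapping.lookup (rbr b c) N)))) d
      = ?h * (?h * cbkt \<xi> (\<lambda>i. \<eta> i + \<zeta> i) X (cbkt \<eta> \<zeta> Y Z) d)"
    by (simp add: gev.sum numv.ev_pact numv.ev_psubst ins_ins_generic numv.nested_right,
      simp add: numv.ev_rbr[abs_def] mom cbkt_mult_right flip: X_def Y_def Z_def)
  have 2: "gev (\<Sum>M\<in>Poly_Mapping.keys (rbr a b). pact re38_act (mpower lamv M)
        (psubst re38_act (\<lambda>i. lamv i + muv i) (rbr (Poly_Mapping.lookup (rbr a b) M) c))) d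
      = ?h * (?h * cbkt (\<lambda>i. \<xi> i + \<eta> i) \<zeta> (cbkt \<xi> \<eta> X Y) Z d)"
    by (simp add: gev.sum numv.ev_pact numv.ev_psubst ins_ins_generic numv.nested_left,
      simp add: numv.ev_rbr[abs_def] mom cbkt_mult_left flip: X_def Y_def Z_def)
  have 3: "gev (\<Sum>M\<in>Poly_Mapping.keys (rbr a c). pact re38_act (mpower lamv M) (psubst re38_act muv (rbr b (Poly_Mapping.lookup (rbr a c) M)))) d
      = ?h * (?h * cbkt \<eta> (\<lambda>i. \<xi> i + \<zeta> i) Y (cbkt \<xi> \<zeta> X Z) d)"
    by (simp add: gev.sum numv.ev_pact numv.ev_psubst ins_ins_generic numv.nested_right,
      simp add: numv.ev_rbr[abs_def] mom cbkt_mult_right flip: X_def Y_def Z_def)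
  have par: "parity_vec p X" "parity_vec q Y"
    unfolding X_def Y_def using ab by (auto intro: numv.parity_vec_ins)
  have koszul_gev: "gev (koszul p q x) d = koszul p q (gev x d)" for x :: "(3 + 3, 'f re38) rpoly"
    by (simp add: koszul_def gev.minus)
  have koszul_h: "koszul p q (?h * x) = ?h * koszul p q x" for x
    by (simp add: koszul_def)
  show "gev (\<Sum>N\<in>Poly_Mapping.keys (rbr b c). pact re38_act (mpower muv N) (psubst re38_act lamv (rbr a (Poly_Mapping.lookup (rbr b c) N)))) d
    = gev ((\<Sum>M\<in>Poly_Mapping.keys (rbr a b). pact re38_act (mpower lamv M)
            (psubst re38_act (\<lambda>i. lamv i + muv i) (rbr (Poly_Mapping.lookup (rbr a b) M) c)))
        + koszul p q (\<Sum>M\<in>Poly_Mapping.keys (rbr a c). pact re38_act (mpower lamv M) (psubst re38_act muv (rbr b (Poly_Mapping.lookup (rbr a c) M))))) d"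
    unfolding gev.add koszul_gev 1 2 3 koszul_h cbkt_jacobi[OF par(1) bxyz(1) par(2) bxyz(2,3)]
    by (simp add: distrib_left)
qed

section \<open>Parity and gradation\<close>

lemma direct_sum_decompositionI:
  fixes W :: "'i \<Rightarrow> 'r::ab_group_add set" and \<pi> :: "'i \<Rightarrow> 'r \<Rightarrow> 'k \<Rightarrow> 'a::ab_group_add"
  assumes zero: "\<And>i. 0 \<in> W i" and diff: "\<And>i x y. x \<in> W i \<Longrightarrow> y \<in> W i \<Longrightarrow> x - y \<in> W i"
    and sums: "\<And>x. \<exists>f :: 'i \<Rightarrow>\<^sub>0 'r. (\<forall>i. Poly_Mapping.lookup f i \<in> W i) \<and>
      x = (\<Sum>i\<in>Poly_Mapping.keys f. Poly_Mapping.lookup f i)"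
    and add: "\<And>i k. Modules.additive (\<lambda>x. \<pi> i x k)"
    and proj: "\<And>i j x k. x \<in> W j \<Longrightarrow> i \<noteq> j \<Longrightarrow> \<pi> i x k = 0"
    and inj: "\<And>x. (\<And>i k. \<pi> i x k = 0) \<Longrightarrow> x = 0"
  shows "direct_sum_decomposition W"
    and "x \<in> W i \<longleftrightarrow> (\<forall>j k. j \<noteq> i \<longrightarrow> \<pi> j x k = 0)"
proof -
  interpret P: Modules.additive "\<lambda>x. \<pi> i x k" for i k by (rule add)
  have proj_sum: "\<pi> i (\<Sum>j\<in>Poly_Mapping.keys f. Poly_Mapping.lookup f j) k = \<pi> i (Poly_Mapping.lookup f i) k"
    if "\<forall>j. Poly_Mapping.lookup f j \<in> W j" for f :: "'i \<Rightarrow>\<^sub>0 'r" and i k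
  proof -
    have "\<pi> i (\<Sum>j\<in>Poly_Mapping.keys f. Poly_Mapping.lookup f j) k
        = (\<Sum>j\<in>Poly_Mapping.keys f. if j = i then \<pi> i (Poly_Mapping.lookup f i) k else 0)"
      unfolding P.sum using proj[OF that[rule_format]] by (intro sum.cong refl) auto
    also have "\<dots> = \<pi> i (Poly_Mapping.lookup f i) k"
      by (auto simp: in_keys_iff P.zero)
    finally show ?thesis .
  qed
  have W_0: "y = 0" if "y \<in> W i" "\<And>k. \<pi> i y k = 0" for y i
    using that proj by (intro inj) (metis)
  show "direct_sum_decomposition W"
    unfolding direct_sum_decomposition_def
  proof
    fix x
    obtain f :: "'i \<Rightarrow>\<^sub>0 'r" where f: "\<forall>i. Poly_Mapping.lookup f i \<in> W i"
      "x = (\<Sum>i\<in>Poly_Mapping.keys f. Poly_Mapping.lookup f i)"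
      using sums by blast
    show "\<exists>!f :: 'i \<Rightarrow>\<^sub>0 'r. (\<forall>i. Poly_Mapping.lookup f i \<in> W i) \<and>
        x = (\<Sum>i\<in>Poly_Mapping.keys f. Poly_Mapping.lookup f i)"
    proof (rule ex1I[of _ f])
      show "(\<forall>i. Poly_Mapping.lookup f i \<in> W i) \<and> x = (\<Sum>i\<in>Poly_Mapping.keys f. Poly_Mapping.lookup f i)"
        using f by blast
      fix g :: "'i \<Rightarrow>\<^sub>0 'r"
      assume g: "(\<forall>i. Poly_Mapping.lookup g i \<in> W i) \<and> x = (\<Sum>i\<in>Poly_Mapping.keys g. Poly_Mapping.lookup g i)"
      show "g = f"
      proof (rule poly_mapping_eqI)
        fix i
        have "\<pi> i (Poly_Mapping.lookup g i - Poly_Mapping.lookup f i) k = 0" for k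
          using proj_sum[of f i k] proj_sum[of g i k] f g by (simp add: P.diff)
        then have "Poly_Mapping.lookup g i - Poly_Mapping.lookup f i = 0"
          using f g diff by (intro W_0[of _ i]) auto
        then show "Poly_Mapping.lookup g i = Poly_Mapping.lookup f i" by simp
      qed
    qed
  qed
  show "x \<in> W i \<longleftrightarrow> (\<forall>j k. j \<noteq> i \<longrightarrow> \<pi> j x k = 0)"
  proof
    assume *: "\<forall>j k. j \<noteq> i \<longrightarrow> \<pi> j x k = 0"
    obtain f :: "'i \<Rightarrow>\<^sub>0 'r" where f: "\<forall>i. Poly_Mapping.lookup f i \<in> W i"
      "x = (\<Sum>i\<in>Poly_Mapping.keys f. Poly_Mapping.lookup f i)"
      using sums by blast
    have "Poly_Mapping.lookup f j = 0" if "j \<noteq> i" for j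
      using * f that proj_sum[of f j] by (intro W_0[of _ j]) auto
    then have "x = (\<Sum>j\<in>Poly_Mapping.keys f. if j = i then Poly_Mapping.lookup f i else 0)"
      unfolding f(2) by (intro sum.cong) auto
    also have "\<dots> = Poly_Mapping.lookup f i"
      by (auto simp: in_keys_iff)
    finally show "x \<in> W i" using f by simp
  qed (use proj in blast)
qed

lemma decomposable_add:
  fixes W :: "'i \<Rightarrow> 'r::ab_group_add set"
  assumes W: "\<And>i x y. x \<in> W i \<Longrightarrow> y \<in> W i \<Longrightarrow> x + y \<in> W i"
    and "\<exists>f :: 'i \<Rightarrow>\<^sub>0 'r. (\<forall>i. Poly_Mapping.lookup f i \<in> W i) \<and> x = (\<Sum>i\<in>Poly_Mapping.keys f. Poly_Mapping.lookup f i)"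
    and "\<exists>f :: 'i \<Rightarrow>\<^sub>0 'r. (\<forall>i. Poly_Mapping.lookup f i \<in> W i) \<and> y = (\<Sum>i\<in>Poly_Mapping.keys f. Poly_Mapping.lookup f i)"
  shows "\<exists>f :: 'i \<Rightarrow>\<^sub>0 'r. (\<forall>i. Poly_Mapping.lookup f i \<in> W i) \<and> x + y = (\<Sum>i\<in>Poly_Mapping.keys f. Poly_Mapping.lookup f i)"
proof -
  obtain f g :: "'i \<Rightarrow>\<^sub>0 'r" where fg: "\<forall>i. Poly_Mapping.lookup f i \<in> W i" "x = (\<Sum>i\<in>Poly_Mapping.keys f. Poly_Mapping.lookup f i)"
    "\<forall>i. Poly_Mapping.lookup g i \<in> W i" "y = (\<Sum>i\<in>Poly_Mapping.keys g. Poly_Mapping.lookup g i)"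
    using assms(2,3) by blast
  let ?K = "Poly_Mapping.keys f \<union> Poly_Mapping.keys g"
  have sum_K: "(\<Sum>i\<in>Poly_Mapping.keys h. Poly_Mapping.lookup h i) = (\<Sum>i\<in>?K. Poly_Mapping.lookup h i)"
    if "Poly_Mapping.keys h \<subseteq> ?K" for h :: "'i \<Rightarrow>\<^sub>0 'r"
    using that by (intro sum.mono_neutral_left) (auto simp: in_keys_iff)
  have "x + y = (\<Sum>i\<in>Poly_Mapping.keys (f + g). Poly_Mapping.lookup (f + g) i)"
    using sum_K[OF keys_add] sum_K[of f] sum_K[of g] by (simp add: fg(2,4) lookup_add sum.distrib)
  moreover have "\<forall>i. Poly_Mapping.lookup (f + g) i \<in> W i"
    using fg W by (simp add: lookup_add)
  ultimately show ?thesis by blast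
qed

lemma decomposable_homogeneous:
  fixes W :: "'i \<Rightarrow> 'r::ab_group_add set"
  assumes "\<And>i. 0 \<in> W i" "x \<in> W i"
  shows "\<exists>f :: 'i \<Rightarrow>\<^sub>0 'r. (\<forall>i. Poly_Mapping.lookup f i \<in> W i) \<and> x = (\<Sum>i\<in>Poly_Mapping.keys f. Poly_Mapping.lookup f i)"
  using assms by (intro exI[of _ "Poly_Mapping.single i x"]) (auto simp: lookup_single when_def)

lemma re38_parity_subspace: "re38.subspace (re38_parity p)"
  unfolding re38_parity_def by (rule re38.subspace_span)

lemma re38_parity_decomposition:
  shows re38_parity_direct_sum: "direct_sum_decomposition (re38_parity :: bit \<Rightarrow> 'f::field_char_0 re38 set)"
    and re38_parity_iff: "(x :: 'f re38) \<in> re38_parity p \<longleftrightarrow> parity_vec p (coord x)"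
proof -
  let ?\<pi> = "\<lambda>p (x :: 'f re38) c. if coord_parity c = p then coord x c else 0"
  have homogeneous: "re38_act a (gen g) \<in> re38_parity (gen_parity g)" for a and g
    unfolding re38_parity_def by (rule re38.span_scale[OF re38.span_base]) auto
  have sums: "\<exists>f :: bit \<Rightarrow>\<^sub>0 'f re38. (\<forall>i. Poly_Mapping.lookup f i \<in> re38_parity i) \<and>
      x = (\<Sum>i\<in>Poly_Mapping.keys f. Poly_Mapping.lookup f i)" for x
  proof (induction x rule: re38_induct)
    case zero
    show ?case
      by (rule decomposable_homogeneous[of _ _ 0]) (rule re38.subspace_0[OF re38_parity_subspace])+
  next
    case (add x y)
    then show ?case
      by (intro decomposable_add re38.subspace_add[OF re38_parity_subspace])
  next
    case (act p g)
    show ?case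
      by (rule decomposable_homogeneous[where W = re38_parity, OF _ homogeneous]) (rule re38.subspace_0[OF re38_parity_subspace])
  qed
  have additive: "Modules.additive (\<lambda>x. ?\<pi> p x c)" for p c
    by unfold_locales (simp add: coord_add)
  have proj: "?\<pi> i x c = 0" if "x \<in> re38_parity j" "i \<noteq> j" for i j x c
    using parity_vec_coord[OF that(1)] that(2) by (auto simp: parity_vec_def)
  have inj: "x = 0" if "\<And>i c. ?\<pi> i x c = 0" for x
    by (rule coord_eq_0) (metis that)
  note D = direct_sum_decompositionI[where W = re38_parity and \<pi> = ?\<pi>]
  have D1: "direct_sum_decomposition (re38_parity :: bit \<Rightarrow> 'f re38 set)"
    by (rule D(1)) (fact sums additive proj inj | (rule re38.subspace_0[OF re38_parity_subspace] re38.subspace_diff[OF re38_parity_subspace]; assumption?))+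
  have D2: "x \<in> re38_parity n \<longleftrightarrow> (\<forall>j k. j \<noteq> n \<longrightarrow> ?\<pi> j x k = 0)" for x n
    by (rule D(2)) (fact sums additive proj inj | (rule re38.subspace_0[OF re38_parity_subspace] re38.subspace_diff[OF re38_parity_subspace]; assumption?))+
  show "direct_sum_decomposition (re38_parity :: bit \<Rightarrow> 'f re38 set)"
    by (rule D1)
  show "x \<in> re38_parity p \<longleftrightarrow> parity_vec p (coord x)"
    unfolding D2 parity_vec_def by auto
qed

lemma rbr_parity:
  assumes "a \<in> re38_parity p" "b \<in> re38_parity q"
  shows "Poly_Mapping.lookup (rbr a b) M \<in> re38_parity (p + q)"
proof -
  have gev_0: "gev (rbr a b) c = 0" if "coord_parity c \<noteq> p + q" for c
  proof -
    have "parity_vec (p + q) (cbkt (\<lambda>i. - lam i) (\<lambda>i. del i + lam i)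
        (\<lambda>c. ins numv (\<lambda>i. - lam i) (coord a c)) (\<lambda>c. ins numv (\<lambda>i. del i + lam i) (coord b c)))"
      by (intro cbkt_parity numv.parity_vec_ins assms)
    then have "cbkt (\<lambda>i. - lam i) (\<lambda>i. del i + lam i)
        (\<lambda>c. ins numv (\<lambda>i. - lam i) (coord a c)) (\<lambda>c. ins numv (\<lambda>i. del i + lam i) (coord b c)) c = 0"
      using that unfolding parity_vec_def by blast
    then show ?thesis
      by (simp only: numv.ev_rbr mult_zero_right)
  qed
  show ?thesis
    unfolding re38_parity_iff parity_vec_def
  proof (intro allI impI)
    fix c assume "coord_parity c \<noteq> p + q"
    then show "coord (Poly_Mapping.lookup (rbr a b) M) c = 0"
      using gev_0[of c] lookup_gev[of "rbr a b" c M] by simp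
  qed
qed

lemma rbr_lie_conformal:
  "lie_conformal_superalgebra re38_act re38_parity (rbr :: 'f::field_char_0 re38 lbracket)"
  by (intro lie_conformal_superalgebra.intro lie_conformal_superalgebra_axioms.intro)
    (rule module_re38_act re38_parity_subspace re38_parity_direct_sum rbr_bilinear rbr_parity
      rbr_sesquilinear rbr_skew rbr_jacobi; assumption?)+

definition wpoly :: "(int \<Rightarrow> 'a::comm_ring_1 set) \<Rightarrow> int \<Rightarrow> (3, 'a) rpoly set"
  where "wpoly G d = {x. \<forall>M. Poly_Mapping.lookup x M \<in> G (d - 2 * int (msize M))}"

locale graded_ring =
  fixes G :: "int \<Rightarrow> 'a::comm_ring_1 set"
  assumes G_0: "0 \<in> G d" and G_add: "x \<in> G d \<Longrightarrow> y \<in> G d \<Longrightarrow> x + y \<in> G d"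
    and G_minus: "x \<in> G d \<Longrightarrow> - x \<in> G d"
    and G_1: "1 \<in> G 0" and G_mult: "x \<in> G d \<Longrightarrow> y \<in> G e \<Longrightarrow> d + e = k \<Longrightarrow> x * y \<in> G k"
begin

lemma G_diff: "x \<in> G d \<Longrightarrow> y \<in> G d \<Longrightarrow> x - y \<in> G d"
  using G_add[OF _ G_minus] by simp

lemma G_sum: "(\<And>i. i \<in> A \<Longrightarrow> f i \<in> G d) \<Longrightarrow> sum f A \<in> G d"
  by (induction A rule: infinite_finite_induct) (simp_all add: G_0 G_add)

lemma G_numeral: "numeral n \<in> G 0"
  by (induction n) (simp_all only: numeral.simps G_1 G_add)

lemma G_power: "x \<in> G d \<Longrightarrow> x ^ n \<in> G (int n * d)"
  by (induction n) (auto intro!: G_1 G_mult simp: algebra_simps)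

lemma G_prod: "(\<And>i. i \<in> A \<Longrightarrow> f i \<in> G (d i)) \<Longrightarrow> prod f A \<in> G (sum d A)"
  by (induction A rule: infinite_finite_induct) (auto intro: G_1 G_mult)

lemma G_mpower:
  assumes "\<And>i. q i \<in> G 2"
  shows "mpower q M \<in> G (2 * int (msize M))"
proof -
  have "mpower q M \<in> G (\<Sum>i\<in>UNIV. int (Poly_Mapping.lookup M i) * 2)"
    unfolding mpower_def by (intro G_prod G_power assms)
  then show ?thesis
    by (simp add: msize_def sum_distrib_left mult.commute)
qed

lemma wpoly_single: "x \<in> G (d - 2 * int (msize M)) \<Longrightarrow> Poly_Mapping.single M x \<in> wpoly G d"
  by (auto simp: wpoly_def lookup_single when_def G_0)

lemma wpoly_add: "x \<in> wpoly G d \<Longrightarrow> y \<in> wpoly G d \<Longrightarrow> x + y \<in> wpoly G d"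
  by (simp add: wpoly_def lookup_add G_add)

lemma wpoly_0: "0 \<in> wpoly G d"
  by (simp add: wpoly_def G_0)

lemma wpoly_sum: "(\<And>i. i \<in> A \<Longrightarrow> f i \<in> wpoly G d) \<Longrightarrow> sum f A \<in> wpoly G d"
  by (induction A rule: infinite_finite_induct) (simp_all add: wpoly_add wpoly_0)

lemma graded_ring_wpoly: "graded_ring (wpoly G)"
proof
  fix x y :: "(3, 'a) rpoly" and d e k :: int
  assume x: "x \<in> wpoly G d" and y: "y \<in> wpoly G e" and k: "d + e = k"
  have "pact (*) x y \<in> wpoly G k"
    unfolding pact_def
  proof (intro wpoly_sum wpoly_single G_mult)
    fix M N
    show "Poly_Mapping.lookup x M \<in> G (d - 2 * int (msize M))" "Poly_Mapping.lookup y N \<in> G (e - 2 * int (msize N))"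
      using x y by (simp_all add: wpoly_def)
    show "d - 2 * int (msize M) + (e - 2 * int (msize N)) = k - 2 * int (msize (M + N))"
      by (simp add: msize_def lookup_add sum.distrib flip: k)
  qed
  then show "x * y \<in> wpoly G k" by (simp add: mult_eq_pact)
next
  show "1 \<in> wpoly G 0"
    using wpoly_single[of 1 0 0] G_1 by (simp add: msize_def)
qed (auto simp: wpoly_def lookup_add G_0 G_add G_minus)

lemma wpoly_pvar: "pvar i \<in> wpoly G 2"
  unfolding pvar_def by (rule wpoly_single) (simp add: msize_def lookup_single when_def G_1)

lemma wpoly_pconst: "x \<in> G d \<Longrightarrow> pconst x \<in> wpoly G d"
  unfolding pconst_def by (rule wpoly_single) (simp add: msize_def)

end

definition weight_0 :: "int \<Rightarrow> 'a::comm_ring_1 set"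
  where "weight_0 d = (if d = 0 then UNIV else {0})"

interpretation weight_0: graded_ring weight_0
  by unfold_locales (auto simp: weight_0_def split: if_splits)

definition coord_degree :: "coord \<Rightarrow> int"
  where "coord_degree c = (case c of CA i \<Rightarrow> -2 | CB i \<Rightarrow> 4 | CE \<Rightarrow> 0 | CF \<Rightarrow> 0 | CH \<Rightarrow> 0 | CV l \<Rightarrow> -3 | CD t l \<Rightarrow> 1)"

context graded_ring
begin

lemma cbkt_degree:
  assumes "\<And>i. \<xi> i \<in> G 2" "\<And>i. \<eta> i \<in> G 2"
    and "\<And>c. X c \<in> G (coord_degree c - m)" "\<And>c. Y c \<in> G (coord_degree c - n)"
  shows "cbkt \<xi> \<eta> X Y c \<in> G (coord_degree c - m - n)"
proof -
  have x: "\<And>i k. k = 2 \<Longrightarrow> \<xi> i \<in> G k" and y: "\<And>i k. k = 2 \<Longrightarrow> \<eta> i \<in> G k"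
    using assms(1,2) by simp_all
  have X: "\<And>i k. k = - 2 - m \<Longrightarrow> X (CA i) \<in> G k" "\<And>i k. k = 4 - m \<Longrightarrow> X (CB i) \<in> G k"
    "\<And>k. k = - m \<Longrightarrow> X CE \<in> G k" "\<And>k. k = - m \<Longrightarrow> X CF \<in> G k" "\<And>k. k = - m \<Longrightarrow> X CH \<in> G k"
    "\<And>i k. k = - 3 - m \<Longrightarrow> X (CV i) \<in> G k" "\<And>i l k. k = 1 - m \<Longrightarrow> X (CD i l) \<in> G k"
    using assms(3)[of "CA _"] assms(3)[of "CB _"] assms(3)[of CE] assms(3)[of CF] assms(3)[of CH]
      assms(3)[of "CV _"] assms(3)[of "CD _ _"] by (simp_all add: coord_degree_def)
  have Y: "\<And>i k. k = - 2 - n \<Longrightarrow> Y (CA i) \<in> G k" "\<And>i k. k = 4 - n \<Longrightarrow> Y (CB i) \<in> G k"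
    "\<And>k. k = - n \<Longrightarrow> Y CE \<in> G k" "\<And>k. k = - n \<Longrightarrow> Y CF \<in> G k" "\<And>k. k = - n \<Longrightarrow> Y CH \<in> G k"
    "\<And>i k. k = - 3 - n \<Longrightarrow> Y (CV i) \<in> G k" "\<And>i l k. k = 1 - n \<Longrightarrow> Y (CD i l) \<in> G k"
    using assms(4)[of "CA _"] assms(4)[of "CB _"] assms(4)[of CE] assms(4)[of CF] assms(4)[of CH]
      assms(4)[of "CV _"] assms(4)[of "CD _ _"] by (simp_all add: coord_degree_def)
  have num: "\<And>n k. k = 0 \<Longrightarrow> numeral n \<in> G k"
    using G_numeral by simp
  note rules = num X Y x y G_add G_diff G_minus G_mult
  have "\<forall>c. cbkt \<xi> \<eta> X Y c \<in> G (coord_degree c - m - n)"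
    unfolding all_coord
    by (intro conjI; simp add: cbkt_def curl_simps bkt_defs cb_def coord_degree_def; (rule rules | rule refl | linarith)+)
  then show ?thesis ..
qed

end

lemma coord_gen_degree: "coord (gen g) c \<in> wpoly weight_0 (coord_degree c - gen_degree g)"
proof -
  interpret W: graded_ring "wpoly weight_0" by (rule weight_0.graded_ring_wpoly)
  have one: "of_bool b \<in> wpoly weight_0 k" if "b \<Longrightarrow> k = 0" for b k
    using that W.G_1 W.G_0 by (cases b) auto
  have var: "pvar i \<in> wpoly weight_0 k" if "k = 2" for i k
    using weight_0.wpoly_pvar that by simp
  have "\<forall>c. coord (gen g) c \<in> wpoly weight_0 (coord_degree c - gen_degree g)"
    unfolding all_coord coord_gen_gcoord curl_simps crs_simps cb_def gcoord_simps coord_degree_def coord.case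
    by (intro conjI W.G_diff W.G_mult[OF var one refl] one refl; clarsimp simp: weight_0.wpoly_pvar W.G_0)
  then show ?thesis ..
qed

lemma module_fscale: "module (fscale re38_act :: 'f::field \<Rightarrow> _)"
  by unfold_locales (simp_all add: re38.scale_right_distrib re38.scale_left_distrib re38.scale_scale
      pconst.map_add pconst.map_mult pconst.map_one)

global_interpretation fre38: module "fscale re38_act :: 'f::field \<Rightarrow> _"
  by (rule module_fscale)

lemma re38_degree_subspace: "fre38.subspace (re38_degree n)"
  unfolding re38_degree_def by (rule fre38.subspace_span)

lemma re38_degree_monom:
  "re38_act (Poly_Mapping.single M c) (gen g) \<in> re38_degree (gen_degree g - 2 * int (msize M))"
proof -
  have "re38_act (Poly_Mapping.single M c) (gen g) = fscale re38_act c (re38_act (Poly_Mapping.single M 1) (gen g))"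
    by (simp add: re38.scale_scale pconst_def mult_single)
  then show ?thesis
    unfolding re38_degree_def by (simp only:) (rule fre38.span_scale[OF fre38.span_base], blast)
qed

lemma coord_degree_wpoly:
  "x \<in> re38_degree n \<Longrightarrow> coord x c \<in> wpoly weight_0 (coord_degree c - n)"
  unfolding re38_degree_def
proof (induction rule: fre38.span_induct_alt)
  interpret W: graded_ring "wpoly weight_0" by (rule weight_0.graded_ring_wpoly)
  case base
  show ?case by (simp add: coord.zero W.G_0)
next
  interpret W: graded_ring "wpoly weight_0" by (rule weight_0.graded_ring_wpoly)
  case (step k x y)
  then obtain M g where x: "x = re38_act (Poly_Mapping.single M 1) (gen g)" "gen_degree g - 2 * int (msize M) = n"
    by blast
  have "pconst k * (Poly_Mapping.single M 1 * coord (gen g) c) \<in> wpoly weight_0 (coord_degree c - n)"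
    by (rule W.G_mult[OF weight_0.wpoly_pconst[of _ 0] W.G_mult[OF weight_0.wpoly_single[of _ "2 * int (msize M)"] coord_gen_degree refl]])
      (use x(2) in \<open>simp_all add: weight_0_def\<close>)
  with step show ?case
    by (simp add: coord_add coord_act x(1) W.G_add mult.assoc)
qed

lemma re38_degree_decomposition:
  shows re38_degree_direct_sum: "direct_sum_decomposition (re38_degree :: int \<Rightarrow> 'f::field_char_0 re38 set)"
    and re38_degree_iff: "(x :: 'f re38) \<in> re38_degree n \<longleftrightarrow> (\<forall>c. coord x c \<in> wpoly weight_0 (coord_degree c - n))"
proof -
  let ?\<pi> = "\<lambda>n (x :: 'f re38) (c, K). if coord_degree c - n = 2 * int (msize K) then Poly_Mapping.lookup (coord x c) K else 0"
  have wpoly: "p \<in> wpoly weight_0 d \<longleftrightarrow> (\<forall>K. d \<noteq> 2 * int (msize K) \<longrightarrow> Poly_Mapping.lookup p K = 0)" for p :: "'f dpoly" and d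
    by (auto simp: wpoly_def weight_0_def)
  have sums: "\<exists>f :: int \<Rightarrow>\<^sub>0 'f re38. (\<forall>i. Poly_Mapping.lookup f i \<in> re38_degree i) \<and>
      x = (\<Sum>i\<in>Poly_Mapping.keys f. Poly_Mapping.lookup f i)" for x
  proof (induction x rule: re38_induct)
    case zero
    show ?case
      by (rule decomposable_homogeneous[of _ _ 0]) (rule fre38.subspace_0[OF re38_degree_subspace])+
  next
    case (add x y)
    then show ?case
      by (intro decomposable_add fre38.subspace_add[OF re38_degree_subspace])
  next
    case (act p g)
    have "\<exists>f :: int \<Rightarrow>\<^sub>0 'f re38. (\<forall>i. Poly_Mapping.lookup f i \<in> re38_degree i) \<and>
        re38_act (\<Sum>M\<in>A. Poly_Mapping.single M (k M)) (gen g) = (\<Sum>i\<in>Poly_Mapping.keys f. Poly_Mapping.lookup f i)"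
      if "finite A" for A and k :: "expo \<Rightarrow> 'f"
      using that
    proof induction
      case empty
      show ?case
        unfolding sum.empty re38.scale_zero_left
        by (rule decomposable_homogeneous[of _ _ 0]) (rule fre38.subspace_0[OF re38_degree_subspace])+
    next
      case (insert M A)
      have "\<exists>f :: int \<Rightarrow>\<^sub>0 'f re38. (\<forall>i. Poly_Mapping.lookup f i \<in> re38_degree i) \<and>
        re38_act (Poly_Mapping.single M (k M)) (gen g) = (\<Sum>i\<in>Poly_Mapping.keys f. Poly_Mapping.lookup f i)"
        by (rule decomposable_homogeneous[where W = re38_degree, OF _ re38_degree_monom]) (rule fre38.subspace_0[OF re38_degree_subspace])
      from decomposable_add[OF fre38.subspace_add[OF re38_degree_subspace] this insert.IH]
      show ?case
        unfolding sum.insert[OF insert.hyps] re38.scale_left_distrib .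
    qed
    from this[of "Poly_Mapping.keys p" "Poly_Mapping.lookup p"] show ?case
      by (simp flip: poly_mapping_sum_single)
  qed
  have additive: "Modules.additive (\<lambda>x. ?\<pi> n x k)" for n k
    by unfold_locales (simp add: coord_add lookup_add split: prod.split)
  have proj: "?\<pi> i x k = 0" if "x \<in> re38_degree j" "i \<noteq> j" for i j x k
    using coord_degree_wpoly[OF that(1)] that(2) by (auto simp: wpoly split: prod.split)
  have inj: "x = 0" if \<pi>: "\<And>i k. ?\<pi> i x k = 0" for x
  proof (rule coord_eq_0, rule poly_mapping_eqI)
    show "Poly_Mapping.lookup (coord x c) K = Poly_Mapping.lookup 0 K" for c K
      using \<pi>[of "coord_degree c - 2 * int (msize K)" "(c, K)"] by simp
  qed
  note D = direct_sum_decompositionI[where W = re38_degree and \<pi> = ?\<pi>]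
  have D1: "direct_sum_decomposition (re38_degree :: int \<Rightarrow> 'f re38 set)"
    by (rule D(1)) (fact sums additive proj inj | (rule fre38.subspace_0[OF re38_degree_subspace] fre38.subspace_diff[OF re38_degree_subspace]; assumption?))+
  have D2: "x \<in> re38_degree n \<longleftrightarrow> (\<forall>j k. j \<noteq> n \<longrightarrow> ?\<pi> j x k = 0)" for x n
    by (rule D(2)) (fact sums additive proj inj | (rule fre38.subspace_0[OF re38_degree_subspace] fre38.subspace_diff[OF re38_degree_subspace]; assumption?))+
  show "direct_sum_decomposition (re38_degree :: int \<Rightarrow> 'f re38 set)"
    by (rule D1)
  show "x \<in> re38_degree n \<longleftrightarrow> (\<forall>c. coord x c \<in> wpoly weight_0 (coord_degree c - n))"
  proof
    assume "\<forall>c. coord x c \<in> wpoly weight_0 (coord_degree c - n)"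
    then have z: "?\<pi> j x (c, K) = 0" if "j \<noteq> n" for j c K
      using that unfolding wpoly by simp
    show "x \<in> re38_degree n"
      unfolding D2
    proof (intro allI impI)
      fix j :: int and k :: "coord \<times> expo" assume "j \<noteq> n"
      from z[OF this, of "fst k" "snd k"] show "?\<pi> j x k = 0"
        by (simp only: prod.collapse)
    qed
  qed (intro allI coord_degree_wpoly)
qed

lemma ins_coord_degree:
  fixes q :: "3 \<Rightarrow> (3, 'f::field_char_0 dpoly) rpoly"
  assumes "x \<in> re38_degree n" and q: "\<And>i. q i \<in> wpoly (wpoly weight_0) 2"
  shows "ins numv q (coord x c) \<in> wpoly (wpoly weight_0) (coord_degree c - n)"
proof -
  interpret W: graded_ring "wpoly weight_0" by (rule weight_0.graded_ring_wpoly)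
  interpret W2: graded_ring "wpoly (wpoly weight_0)" by (rule W.graded_ring_wpoly)
  show ?thesis
    unfolding ins_def
  proof (intro W2.G_sum)
    fix M assume "M \<in> Poly_Mapping.keys (coord x c)"
    then have "coord_degree c - n = 2 * int (msize M)"
      using coord_degree_wpoly[OF assms(1), of c] by (auto simp: wpoly_def weight_0_def in_keys_iff split: if_splits)
    then show "numv (Poly_Mapping.lookup (coord x c) M) * mpower q M \<in> wpoly (wpoly weight_0) (coord_degree c - n)"
      by (intro W2.G_mult[OF _ W2.G_mpower[OF q], of _ 0] W.wpoly_pconst weight_0.wpoly_pconst)
        (simp_all add: weight_0_def)
  qed
qed

lemma rbr_degree:
  assumes "a \<in> re38_degree m" "b \<in> re38_degree n"
  shows "rbr a (b :: 'f::field_char_0 re38) \<in> rpoly_degree re38_degree (m + n)"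
proof -
  interpret W: graded_ring "wpoly weight_0 :: _ \<Rightarrow> 'f dpoly set" by (rule weight_0.graded_ring_wpoly)
  interpret W2: graded_ring "wpoly (wpoly weight_0) :: _ \<Rightarrow> (3, 'f dpoly) rpoly set" by (rule W.graded_ring_wpoly)
  have lam: "(lam i :: (3, 'f dpoly) rpoly) \<in> wpoly (wpoly weight_0) 2"
    and del: "(del i :: (3, 'f dpoly) rpoly) \<in> wpoly (wpoly weight_0) 2" for i :: 3
    by (rule W.wpoly_pvar) (rule W.wpoly_pconst[OF weight_0.wpoly_pvar])
  have "gev (rbr a b) c \<in> wpoly (wpoly weight_0) (coord_degree c - m - n)" for c
    unfolding numv.ev_rbr
  proof (rule W2.G_mult)
    show "(num (1/2) :: (3, 'f dpoly) rpoly) \<in> wpoly (wpoly weight_0) 0"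
      by (intro W.wpoly_pconst weight_0.wpoly_pconst) (simp add: weight_0_def)
    show "cbkt (\<lambda>i. - lam i) (\<lambda>i. del i + lam i) (\<lambda>c. ins numv (\<lambda>i. - lam i) (coord a c))
        (\<lambda>c. ins numv (\<lambda>i. del i + lam i) (coord b c)) c \<in> wpoly (wpoly weight_0) (coord_degree c - m - n)"
      by (intro W2.cbkt_degree ins_coord_degree assms W2.G_minus W2.G_add lam del)
  qed simp
  then show ?thesis
    by (auto simp: rpoly_degree_def re38_degree_iff wpoly_def[of "wpoly weight_0"] lookup_gev algebra_simps)
qed

lemma re38_degree_pvar:
  assumes "a \<in> re38_degree n"
  shows "re38_act (pvar i) (a :: 'f::field_char_0 re38) \<in> re38_degree (n - 2)"
proof -
  interpret W: graded_ring "wpoly weight_0 :: _ \<Rightarrow> 'f dpoly set" by (rule weight_0.graded_ring_wpoly)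
  show ?thesis
    unfolding re38_degree_iff coord_act
    by (intro allI W.G_mult[OF weight_0.wpoly_pvar coord_degree_wpoly[OF assms]]) simp
qed

lemma rbr_Z_graded: "Z_graded re38_act (rbr :: 'f::field_char_0 re38 lbracket) re38_degree"
  unfolding Z_graded_def
  by (intro conjI allI ballI re38_degree_subspace re38_degree_direct_sum re38_degree_pvar rbr_degree)

section \<open>Power series\<close>

lemma finite_expo_below: "finite {K :: expo. \<forall>i. Poly_Mapping.lookup K i \<le> Poly_Mapping.lookup M i}"
proof (rule finite_imageD)
  show "inj_on Poly_Mapping.lookup {K :: expo. \<forall>i. Poly_Mapping.lookup K i \<le> Poly_Mapping.lookup M i}"
    by (meson inj_onI poly_mapping.lookup_inject)
  show "finite (Poly_Mapping.lookup ` {K :: expo. \<forall>i. Poly_Mapping.lookup K i \<le> Poly_Mapping.lookup M i})"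
    by (rule finite_subset[OF _ finite_PiE[of UNIV "\<lambda>i. {..Poly_Mapping.lookup M i}"]]) (auto simp: PiE_def)
qed

lemma finite_expo_sum: "finite {(K, L). K + L = (M :: expo)}"
proof (rule finite_subset)
  let ?A = "{K :: expo. \<forall>i. Poly_Mapping.lookup K i \<le> Poly_Mapping.lookup M i}"
  show "{(K, L). K + L = M} \<subseteq> ?A \<times> ?A"
    by (auto simp: lookup_add)
  show "finite (?A \<times> ?A)"
    by (intro finite_cartesian_product finite_expo_below)
qed

abbreviation unit_expo :: "3 \<Rightarrow> expo"
  where "unit_expo i \<equiv> Poly_Mapping.single i 1"

lemma unit_expo_decomp:
  assumes "Poly_Mapping.lookup K i \<noteq> 0"
  shows "\<exists>K'. K = K' + unit_expo i"
proof
  show "K = (K - unit_expo i) + unit_expo i"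
  proof (rule poly_mapping_eqI)
    fix j
    show "Poly_Mapping.lookup K j = Poly_Mapping.lookup ((K - unit_expo i) + unit_expo i) j"
      using assms by (cases "j = i") (simp_all add: lookup_add lookup_minus lookup_single)
  qed
qed

lemma sum_expo_shift:
  fixes F :: "expo \<Rightarrow> expo \<Rightarrow> 'a::comm_semiring_1"
  shows "(\<Sum>(K, L)\<in>{(K, L). K + L = M + unit_expo i}. of_nat (Poly_Mapping.lookup K i) * F K L) =
    (\<Sum>(K, L)\<in>{(K, L). K + L = M}. of_nat (Poly_Mapping.lookup K i + 1) * F (K + unit_expo i) L)"
proof -
  let ?e = "unit_expo i" and ?l = "\<lambda>K :: expo. Poly_Mapping.lookup K i"
  define N where "N = M + ?e"
  let ?T = "{(K, L). K + L = N \<and> ?l K \<noteq> 0}"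
  have "(\<Sum>(K, L)\<in>{(K, L). K + L = N}. of_nat (?l K) * F K L) = (\<Sum>(K, L)\<in>?T. of_nat (?l K) * F K L)"
    by (rule sum.mono_neutral_right[OF finite_expo_sum]) (auto intro!: Nat.gr0I)
  also have "\<dots> = (\<Sum>(K, L)\<in>{(K, L). K + L = M}. of_nat (?l K + 1) * F (K + ?e) L)"
  proof (rule sum.reindex_bij_witness[of _ "\<lambda>(K, L). (K + ?e, L)" "\<lambda>(K, L). (K - ?e, L)"])
    fix KL assume "KL \<in> ?T"
    then obtain K L where KL: "KL = (K, L)" "K + L = N" "?l K \<noteq> 0" by blast
    then obtain K' where K': "K = K' + ?e" using unit_expo_decomp by blast
    have "(K' + L) + ?e = M + ?e"
      using KL(2) unfolding K' N_def by (simp only: add_ac)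
    then have M: "K' + L = M" by (simp only: add_right_cancel)
    have minus: "K - ?e = K'"
      unfolding K' by (rule add_diff_cancel_right')
    have l: "?l K = ?l K' + 1"
      unfolding K' by (simp add: lookup_add)
    show "(case case KL of (K, L) \<Rightarrow> (K - ?e, L) of (K, L) \<Rightarrow> (K + ?e, L)) = KL"
      by (simp only: KL(1) prod.case minus K'[symmetric])
    show "(case KL of (K, L) \<Rightarrow> (K - ?e, L)) \<in> {(K, L). K + L = M}"
      by (simp only: KL(1) prod.case minus mem_Collect_eq M)
    show "(case case KL of (K, L) \<Rightarrow> (K - ?e, L) of (K, L) \<Rightarrow> of_nat (?l K + 1) * F (K + ?e) L) =
        (case KL of (K, L) \<Rightarrow> of_nat (?l K) * F K L)"
      by (simp only: KL(1) prod.case minus l K'[symmetric])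
  next
    fix KL assume "KL \<in> {(K, L). K + L = M}"
    then obtain K L where KL: "KL = (K, L)" "K + L = M" by blast
    have "(K + ?e) + L = (K + L) + ?e" by (simp only: add_ac)
    with KL(2) have e: "(K + ?e) + L = N" by (simp only: N_def)
    have l: "?l (K + ?e) \<noteq> 0" by (simp add: lookup_add)
    show "(case case KL of (K, L) \<Rightarrow> (K + ?e, L) of (K, L) \<Rightarrow> (K - ?e, L)) = KL"
      by (simp only: KL(1) prod.case add_diff_cancel_right')
    show "(case KL of (K, L) \<Rightarrow> (K + ?e, L)) \<in> ?T"
      using l by (simp only: KL(1) prod.case mem_Collect_eq e simp_thms)
  qed
  finally show ?thesis unfolding N_def .
qed

lemma sum_expo_swap:
  "(\<Sum>(K, L)\<in>{(K, L). K + L = (M :: expo)}. F K L) = (\<Sum>(K, L)\<in>{(K, L). K + L = M}. F L K)"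
  by (rule sum.reindex_bij_witness[of _ prod.swap prod.swap]) (auto simp: add.commute)

lemma ps_deriv_mult:
  "ps_deriv i (ps_mult f g) = (\<lambda>M. ps_mult (ps_deriv i f) g M + ps_mult f (ps_deriv i g) M)"
proof
  fix M
  let ?S = "\<lambda>M. {(K, L). K + L = (M :: expo)}" and ?e = "unit_expo i"
  let ?l = "\<lambda>K. Poly_Mapping.lookup K i"
  have "(\<Sum>(K, L)\<in>?S (M + ?e). of_nat (?l K) * (f K * g L)) = ps_mult (ps_deriv i f) g M"
    unfolding sum_expo_shift by (simp add: ps_mult_def ps_deriv_def mult.assoc)
  moreover have "(\<Sum>(K, L)\<in>?S (M + ?e). of_nat (?l L) * (f K * g L)) = ps_mult f (ps_deriv i g) M"
  proof -
    have "(\<Sum>(K, L)\<in>?S (M + ?e). of_nat (?l L) * (f K * g L)) = (\<Sum>(L, K)\<in>?S (M + ?e). of_nat (?l L) * (f K * g L))"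
      by (rule sum_expo_swap)
    also have "\<dots> = (\<Sum>(L, K)\<in>?S M. of_nat (?l L + 1) * (f K * g (L + ?e)))"
      by (rule sum_expo_shift)
    also have "\<dots> = (\<Sum>(K, L)\<in>?S M. of_nat (?l L + 1) * (f K * g (L + ?e)))"
      by (rule sum_expo_swap)
    finally show ?thesis
      by (simp only: ps_mult_def ps_deriv_def mult.left_commute)
  qed
  moreover have "ps_deriv i (ps_mult f g) M =
      (\<Sum>(K, L)\<in>?S (M + ?e). of_nat (?l K) * (f K * g L)) + (\<Sum>(K, L)\<in>?S (M + ?e). of_nat (?l L) * (f K * g L))"
  proof -
    have key: "of_nat (?l M + 1) = of_nat (?l K) + (of_nat (?l L) :: 'a)" if "K + L = M + ?e" for K L
    proof -
      have "?l K + ?l L = ?l M + 1"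
        using arg_cong[OF that, of ?l] by (simp only: lookup_add lookup_single_eq)
      then show ?thesis by (metis of_nat_add)
    qed
    have "of_nat (?l M + 1) * (case KL of (K, L) \<Rightarrow> f K * g L) =
        (case KL of (K, L) \<Rightarrow> of_nat (?l K) * (f K * g L)) + (case KL of (K, L) \<Rightarrow> of_nat (?l L) * (f K * g L))"
      if "KL \<in> ?S (M + ?e)" for KL
    proof -
      obtain K L where KL: "KL = (K, L)" "K + L = M + ?e" using \<open>KL \<in> ?S (M + ?e)\<close> by blast
      show ?thesis
        unfolding KL(1) prod.case key[OF KL(2)] distrib_right ..
    qed
    then show ?thesis
      unfolding ps_deriv_def ps_mult_def sum_distrib_left sum.distrib[symmetric]
      by (intro sum.cong refl)
  qed
  ultimately show "ps_deriv i (ps_mult f g) M = ps_mult (ps_deriv i f) g M + ps_mult f (ps_deriv i g) M"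
    by (simp only:)
qed

lemma ps_deriv_commute: "ps_deriv i (ps_deriv j f) = ps_deriv j (ps_deriv i f)"
  by (rule ext) (auto simp: ps_deriv_def lookup_add lookup_single when_def add_ac)

lemma ps_deriv_add: "ps_deriv i (\<lambda>M. f M + g M) = (\<lambda>M. ps_deriv i f M + ps_deriv i g M)"
  by (simp add: ps_deriv_def distrib_left)

lemma ps_deriv_scale: "ps_deriv i (\<lambda>M. c * f M) = (\<lambda>M. c * ps_deriv i f M)"
  by (simp add: ps_deriv_def mult.left_commute)

lemma ps_mderiv_0: "ps_mderiv 0 f = f"
  by (simp add: ps_mderiv_def)

lemma funpow_ps_deriv_swap: "(ps_deriv i ^^ n) (ps_deriv j f) = ps_deriv j ((ps_deriv i ^^ n) f)"
  by (induction n) (simp_all add: ps_deriv_commute)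

lemma ps_mderiv_deriv: "ps_mderiv J (ps_deriv i f) = ps_deriv i (ps_mderiv J f)"
  by (simp add: ps_mderiv_def funpow_ps_deriv_swap)

lemma ps_mderiv_unit: "ps_mderiv (J + unit_expo i) f = ps_mderiv J (ps_deriv i f)"
  using exhaust_3[of i]
  by (elim disjE) (simp_all add: ps_mderiv_def lookup_add lookup_single funpow_ps_deriv_swap)

lemma funpow_ps_deriv_linear:
  "(ps_deriv i ^^ n) (\<lambda>M. f M + g M) = (\<lambda>M. (ps_deriv i ^^ n) f M + (ps_deriv i ^^ n) g M)"
  "(ps_deriv i ^^ n) (\<lambda>M. c * f M) = (\<lambda>M. c * (ps_deriv i ^^ n) f M)"
  by (induction n) (simp_all add: ps_deriv_add ps_deriv_scale)

lemma ps_mderiv_add: "ps_mderiv J (\<lambda>M. f M + g M) = (\<lambda>M. ps_mderiv J f M + ps_mderiv J g M)"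
  by (simp add: ps_mderiv_def funpow_ps_deriv_linear)

lemma ps_mderiv_scale: "ps_mderiv J (\<lambda>M. c * f M) = (\<lambda>M. c * ps_mderiv J f M)"
  by (simp add: ps_mderiv_def funpow_ps_deriv_linear)

lemma ps_mult_add_left: "ps_mult (\<lambda>M. f M + f' M) g = (\<lambda>M. ps_mult f g M + ps_mult f' g M)"
  by (rule ext) (simp add: ps_mult_def distrib_right sum.distrib case_prod_unfold)

lemma ps_mult_add_right: "ps_mult f (\<lambda>M. g M + g' M) = (\<lambda>M. ps_mult f g M + ps_mult f g' M)"
  by (rule ext) (simp add: ps_mult_def distrib_left sum.distrib case_prod_unfold)

lemma ps_mult_scale_left: "ps_mult (\<lambda>M. c * f M) g = (\<lambda>M. c * ps_mult f g M)"
  by (rule ext) (simp add: ps_mult_def sum_distrib_left case_prod_unfold mult.assoc)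

lemma ps_mult_scale_right: "ps_mult f (\<lambda>M. c * g M) = (\<lambda>M. c * ps_mult f g M)"
  by (rule ext) (simp add: ps_mult_def sum_distrib_left case_prod_unfold mult.left_commute)

lemma ps_deriv_monom:
  "ps_deriv i (ps_monom M) = (if Poly_Mapping.lookup M i = 0 then (\<lambda>_. 0)
     else (\<lambda>N. of_nat (Poly_Mapping.lookup M i) * ps_monom (M - unit_expo i) N))"
proof -
  have "N + unit_expo i = M \<longleftrightarrow> Poly_Mapping.lookup M i \<noteq> 0 \<and> N = M - unit_expo i" for N
  proof
    assume "N + unit_expo i = M"
    then show "Poly_Mapping.lookup M i \<noteq> 0 \<and> N = M - unit_expo i"
      by (auto simp: lookup_add)
  next
    assume "Poly_Mapping.lookup M i \<noteq> 0 \<and> N = M - unit_expo i"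
    then show "N + unit_expo i = M"
      using unit_expo_decomp[of M i] by auto
  qed
  moreover have "Poly_Mapping.lookup (M - unit_expo i) i + 1 = Poly_Mapping.lookup M i" if "Poly_Mapping.lookup M i \<noteq> 0"
    using that by (simp add: lookup_minus)
  ultimately show ?thesis
    by (auto simp: fun_eq_iff ps_deriv_def ps_monom_def simp flip: of_nat_Suc)
qed

lemma ps_mult_one: "ps_mult (ps_monom 0) g = g"
proof
  fix M
  have "ps_mult (ps_monom 0) g M = (\<Sum>KL\<in>{(K, L). K + L = M}. if KL = (0, M) then g M else 0)"
    unfolding ps_mult_def by (intro sum.cong) (auto simp: ps_monom_def split: if_splits)
  then show "ps_mult (ps_monom 0) g M = g M"
    by (simp add: finite_expo_sum)
qed

lemma ps_mult_0: "ps_mult (\<lambda>_. 0) g = (\<lambda>_. 0)"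
  using ps_mult_scale_left[of 0 "\<lambda>_. 0" g] by simp

lemma ps_mderiv_const:
  assumes "J \<noteq> 0"
  shows "ps_mderiv J (ps_monom 0) = (\<lambda>_. 0)"
proof -
  obtain i where "Poly_Mapping.lookup J i \<noteq> 0"
    using assms by (metis lookup_zero poly_mapping_eqI)
  then obtain J' where "J = J' + unit_expo i" using unit_expo_decomp by blast
  then have "ps_mderiv J (ps_monom 0) = ps_mderiv J' (ps_deriv i (ps_monom 0))"
    by (simp only: ps_mderiv_unit)
  also have "\<dots> = ps_mderiv J' (\<lambda>M. 0 * ps_monom 0 M)"
    by (simp add: ps_deriv_monom)
  also have "\<dots> = (\<lambda>_. 0)"
    unfolding ps_mderiv_scale by simp
  finally show ?thesis .
qed

section \<open>The annihilation algebra\<close>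

lemma lookup_sym_scale [simp]: "Poly_Mapping.lookup (sym_scale c x) k = c * Poly_Mapping.lookup x k"
  by (simp add: sym_scale_def map.rep_eq when_def)

lemma module_sym_scale: "module (sym_scale :: 'f::field \<Rightarrow> ('f, 'r) presym \<Rightarrow> _)"
  by unfold_locales (auto intro!: poly_mapping_eqI simp: lookup_add algebra_simps)

global_interpretation sym: module "sym_scale :: 'f::field \<Rightarrow> ('f, 'r) presym \<Rightarrow> _"
  by (rule module_sym_scale)

abbreviation ann_null :: "('f::field, 'f re38) presym set"
  where "ann_null \<equiv> sym.span (ann_relations re38_act)"

definition ann_cong :: "('f::field, 'f re38) presym \<Rightarrow> ('f, 'f re38) presym \<Rightarrow> bool"
  where "ann_cong x y \<longleftrightarrow> x - y \<in> ann_null"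

lemma equivp_ann_cong: "equivp (ann_cong :: ('f::field, 'f re38) presym \<Rightarrow> _)"
proof (rule equivpI)
  show "reflp (ann_cong :: ('f, 'f re38) presym \<Rightarrow> _)"
    by (simp add: reflp_def ann_cong_def sym.span_zero)
  show "symp (ann_cong :: ('f, 'f re38) presym \<Rightarrow> _)"
  proof (rule sympI)
    fix x y :: "('f, 'f re38) presym"
    assume "ann_cong x y"
    then have "- (x - y) \<in> ann_null"
      unfolding ann_cong_def by (rule sym.span_neg)
    then show "ann_cong y x" by (simp add: ann_cong_def)
  qed
  show "transp (ann_cong :: ('f, 'f re38) presym \<Rightarrow> _)"
  proof (rule transpI)
    fix x y z :: "('f, 'f re38) presym"
    assume "ann_cong x y" "ann_cong y z"
    then have "(x - y) + (y - z) \<in> ann_null"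
      unfolding ann_cong_def by (rule sym.span_add)
    then show "ann_cong x z" by (simp add: ann_cong_def)
  qed
qed

quotient_type (overloaded) 'f ann = "('f::field, 'f re38) presym" / ann_cong
  by (rule equivp_ann_cong)

instantiation ann :: (field) ab_group_add
begin

lift_definition zero_ann :: "'a ann" is 0 .

lift_definition plus_ann :: "'a ann \<Rightarrow> 'a ann \<Rightarrow> 'a ann" is "(+)"
proof -
  fix x y z w :: "('a, 'a re38) presym"
  assume "ann_cong x y" "ann_cong z w"
  then have "(x - y) + (z - w) \<in> ann_null"
    unfolding ann_cong_def by (rule sym.span_add)
  then show "ann_cong (x + z) (y + w)"
    by (simp add: ann_cong_def algebra_simps)
qed

lift_definition uminus_ann :: "'a ann \<Rightarrow> 'a ann" is uminus
proof -
  fix x y :: "('a, 'a re38) presym"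
  assume "ann_cong x y"
  then have "- (x - y) \<in> ann_null"
    unfolding ann_cong_def by (rule sym.span_neg)
  then show "ann_cong (- x) (- y)"
    by (simp add: ann_cong_def algebra_simps)
qed

definition minus_ann :: "'a ann \<Rightarrow> 'a ann \<Rightarrow> 'a ann"
  where "minus_ann x y = x + (- y)"

instance
proof
  fix a b c :: "'a ann"
  show "a + b + c = a + (b + c)"
    by transfer (simp add: ann_cong_def add.assoc sym.span_zero)
  show "a + b = b + a"
    by transfer (simp add: ann_cong_def add.commute sym.span_zero)
  show "0 + a = a"
    by transfer (simp add: ann_cong_def sym.span_zero)
  show "- a + a = 0"
    by transfer (simp add: ann_cong_def sym.span_zero)
  show "a - b = a + - b"
    by (simp add: minus_ann_def)
qed

end

lift_definition ann_smult :: "'f::field \<Rightarrow> 'f ann \<Rightarrow> 'f ann" is sym_scale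
proof -
  fix c :: 'f and x y :: "('f, 'f re38) presym"
  assume "ann_cong x y"
  then have "sym_scale c (x - y) \<in> ann_null"
    unfolding ann_cong_def by (rule sym.span_scale)
  then show "ann_cong (sym_scale c x) (sym_scale c y)"
    by (simp add: ann_cong_def sym.scale_right_diff_distrib)
qed

lemma module_ann_smult: "module (ann_smult :: 'f::field \<Rightarrow> _)"
proof
  fix a b :: 'f and x y :: "'f ann"
  show "ann_smult a (x + y) = ann_smult a x + ann_smult a y"
    by transfer (simp add: ann_cong_def sym.scale_right_distrib sym.span_zero)
  show "ann_smult (a + b) x = ann_smult a x + ann_smult b x"
    by transfer (simp add: ann_cong_def sym.scale_left_distrib sym.span_zero)
  show "ann_smult a (ann_smult b x) = ann_smult (a * b) x"
    by transfer (simp add: ann_cong_def sym.span_zero)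
  show "ann_smult 1 x = x"
    by transfer (simp add: ann_cong_def sym.span_zero)
qed

global_interpretation ann: module "ann_smult :: 'f::field \<Rightarrow> _"
  by (rule module_ann_smult)

definition cls :: "('f::field, 'f re38) presym \<Rightarrow> 'f ann"
  where "cls = abs_ann"

lemma cls_eq_iff: "cls x = cls y \<longleftrightarrow> x - y \<in> ann_null"
  unfolding cls_def by (simp only: ann.abs_eq_iff ann_cong_def)

lemma cls_add: "cls (x + y) = cls x + cls y"
  unfolding cls_def by (rule plus_ann.abs_eq[symmetric])

lemma cls_scale: "cls (sym_scale c x) = ann_smult c (cls x)"
  unfolding cls_def by (rule ann_smult.abs_eq[symmetric])

global_interpretation cls: Modules.additive cls
  by unfold_locales (rule cls_add)

lemma cls_surj: "\<exists>x. u = cls x"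
  unfolding cls_def using Quotient_abs_rep[OF Quotient_ann] by metis

definition tens :: "'f re38 \<Rightarrow> 'f::field pser \<Rightarrow> 'f ann"
  where "tens a f = cls (tsym a f)"

lemma cls_relation: "x \<in> ann_relations re38_act \<Longrightarrow> cls x = 0"
  using cls_eq_iff[of x 0] by (simp add: cls.zero sym.span_base)

lemma tens_add_left: "tens (a + b) f = tens a f + tens b f"
proof -
  have "tsym (a + b) f - tsym a f - tsym b f \<in> ann_relations re38_act"
    unfolding ann_relations_def by blast
  from cls_relation[OF this] show ?thesis by (simp add: tens_def cls.diff cls.add algebra_simps)
qed

lemma tens_add_right: "tens a (\<lambda>M. f M + g M) = tens a f + tens a g"
proof -
  have "tsym a (\<lambda>M. f M + g M) - tsym a f - tsym a g \<in> ann_relations re38_act"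
    unfolding ann_relations_def by blast
  from cls_relation[OF this] show ?thesis by (simp add: tens_def cls.diff cls.add algebra_simps)
qed

lemma tens_scale_left: "tens (fscale re38_act c a) f = ann_smult c (tens a f)"
proof -
  have "tsym (fscale re38_act c a) f - sym_scale c (tsym a f) \<in> ann_relations re38_act"
    unfolding ann_relations_def by blast
  from cls_relation[OF this] show ?thesis by (simp add: tens_def cls.diff cls_scale)
qed

lemma tens_scale_right: "tens a (\<lambda>M. c * f M) = ann_smult c (tens a f)"
proof -
  have "tsym a (\<lambda>M. c * f M) - sym_scale c (tsym a f) \<in> ann_relations re38_act"
    unfolding ann_relations_def by blast
  from cls_relation[OF this] show ?thesis by (simp add: tens_def cls.diff cls_scale)
qed

lemma tens_pvar: "tens (re38_act (pvar i) a) f = - tens a (ps_deriv i f)"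
proof -
  have "tsym (re38_act (pvar i) a) f + tsym a (ps_deriv i f) \<in> ann_relations re38_act"
    unfolding ann_relations_def by blast
  from cls_relation[OF this] show ?thesis by (simp add: tens_def cls.add eq_neg_iff_add_eq_0)
qed

global_interpretation tens: Modules.additive "\<lambda>a. tens a f" for f
  by unfold_locales (rule tens_add_left)

lemma tens_0_right: "tens a (\<lambda>_. 0) = 0"
  using tens_scale_right[of a 0 "\<lambda>_. 0"] by simp

definition lext :: "('f::field \<Rightarrow> 'v::ab_group_add \<Rightarrow> 'v) \<Rightarrow> ('k \<Rightarrow> 'v) \<Rightarrow> ('k \<Rightarrow>\<^sub>0 'f) \<Rightarrow> 'v"
  where "lext sc h x = (\<Sum>k\<in>Poly_Mapping.keys x. sc (Poly_Mapping.lookup x k) (h k))"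

definition balanced :: "('f::field \<Rightarrow> 'v::ab_group_add \<Rightarrow> 'v) \<Rightarrow> ('f re38 \<times> 'f pser \<Rightarrow> 'v) \<Rightarrow> bool"
  where "balanced sc h \<longleftrightarrow>
    (\<forall>a b f. h (a + b, f) = h (a, f) + h (b, f)) \<and>
    (\<forall>a f g. h (a, \<lambda>M. f M + g M) = h (a, f) + h (a, g)) \<and>
    (\<forall>c a f. h (fscale re38_act c a, f) = sc c (h (a, f))) \<and>
    (\<forall>c a f. h (a, \<lambda>M. c * f M) = sc c (h (a, f))) \<and>
    (\<forall>i a f. h (re38_act (pvar i) a, f) = - h (a, ps_deriv i f))"

locale field_module = module scale for scale :: "'f::field \<Rightarrow> 'v::ab_group_add \<Rightarrow> 'v"
begin

lemma lext_superset:
  "finite A \<Longrightarrow> Poly_Mapping.keys x \<subseteq> A \<Longrightarrow> lext scale h x = (\<Sum>k\<in>A. scale (Poly_Mapping.lookup x k) (h k))"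
  unfolding lext_def by (intro sum.mono_neutral_left) (auto simp: in_keys_iff)

lemma lext_single: "lext scale h (Poly_Mapping.single k c) = scale c (h k)"
  by (subst lext_superset[of "{k}"]) auto

lemma lext_add: "lext scale h (x + y) = lext scale h x + lext scale h y"
proof -
  let ?A = "Poly_Mapping.keys x \<union> Poly_Mapping.keys y"
  show ?thesis
    using keys_add[of x y]
    by (simp add: lext_superset[of ?A] lookup_add scale_left_distrib sum.distrib)
qed

lemma additive_lext: "Modules.additive (lext scale h)"
  by (intro Modules.additive.intro lext_add)

sublocale lext: Modules.additive "lext scale h" for h
  by (rule additive_lext)

lemma lext_scale: "lext scale h (sym_scale c x) = scale c (lext scale h x)"
proof -
  have "Poly_Mapping.keys (sym_scale c x) \<subseteq> Poly_Mapping.keys x"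
    by (auto simp: in_keys_iff)
  then show ?thesis
    by (simp add: lext_superset[of "Poly_Mapping.keys x"] scale_sum_right)
qed

lemma lext_tsym: "lext scale h (tsym a f) = h (a, f)"
  by (simp add: tsym_def lext_single)

lemma lext_null:
  assumes "balanced scale h" "x \<in> ann_null"
  shows "lext scale h x = 0"
  using assms(2)
proof (induction rule: sym.span_induct_alt)
  case base
  show ?case by (rule lext.zero)
next
  case (step c x y)
  have "lext scale h x = 0"
    using step(1) assms(1) unfolding ann_relations_def balanced_def
    by (elim UnE CollectE exE conjE) (simp_all add: lext.diff lext.add lext_tsym lext_scale)
  then show ?case by (simp add: lext_add lext_scale step)
qed

lemma lext_cong: "balanced scale h \<Longrightarrow> cls x = cls y \<Longrightarrow> lext scale h x = lext scale h y"
  using lext_null[of h "x - y"] by (simp add: cls_eq_iff lext.diff)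

end

global_interpretation ann: field_module "ann_smult :: 'f::field \<Rightarrow> _"
  by (rule field_module.intro[OF module_ann_smult])

lemma cls_lext: "cls x = lext ann_smult (\<lambda>(a, f). tens a f) x"
proof -
  have "cls x = cls (\<Sum>k\<in>Poly_Mapping.keys x. Poly_Mapping.single k (Poly_Mapping.lookup x k))"
    by (simp flip: poly_mapping_sum_single)
  also have "\<dots> = (\<Sum>k\<in>Poly_Mapping.keys x. cls (sym_scale (Poly_Mapping.lookup x k) (Poly_Mapping.single k 1)))"
    unfolding cls.sum
    by (intro sum.cong arg_cong[of _ _ cls] poly_mapping_eqI) (auto simp: lookup_single when_def)
  finally show ?thesis
    by (simp add: lext_def cls_scale tens_def tsym_def case_prod_unfold)
qed

lemma ann_induct [case_names tens add]:
  assumes tens: "\<And>a f. P (tens a f)" and add: "\<And>u v. P u \<Longrightarrow> P v \<Longrightarrow> P (u + v)"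
  shows "P u"
proof -
  have "P 0" using tens[of 0] by (simp add: tens.zero)
  then have "P (sum h A)" if "\<And>k. P (h k)" for h and A :: "('a re38 \<times> 'a pser) set"
    by (induction A rule: infinite_finite_induct) (auto intro: add that)
  moreover have "P (ann_smult c (tens a f))" for c a f
    using tens by (simp flip: tens_scale_left)
  moreover obtain x where "u = cls x" using cls_surj by blast
  ultimately show ?thesis
    by (simp add: cls_lext lext_def case_prod_unfold)
qed

subsection \<open>The bracket\<close>

definition pair :: "(3, 'f::field re38) rpoly \<Rightarrow> 'f pser \<Rightarrow> 'f pser \<Rightarrow> 'f ann"
  where "pair x f g = (\<Sum>J\<in>Poly_Mapping.keys x. tens (Poly_Mapping.lookup x J) (ps_mult (ps_mderiv J f) g))"

lemma pair_superset:
  "finite A \<Longrightarrow> Poly_Mapping.keys x \<subseteq> A \<Longrightarrow>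
    pair x f g = (\<Sum>J\<in>A. tens (Poly_Mapping.lookup x J) (ps_mult (ps_mderiv J f) g))"
  unfolding pair_def by (intro sum.mono_neutral_left) (auto simp: in_keys_iff tens.zero)

lemma pair_single: "pair (Poly_Mapping.single J r) f g = tens r (ps_mult (ps_mderiv J f) g)"
  by (subst pair_superset[of "{J}"]) auto

lemma pair_add: "pair (x + y) f g = pair x f g + pair y f g"
proof -
  let ?A = "Poly_Mapping.keys x \<union> Poly_Mapping.keys y"
  show ?thesis
    using keys_add[of x y]
    by (simp add: pair_superset[of ?A] lookup_add tens_add_left sum.distrib)
qed

global_interpretation pair: Modules.additive "\<lambda>x. pair x f g" for f g
  by unfold_locales (rule pair_add)

lemma pair_add_left: "pair x (\<lambda>M. f M + f' M) g = pair x f g + pair x f' g"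
  by (simp add: pair_def ps_mderiv_add ps_mult_add_left tens_add_right sum.distrib)

lemma pair_add_right: "pair x f (\<lambda>M. g M + g' M) = pair x f g + pair x f g'"
  by (simp add: pair_def ps_mult_add_right tens_add_right sum.distrib)

lemma pair_scale_left: "pair x (\<lambda>M. c * f M) g = ann_smult c (pair x f g)"
  by (simp add: pair_def ps_mderiv_scale ps_mult_scale_left tens_scale_right ann.scale_sum_right)

lemma pair_scale_right: "pair x f (\<lambda>M. c * g M) = ann_smult c (pair x f g)"
  by (simp add: pair_def ps_mult_scale_right tens_scale_right ann.scale_sum_right)

lemma pact_pvar: "pact act (pvar i) x = (\<Sum>n\<in>Poly_Mapping.keys x.
    Poly_Mapping.single (n + Poly_Mapping.single i 1) (act 1 (Poly_Mapping.lookup x n)))"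
  by (simp add: pact_def pvar_def add.commute)

lemma pact_pconst:
  "act 0 = (\<lambda>_. 0) \<Longrightarrow> pact act (pconst p) x =
    (\<Sum>n\<in>Poly_Mapping.keys x. Poly_Mapping.single n (act p (Poly_Mapping.lookup x n)))"
  by (cases "p = 0") (simp_all add: pact_def pconst_def)

lemma pair_lam: "pair (pact re38_act (pvar i) x) f g = pair x (ps_deriv i f) g"
  unfolding pact_pvar pair.sum pair_single ps_mderiv_unit by (simp add: pair_def)

lemma pair_const: "pair (pact re38_act (pconst p) x) f g =
    (\<Sum>J\<in>Poly_Mapping.keys x. tens (re38_act p (Poly_Mapping.lookup x J)) (ps_mult (ps_mderiv J f) g))"
  by (simp add: pact_pconst[of re38_act] pair.sum pair_single fun_eq_iff)

lemma pair_num: "pair (pact re38_act (pconst (pconst c)) x) f g = ann_smult c (pair x f g)"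
  unfolding pair_const unfolding pair_def by (simp add: tens_scale_left ann.scale_sum_right)

lemma pair_del: "pair (pact re38_act (pconst (pvar i)) x) f g = - pair x (ps_deriv i f) g - pair x f (ps_deriv i g)"
  unfolding pair_const unfolding pair_def
  by (simp add: tens_pvar ps_deriv_mult tens_add_right ps_mderiv_deriv sum_subtractf sum_negf)

definition brk2 :: "'f::field_char_0 re38 \<times> 'f pser \<Rightarrow> 'f re38 \<times> 'f pser \<Rightarrow> 'f ann"
  where "brk2 k l = pair (rbr (fst k) (fst l)) (snd k) (snd l)"

lemma pact_add_left: "gev (pact re38_act (p + q) x) c = gev (pact re38_act p x + pact re38_act q x) c"
  by (simp add: numv.ev_pact gev.add ins_ins_generic distrib_right)

lemma pact_minus_left: "gev (pact re38_act (- p) x) c = gev (- pact re38_act p x) c"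
  by (simp add: numv.ev_pact gev.minus ins_ins_generic)

lemma balanced_brk2_left:
  fixes l :: "'f::field_char_0 re38 \<times> 'f pser"
  shows "balanced ann_smult (\<lambda>k. brk2 k l)"
proof -
  have sesqui: "rbr (re38_act (pvar i) a) b = - pact re38_act (pvar i) (rbr a b)" for i and a b :: "'f re38"
  proof -
    have "rbr (re38_act (pvar i) a) b = pact re38_act (- pvar i) (rbr a b)"
      using rbr_sesquilinear[where 'f = 'f] unfolding sesquilinear_def by blast
    also have "\<dots> = - pact re38_act (pvar i) (rbr a b)"
      by (rule gev_eqI) (rule pact_minus_left)
    finally show ?thesis .
  qed
  note bilinear = rbr_bilinear[where 'f = 'f, unfolded bilinear_bracket_def]
  show ?thesis
    unfolding balanced_def brk2_def fst_conv snd_conv using bilinear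
    by (simp add: pair_add pair_add_left pair_scale_left pair_num pair.minus pair_lam sesqui)
qed

lemma balanced_brk2_right:
  fixes k :: "'f::field_char_0 re38 \<times> 'f pser"
  shows "balanced ann_smult (\<lambda>l. brk2 k l)"
proof -
  have sesqui: "rbr a (re38_act (pvar i) b) = pact re38_act (pconst (pvar i)) (rbr a b) + pact re38_act (pvar i) (rbr a b)"
    for i and a b :: "'f re38"
  proof -
    have "rbr a (re38_act (pvar i) b) = pact re38_act (pconst (pvar i) + pvar i) (rbr a b)"
      using rbr_sesquilinear[where 'f = 'f] unfolding sesquilinear_def by blast
    also have "\<dots> = pact re38_act (pconst (pvar i)) (rbr a b) + pact re38_act (pvar i) (rbr a b)"
      by (rule gev_eqI) (rule pact_add_left)
    finally show ?thesis .
  qed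
  note bilinear = rbr_bilinear[where 'f = 'f, unfolded bilinear_bracket_def]
  show ?thesis
    unfolding balanced_def brk2_def fst_conv snd_conv using bilinear
    by (simp add: pair_add pair_add_right pair_scale_right pair_num pair_lam pair_del sesqui)
qed

context field_module
begin

lemma lext_fun_add: "lext scale (\<lambda>k. h k + h' k) x = lext scale h x + lext scale h' x"
  by (simp add: lext_def scale_right_distrib sum.distrib)

lemma lext_fun_scale: "lext scale (\<lambda>k. scale c (h k)) x = scale c (lext scale h x)"
  by (simp add: lext_def scale_sum_right scale_scale mult.commute)

lemma lext_fun_minus: "lext scale (\<lambda>k. - h k) x = - lext scale h x"
  by (simp add: lext_def sum_negf)

end

definition rep :: "'f::field ann \<Rightarrow> ('f, 'f re38) presym"
  where "rep u = (SOME x. cls x = u)"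

lemma cls_rep: "cls (rep u) = u"
  unfolding rep_def by (rule someI_ex) (metis cls_surj)

definition brk :: "'f::field_char_0 ann \<Rightarrow> 'f ann \<Rightarrow> 'f ann"
  where "brk u v = lext ann_smult (\<lambda>k. lext ann_smult (\<lambda>l. brk2 k l) (rep v)) (rep u)"

lemma balanced_lext_brk2:
  fixes y :: "('f::field_char_0, 'f re38) presym"
  shows "balanced ann_smult (\<lambda>k. lext ann_smult (\<lambda>l. brk2 k l) y)"
proof -
  have D: "brk2 (a + b, f) l = brk2 (a, f) l + brk2 (b, f) l"
    "brk2 (a, \<lambda>M. f M + g M) l = brk2 (a, f) l + brk2 (a, g) l"
    "brk2 (fscale re38_act c a, f) l = ann_smult c (brk2 (a, f) l)"
    "brk2 (a, \<lambda>M. c * f M) l = ann_smult c (brk2 (a, f) l)"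
    "brk2 (re38_act (pvar i) a, f) l = - brk2 (a, ps_deriv i f) l"
    for a b :: "'f re38" and f g c i l
    using balanced_brk2_left[of l] unfolding balanced_def by blast+
  show ?thesis
    unfolding balanced_def
    by (simp add: D[abs_def] ann.lext_fun_add ann.lext_fun_scale ann.lext_fun_minus)
qed

lemma brk_cls: "brk (cls x) (cls y) = lext ann_smult (\<lambda>k. lext ann_smult (\<lambda>l. brk2 k l) y) x"
proof -
  have "lext ann_smult (\<lambda>l. brk2 k l) (rep (cls y)) = lext ann_smult (\<lambda>l. brk2 k l) y" for k
    by (rule ann.lext_cong[OF balanced_brk2_right cls_rep])
  then show ?thesis
    unfolding brk_def by (simp only: ann.lext_cong[OF balanced_lext_brk2 cls_rep])
qed

lemma brk_add_left: "brk (u + u') v = brk u v + brk u' v"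
proof -
  obtain x x' y where "u = cls x" "u' = cls x'" "v = cls y" using cls_surj by metis
  then show ?thesis by (simp only: cls_add[symmetric] brk_cls ann.lext_add)
qed

lemma brk_add_right: "brk u (v + v') = brk u v + brk u v'"
proof -
  obtain x y y' where "u = cls x" "v = cls y" "v' = cls y'" using cls_surj by metis
  then show ?thesis by (simp only: cls_add[symmetric] brk_cls ann.lext_add ann.lext_fun_add)
qed

lemma brk_scale_left: "brk (ann_smult c u) v = ann_smult c (brk u v)"
proof -
  obtain x y where "u = cls x" "v = cls y" using cls_surj by metis
  then show ?thesis by (simp only: cls_scale[symmetric] brk_cls ann.lext_scale)
qed

lemma brk_scale_right: "brk u (ann_smult c v) = ann_smult c (brk u v)"
proof -
  obtain x y where "u = cls x" "v = cls y" using cls_surj by metis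
  then show ?thesis by (simp only: cls_scale[symmetric] brk_cls ann.lext_scale ann.lext_fun_scale)
qed

lemma brk_tens: "brk (tens a f) (tens b g) = pair (rbr a b) f g"
  by (simp only: tens_def brk_cls ann.lext_tsym brk2_def fst_conv snd_conv)

global_interpretation brk_left: Modules.additive "\<lambda>u. brk u v" for v
  by unfold_locales (rule brk_add_left)

global_interpretation brk_right: Modules.additive "\<lambda>v. brk u v" for u
  by unfold_locales (rule brk_add_right)

lemma mfact_neq_0: "mfact J \<noteq> (0 :: 'f::field_char_0)"
  by (simp add: mfact_def)

lemma cls_sym_bracket:
  fixes k :: "'f::field_char_0 re38 \<times> 'f pser"
  shows "cls (sym_bracket re38_act rbr k l) = brk2 k l"
proof -
  have "ann_smult (1 / mfact J) (tens (fscale re38_act (mfact J) r) f) = tens r f" for J f and r :: "'f re38"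
    by (simp add: tens_scale_left mfact_neq_0)
  then show ?thesis
    by (simp add: sym_bracket_def case_prod_unfold cls.sum cls_scale brk2_def pair_def nprod_def flip: tens_def)
qed

subsection \<open>Derivations along \<open>y\<close>\<close>

definition dsym :: "(3 \<Rightarrow> 'f::field) \<Rightarrow> 'f re38 \<times> 'f pser \<Rightarrow> 'f ann"
  where "dsym c k = (\<Sum>i\<in>UNIV. ann_smult (c i) (tens (fst k) (ps_deriv i (snd k))))"

definition der :: "(3 \<Rightarrow> 'f::field) \<Rightarrow> 'f ann \<Rightarrow> 'f ann"
  where "der c u = lext ann_smult (dsym c) (rep u)"

lemma balanced_dsym: "balanced ann_smult (dsym c)"
proof -
  have "ann_smult x (ann_smult y u) = ann_smult y (ann_smult x u)" for x y and u :: "'a ann"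
    by (simp add: ann.scale_scale mult.commute)
  then show ?thesis
    unfolding balanced_def dsym_def fst_conv snd_conv
    by (simp add: tens_add_left ann.scale_right_distrib sum.distrib ps_deriv_add tens_add_right
        tens_scale_left ps_deriv_scale tens_scale_right ann.scale_sum_right tens_pvar sum_negf ps_deriv_commute)
qed

lemma der_cls: "der c (cls x) = lext ann_smult (dsym c) x"
  unfolding der_def by (rule ann.lext_cong[OF balanced_dsym cls_rep])

lemma der_add: "der c (u + v) = der c u + der c v"
proof -
  obtain x y where "u = cls x" "v = cls y" using cls_surj by metis
  then show ?thesis by (simp only: cls_add[symmetric] der_cls ann.lext_add)
qed

lemma der_scale: "der c (ann_smult k u) = ann_smult k (der c u)"
proof -
  obtain x where "u = cls x" using cls_surj by metis
  then show ?thesis by (simp only: cls_scale[symmetric] der_cls ann.lext_scale)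
qed

lemma der_tens: "der c (tens a f) = (\<Sum>i\<in>UNIV. ann_smult (c i) (tens a (ps_deriv i f)))"
  by (simp only: tens_def[of a f] der_cls ann.lext_tsym dsym_def fst_conv snd_conv)

global_interpretation der: Modules.additive "der c" for c
  by unfold_locales (rule der_add)

lemma der_pair: "der c (pair x f g) = (\<Sum>i\<in>UNIV. ann_smult (c i) (pair x (ps_deriv i f) g + pair x f (ps_deriv i g)))"
proof -
  have "der c (pair x f g) = (\<Sum>J\<in>Poly_Mapping.keys x. \<Sum>i\<in>UNIV. ann_smult (c i)
      (tens (Poly_Mapping.lookup x J) (ps_mult (ps_mderiv J (ps_deriv i f)) g)
        + tens (Poly_Mapping.lookup x J) (ps_mult (ps_mderiv J f) (ps_deriv i g))))"
    unfolding pair_def der.sum der_tens ps_deriv_mult tens_add_right ps_mderiv_deriv ..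
  also have "\<dots> = (\<Sum>i\<in>UNIV. \<Sum>J\<in>Poly_Mapping.keys x. ann_smult (c i)
      (tens (Poly_Mapping.lookup x J) (ps_mult (ps_mderiv J (ps_deriv i f)) g)
        + tens (Poly_Mapping.lookup x J) (ps_mult (ps_mderiv J f) (ps_deriv i g))))"
    by (rule sum.swap)
  finally show ?thesis
    unfolding pair_def sum.distrib[symmetric] ann.scale_sum_right .
qed

lemma der_brk: "der c (brk u v) = brk (der c u) v + brk u (der c v)"
proof (induction u rule: ann_induct)
  case (tens a f)
  show ?case
  proof (induction v rule: ann_induct)
    case (tens b g)
    show ?case
      unfolding brk_tens der_tens der_pair brk_left.sum brk_right.sum brk_scale_left brk_scale_right
        ann.scale_right_distrib sum.distrib ..
  next
    case (add u v)
    then show ?case by (simp only: brk_add_right der_add add_ac)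
  qed
next
  case (add u v)
  then show ?case by (simp only: brk_add_left der_add add_ac)
qed

lemma cls_sym_deriv: "cls (\<Sum>i\<in>UNIV. sym_scale (c i) (sym_deriv i x)) = der c (cls x)"
proof -
  have "cls (sym_deriv i x) = (\<Sum>k\<in>Poly_Mapping.keys x. ann_smult (Poly_Mapping.lookup x k) (tens (fst k) (ps_deriv i (snd k))))" for i
    by (simp add: sym_deriv_def cls.sum case_prod_unfold cls_scale tens_def)
  then have "cls (\<Sum>i\<in>UNIV. sym_scale (c i) (sym_deriv i x)) = (\<Sum>i\<in>UNIV. \<Sum>k\<in>Poly_Mapping.keys x.
      ann_smult (c i * Poly_Mapping.lookup x k) (tens (fst k) (ps_deriv i (snd k))))"
    by (simp add: cls.sum cls_scale ann.scale_sum_right ann.scale_scale)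
  also have "\<dots> = (\<Sum>k\<in>Poly_Mapping.keys x. \<Sum>i\<in>UNIV.
      ann_smult (c i * Poly_Mapping.lookup x k) (tens (fst k) (ps_deriv i (snd k))))"
    by (rule sum.swap)
  also have "\<dots> = der c (cls x)"
    by (simp add: der_cls lext_def dsym_def ann.scale_sum_right ann.scale_scale mult.commute)
  finally show ?thesis .
qed

subsection \<open>The adjoint action in degree -2\<close>

lemma cbkt_a:
  fixes \<eta> :: "3 \<Rightarrow> 's::idom"
  assumes "\<And>i. Y (CB i) = crs \<eta> \<beta> i"
  shows "cbkt (\<lambda>_. 0) \<eta> (curl (\<lambda>_. 0) (gcoord (Ga j))) Y c = - 2 * (\<eta> j * Y c)"
proof -
  have "\<forall>c. cbkt (\<lambda>_. 0) \<eta> (curl (\<lambda>_. 0) (gcoord (Ga j))) Y c = - 2 * (\<eta> j * Y c)"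
    unfolding all_coord
    by (insert exhaust_3[of j]; elim disjE; hypsubst_thin; intro conjI;
      simp add: cbkt_def curl_simps bkt_defs cb_def gcoord_simps assms del: mult_cancel_left mult_cancel_right mult_eq_0_iff; algebra)
  then show ?thesis ..
qed

lemma ins_at_0:
  fixes f :: "'a::zero \<Rightarrow> 's::comm_ring_1" and x :: "('v::finite, 'a) rpoly"
  assumes f: "f 0 = 0"
  shows "ins f (\<lambda>_. 0) x = f (Poly_Mapping.lookup x 0)"
proof -
  have "mpower (\<lambda>_. 0) M = (if M = 0 then 1 else 0 :: 's)" for M :: "'v \<Rightarrow>\<^sub>0 nat"
  proof (cases "M = 0")
    case False
    then obtain i where "Poly_Mapping.lookup M i \<noteq> 0" by (metis lookup_zero poly_mapping_eqI)
    then have "(\<Prod>j\<in>UNIV. (0 :: 's) ^ Poly_Mapping.lookup M j) = 0"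
      by (intro prod_zero finite bexI[of _ i]) (auto simp: power_0_left)
    then show ?thesis using False by (simp only: mpower_def if_False)
  qed simp
  then have "ins f (\<lambda>_. 0) x = (\<Sum>M\<in>Poly_Mapping.keys x. if M = 0 then f (Poly_Mapping.lookup x 0) else 0)"
    unfolding ins_def by (intro sum.cong refl) simp
  then show ?thesis
    using f by (simp add: in_keys_iff)
qed

lemma rbr_a_0: "Poly_Mapping.lookup (rbr (gen (Ga j)) b) 0 = - re38_act (pvar j) (b :: 'f::field_char_0 re38)"
proof (rule coord_eqI)
  fix c
  interpret S: scalar_map "pconst :: 'f \<Rightarrow> 'f dpoly"
    by (rule scalar_map.intro[OF ring_map_pconst])
  obtain \<beta> where \<beta>: "\<And>i. coord b (CB i) = crs pvar \<beta> i"
    using coord_CB[of b] by blast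
  have "coord (Poly_Mapping.lookup (rbr (gen (Ga j)) b) 0) c = ev pconst pvar (\<lambda>_. 0) (rbr (gen (Ga j)) b) c"
    unfolding ev_def ins_pconst_pvar by (simp add: ins_at_0 coord.zero)
  also have "\<dots> = pconst (1/2) * cbkt (\<lambda>_. 0) pvar (curl (\<lambda>_. 0) (gcoord (Ga j))) (coord b) c"
    by (simp add: S.ev_rbr S.ins_coord_gen ins_pconst_pvar)
  also have "\<dots> = - ((pconst (1/2) + pconst (1/2)) * (pvar j * coord b c))"
    unfolding cbkt_a[of "coord b", OF \<beta>] by (simp add: algebra_simps)
  also have "pconst (1/2) + pconst (1/2) = (1 :: 'f dpoly)"
    by (simp add: pconst.map_one flip: pconst.map_add)
  finally show "coord (Poly_Mapping.lookup (rbr (gen (Ga j)) b) 0) c = coord (- re38_act (pvar j) b) c"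
    by (simp add: coord.minus coord_act)
qed

definition uvec :: "(3 \<Rightarrow> 'f::field) \<Rightarrow> 'f ann"
  where "uvec c = (\<Sum>j\<in>UNIV. ann_smult (c j) (tens (gen (Ga j)) (ps_monom 0)))"

lemma pair_const_left: "pair x (ps_monom 0) g = tens (Poly_Mapping.lookup x 0) g"
proof -
  have "tens (Poly_Mapping.lookup x J) (ps_mult (ps_mderiv J (ps_monom 0)) g) =
      (if J = 0 then tens (Poly_Mapping.lookup x 0) g else 0)" for J
    by (simp add: ps_mderiv_0 ps_mult_one ps_mderiv_const ps_mult_0 tens_0_right)
  then have "pair x (ps_monom 0) g = (\<Sum>J\<in>Poly_Mapping.keys x. if J = 0 then tens (Poly_Mapping.lookup x 0) g else 0)"
    unfolding pair_def by (intro sum.cong refl)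
  then show ?thesis
    by (simp add: in_keys_iff tens.zero)
qed

lemma brk_uvec: "brk (uvec c) v = der c v"
proof (induction v rule: ann_induct)
  case (tens b g)
  have "tens (- re38_act (pvar j) b) g = tens b (ps_deriv j g)" for j
    by (simp add: tens.minus tens_pvar)
  then show ?case
    by (simp add: uvec_def brk_left.sum brk_scale_left brk_tens pair_const_left rbr_a_0 der_tens)
next
  case (add u v)
  then show ?case by (simp only: brk_add_right der_add)
qed

subsection \<open>Degrees of the annihilation algebra\<close>

definition uspan :: "int \<Rightarrow> 'f::field ann set"
  where "uspan d = ann.span {tens (gen g) (ps_monom L) | g L. gen_degree g + 2 * int (msize L) = d}"

lemma msize_add: "msize (K + L) = msize K + msize L"
  by (simp add: msize_def lookup_add sum.distrib)

lemma msize_unit: "msize (unit_expo i) = 1"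
proof -
  have "msize (unit_expo i) = (\<Sum>j\<in>UNIV. if j = i then 1 else 0)"
    unfolding msize_def by (intro sum.cong) (auto simp: lookup_single)
  then show ?thesis by simp
qed

lemma msize_eq_0: "msize K = 0 \<longleftrightarrow> K = 0"
proof
  assume "msize K = 0"
  then show "K = 0"
    by (intro poly_mapping_eqI) (simp add: msize_def)
qed (simp add: msize_def)

lemma expo_induct [case_names zero add]:
  assumes "P 0" and step: "\<And>K i. P K \<Longrightarrow> P (K + unit_expo i)"
  shows "P (K :: expo)"
proof (induction "msize K" arbitrary: K)
  case 0
  then show ?case using assms(1) by (simp add: msize_eq_0)
next
  case (Suc n)
  then have "K \<noteq> 0" by (auto simp: msize_def)
  then obtain i where "Poly_Mapping.lookup K i \<noteq> 0" by (metis lookup_zero poly_mapping_eqI)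
  then obtain K' where K': "K = K' + unit_expo i" using unit_expo_decomp by blast
  with Suc have "P K'" by (simp only: msize_add msize_unit)
  then show ?case unfolding K' by (rule step)
qed

lemma tens_monom_uspan:
  shows "tens (re38_act (Poly_Mapping.single K 1) (gen g :: 'f::field re38)) (ps_monom M) \<in> uspan (gen_degree g - 2 * int (msize K) + 2 * int (msize M))"
proof (induction K arbitrary: M rule: expo_induct)
  case zero
  have "tens (gen g :: 'f re38) (ps_monom M) \<in> uspan (gen_degree g + 2 * int (msize M))"
    unfolding uspan_def by (rule ann.span_base) blast
  then show ?case
    by (simp add: msize_def)
next
  case (add K i)
  let ?x = "re38_act (Poly_Mapping.single K 1) (gen g :: 'f re38)"
  have "re38_act (Poly_Mapping.single (K + unit_expo i) 1) (gen g :: 'f re38) = re38_act (pvar i) ?x"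
    by (simp add: re38.scale_scale pvar_def mult_single add.commute)
  then have eq: "tens (re38_act (Poly_Mapping.single (K + unit_expo i) 1) (gen g :: 'f re38)) (ps_monom M) = - tens ?x (ps_deriv i (ps_monom M))"
    by (simp only: tens_pvar)
  show ?case
  proof (cases "Poly_Mapping.lookup M i = 0")
    case True
    then show ?thesis
      unfolding eq by (simp add: ps_deriv_monom tens_0_right uspan_def ann.span_zero)
  next
    case False
    then obtain M' where M': "M = M' + unit_expo i" using unit_expo_decomp by blast
    have minus: "M - unit_expo i = M'"
      unfolding M' by (rule add_diff_cancel_right')
    have "tens ?x (ps_deriv i (ps_monom M)) = ann_smult (of_nat (Poly_Mapping.lookup M i)) (tens ?x (ps_monom M'))"
      using False by (simp only: ps_deriv_monom minus if_False tens_scale_right)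
    moreover have "gen_degree g - 2 * int (msize (K + unit_expo i)) + 2 * int (msize M) = gen_degree g - 2 * int (msize K) + 2 * int (msize M')"
      unfolding M' msize_add msize_unit by simp
    ultimately show ?thesis
      unfolding eq using add[of M'] unfolding uspan_def by (simp only: ann.span_neg ann.span_scale)
  qed
qed

lemma tens_degree_uspan:
  "a \<in> re38_degree n \<Longrightarrow> tens a (ps_monom M) \<in> uspan (n + 2 * int (msize M))"
  unfolding re38_degree_def
proof (induction rule: fre38.span_induct_alt)
  case base
  show ?case by (simp add: tens.zero uspan_def ann.span_zero)
next
  case (step c x y)
  then obtain K g where x: "x = re38_act (Poly_Mapping.single K 1) (gen g)" "gen_degree g - 2 * int (msize K) = n"
    by blast
  have "ann_smult c (tens x (ps_monom M)) \<in> uspan (n + 2 * int (msize M))"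
    using tens_monom_uspan[of K g M] unfolding x uspan_def by (rule ann.span_scale)
  with step show ?case
    unfolding tens_add_left tens_scale_left uspan_def by (intro ann.span_add)
qed

abbreviation degree_syms :: "int \<Rightarrow> ('f::field, 'f re38) presym set"
  where "degree_syms d \<equiv> {tsym a (ps_monom M) | a M n. a \<in> re38_degree n \<and> n + 2 * int (msize M) = d}"

lemma cls_degree_uspan: "x \<in> sym.span (degree_syms d) \<Longrightarrow> cls x \<in> uspan d"
proof (induction rule: sym.span_induct_alt)
  case base
  show ?case by (simp add: cls.zero uspan_def ann.span_zero)
next
  case (step c x y)
  then obtain a M n where x: "x = tsym a (ps_monom M)" "a \<in> re38_degree n" "n + 2 * int (msize M) = d"
    by blast
  have "ann_smult c (cls x) \<in> uspan d"
    using tens_degree_uspan[OF x(2), of M] unfolding x(1,3) tens_def uspan_def by (rule ann.span_scale)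
  with step show ?case
    unfolding cls_add cls_scale uspan_def by (intro ann.span_add)
qed

lemma uspan_low: "d < -3 \<Longrightarrow> uspan d = {0}"
proof -
  assume d: "d < -3"
  have "gen_degree g \<ge> -3" for g by (cases g) simp_all
  then have "gen_degree g + 2 * int (msize L) \<noteq> d" for g L
    using d by (smt (verit) of_nat_0_le_iff)
  then have "{tens (gen g) (ps_monom L) | g L. gen_degree g + 2 * int (msize L) = d} = {}" by blast
  then show ?thesis unfolding uspan_def by simp
qed

lemma uvec_add: "uvec (\<lambda>j. c j + c' j) = uvec c + uvec c'"
  by (simp add: uvec_def ann.scale_left_distrib sum.distrib)

lemma uvec_scale: "uvec (\<lambda>j. k * c j) = ann_smult k (uvec c)"
  by (simp add: uvec_def ann.scale_sum_right ann.scale_scale)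

lemma uspan_m2: "uspan (-2) \<subseteq> range uvec"
  unfolding uspan_def
proof (rule ann.span_minimal)
  show "ann.subspace (range uvec)"
  proof (rule ann.subspaceI)
    have "uvec (\<lambda>_. 0) = 0" by (simp add: uvec_def)
    then show "0 \<in> range uvec" by (metis rangeI)
  qed (auto simp flip: uvec_add uvec_scale)
  have "tens (gen (Ga j)) (ps_monom 0) = uvec (\<lambda>i. of_bool (i = j))" for j
    using exhaust_3[of j] by (auto simp: uvec_def sum_3)
  moreover have "\<exists>j. g = Ga j \<and> L = 0" if "gen_degree g + 2 * int (msize L) = -2" for g L
    using that msize_eq_0[of L] by (cases g) (simp_all, presburger+)
  ultimately show "{tens (gen g) (ps_monom L) | g L. gen_degree g + 2 * int (msize L) = -2} \<subseteq> range uvec"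
    by blast
qed

subsection \<open>A functional on the annihilation algebra\<close>

definition wfun :: "3 \<Rightarrow> 'f::field_char_0 pser \<Rightarrow> expo \<Rightarrow> 'f"
  where "wfun j f K = (- 1) ^ msize K * mfact K * f K"

lemma mfact_unit: "mfact (K + unit_expo i) = (mfact K * of_nat (Poly_Mapping.lookup K i + 1) :: 'f::field_char_0)"
proof -
  have "fact (Poly_Mapping.lookup (K + unit_expo i) j) =
      fact (Poly_Mapping.lookup K j) * (if j = i then of_nat (Poly_Mapping.lookup K i + 1) else 1 :: 'f)" for j
    by (cases "j = i") (simp_all add: lookup_add lookup_single)
  then have "mfact (K + unit_expo i) =
      (\<Prod>j\<in>UNIV. fact (Poly_Mapping.lookup K j) * (if j = i then of_nat (Poly_Mapping.lookup K i + 1) else 1 :: 'f))"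
    unfolding mfact_def by (intro prod.cong refl)
  also have "\<dots> = mfact K * of_nat (Poly_Mapping.lookup K i + 1)"
    unfolding prod.distrib mfact_def by (simp only: prod.delta finite UNIV_I if_True)
  finally show ?thesis .
qed

lemma wfun_unit: "wfun j f (K + unit_expo i) = - wfun j (ps_deriv i f) K"
  unfolding wfun_def msize_add msize_unit mfact_unit ps_deriv_def power_add power_one_right
  by (simp only: mult_minus_right mult_minus_left mult_1_right mult.assoc)

global_interpretation fld: field_module "(*) :: 'f::field \<Rightarrow> _"
  by (intro field_module.intro) (unfold_locales, simp_all add: algebra_simps)

lemma lext_pvar: "lext (*) h (pvar i * p) = lext (*) (\<lambda>K. h (K + unit_expo i)) p"
  for p :: "'f::field dpoly"
  unfolding mult_eq_pact pact_pvar fld.lext.sum fld.lext_single by (simp add: lext_def)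

lemma lext_pconst: "lext (*) h (pconst c * p) = c * lext (*) h p"
  for p :: "'f::field dpoly"
proof -
  have "(*) (0 :: 'f) = (\<lambda>_. 0)" by auto
  then show ?thesis
    unfolding mult_eq_pact by (simp add: pact_pconst fld.lext.sum fld.lext_single) (simp add: lext_def sum_distrib_left mult.assoc)
qed

definition afun :: "'f::field_char_0 re38 \<times> 'f pser \<Rightarrow> 'f"
  where "afun k = lext (*) (wfun 1 (snd k)) (coord (fst k) (CA 1))"

lemma balanced_afun: "balanced (*) (afun :: 'f::field_char_0 re38 \<times> 'f pser \<Rightarrow> 'f)"
proof -
  have add: "wfun j (\<lambda>M. f M + g M) = (\<lambda>K. wfun j f K + wfun j g K)" for j and f g :: "'f pser"
    by (rule ext) (simp add: wfun_def distrib_left)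
  have scale: "wfun j (\<lambda>M. c * f M) = (\<lambda>K. c * wfun j f K)" for j c and f :: "'f pser"
    by (rule ext) (simp add: wfun_def)
  show ?thesis
    unfolding balanced_def afun_def fst_conv snd_conv add scale coord_add coord_act lext_pvar lext_pconst wfun_unit
    by (simp add: fld.lext_add fld.lext_fun_add fld.lext_fun_scale fld.lext_fun_minus)
qed

lemma afun_a: "afun (gen (Ga 1), ps_monom 0) = (1 :: 'f::field_char_0)"
proof -
  have "coord (gen (Ga 1)) (CA 1) = (Poly_Mapping.single 0 1 :: 'f dpoly)"
    by (simp add: coord_gen_gcoord curl_simps gcoord_simps)
  then show ?thesis
    by (simp add: afun_def fld.lext_single wfun_def msize_def mfact_def ps_monom_def del: single_one)
qed

lemma der_inj:
  assumes "der c = der (c' :: 3 \<Rightarrow> 'f::field_char_0)"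
  shows "c = c'"
proof
  fix j
  let ?f = "ps_monom (unit_expo j) :: 'f pser" and ?a = "gen (Ga 1) :: 'f re38"
  have deriv: "tens ?a (ps_deriv i ?f) = (if i = j then tens ?a (ps_monom 0) else 0)" for i
    by (simp add: ps_deriv_monom lookup_single tens_0_right tens_scale_right when_def)
  have der_f: "der c (tens ?a ?f) = cls (sym_scale (c j) (tsym ?a (ps_monom 0)))" for c :: "3 \<Rightarrow> 'f"
  proof -
    have "der c (tens ?a ?f) = (\<Sum>i\<in>UNIV. if i = j then ann_smult (c j) (tens ?a (ps_monom 0)) else 0)"
      unfolding der_tens deriv by (intro sum.cong) auto
    then show ?thesis by (simp add: cls_scale tens_def)
  qed
  have "lext (*) afun (sym_scale (c j) (tsym ?a (ps_monom 0))) = lext (*) afun (sym_scale (c' j) (tsym ?a (ps_monom 0)))"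
    by (rule fld.lext_cong[OF balanced_afun]) (simp only: der_f[symmetric] assms)
  then show "c j = c' j"
    by (simp add: fld.lext_scale fld.lext_tsym afun_a)
qed

section \<open>The annihilation algebra on classes\<close>

definition cl :: "'f::field ann \<Rightarrow> ('f, 'f re38) presym set"
  where "cl u = {y. cls y = u}"

lemma mem_cl: "y \<in> cl u \<longleftrightarrow> cls y = u"
  by (simp add: cl_def)

lemma ann_class_cl: "ann_class re38_act x = cl (cls x)"
  by (simp add: ann_class_def cl_def cls_eq_iff)

lemma ann_class_image: "ann_class re38_act ` S = cl ` cls ` S"
  by (simp add: image_image ann_class_cl)

lemma cl_nonempty: "cl u \<noteq> {}"
proof -
  obtain x where x: "u = cls x" using cls_surj by blast
  have "x \<in> cl u" by (simp add: mem_cl x)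
  then show ?thesis by blast
qed

lemma cl_inject: "cl u = cl v \<longleftrightarrow> u = v"
proof
  assume eq: "cl u = cl v"
  obtain x where "x \<in> cl u" using cl_nonempty[of u] by blast
  moreover from this have "x \<in> cl v" by (simp only: eq)
  ultimately show "u = v" by (simp add: mem_cl)
qed simp

lemma ann_carrier_cl: "ann_carrier re38_act = range (cl :: 'f::field ann \<Rightarrow> _)"
proof -
  have "range (cls :: ('f, 'f re38) presym \<Rightarrow> _) = UNIV"
    unfolding surj_def by (intro allI) (rule cls_surj)
  then show ?thesis
    by (simp only: ann_carrier_def ann_class_image)
qed

lemma cl_carrier: "cl u \<in> ann_carrier re38_act"
  by (simp add: ann_carrier_cl)

lemma ann_carrierE:
  assumes "X \<in> ann_carrier re38_act"
  obtains u where "X = cl u"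
  using assms unfolding ann_carrier_cl by blast

lemma ann_map_cl:
  assumes "\<And>x. cls (\<phi> x) = \<Phi> (cls x)"
  shows "ann_map re38_act \<phi> (cl u) = cl (\<Phi> u)"
proof -
  have "ann_map re38_act \<phi> (cl u) = (\<Union>x\<in>cl u. cl (\<Phi> u))"
    unfolding ann_map_def by (intro SUP_cong refl) (simp add: ann_class_cl assms mem_cl)
  then show ?thesis using cl_nonempty[of u] by simp
qed

lemma ann_map2_cl:
  assumes "\<And>x y. cls (\<phi> x y) = \<Phi> (cls x) (cls y)"
  shows "ann_map2 re38_act \<phi> (cl u) (cl v) = cl (\<Phi> u v)"
proof -
  have "ann_map2 re38_act \<phi> (cl u) (cl v) = (\<Union>x\<in>cl u. \<Union>y\<in>cl v. cl (\<Phi> u v))"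
    unfolding ann_map2_def by (intro SUP_cong refl) (simp add: ann_class_cl assms mem_cl)
  then show ?thesis using cl_nonempty[of u] cl_nonempty[of v] by simp
qed

lemma ann_add_cl: "ann_add re38_act (cl u) (cl v) = cl (u + v)"
  unfolding ann_add_def by (rule ann_map2_cl[where \<Phi> = "(+)"]) (rule cls_add)

lemma ann_scale_cl: "ann_scale re38_act c (cl u) = cl (ann_smult c u)"
  unfolding ann_scale_def by (rule ann_map_cl[where \<Phi> = "ann_smult c"]) (rule cls_scale)

lemma ann_bracket_cl: "ann_bracket re38_act rbr (cl u) (cl v) = cl (brk u v)"
  unfolding ann_bracket_def
  by (rule ann_map2_cl[where \<Phi> = brk])
    (simp add: brk_cls lext_def cls.sum cls_scale cls_sym_bracket ann.scale_sum_right)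

lemma ann_deriv_cl:
  "ann_map re38_act (\<lambda>x. \<Sum>i\<in>UNIV. sym_scale (c i) (sym_deriv i x)) (cl u) = cl (der c u)"
  by (rule ann_map_cl[where \<Phi> = "der c"]) (rule cls_sym_deriv)

definition ann_par :: "bit \<Rightarrow> 'f::field ann set"
  where "ann_par q = cls ` sym.span {tsym a f | a f. a \<in> re38_parity q}"

lemma ann_parity_cl: "ann_parity re38_act re38_parity q = cl ` ann_par q"
  by (simp only: ann_parity_def ann_par_def ann_class_image)

lemma ann_par_subspace: "ann.subspace (ann_par q :: 'f::field ann set)"
proof (rule ann.subspaceI)
  show "0 \<in> (ann_par q :: 'f ann set)"
    unfolding ann_par_def by (rule image_eqI[where x = 0]) (rule cls.zero[symmetric], rule sym.span_zero)
next
  fix u v :: "'f ann"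
  assume "u \<in> ann_par q" "v \<in> ann_par q"
  then obtain x y where x: "u = cls x" "x \<in> sym.span {tsym a f | a f. a \<in> re38_parity q}"
    and y: "v = cls y" "y \<in> sym.span {tsym a f | a f. a \<in> re38_parity q}"
    unfolding ann_par_def by (elim imageE)
  from imageI[OF sym.span_add[OF x(2) y(2)], of cls] show "u + v \<in> ann_par q"
    by (simp only: x(1) y(1) ann_par_def cls_add)
next
  fix k and u :: "'f ann"
  assume "u \<in> ann_par q"
  then obtain x where x: "u = cls x" "x \<in> sym.span {tsym a f | a f. a \<in> re38_parity q}"
    unfolding ann_par_def by (elim imageE)
  from imageI[OF sym.span_scale[OF x(2)], of cls k] show "ann_smult k u \<in> ann_par q"
    by (simp only: x(1) ann_par_def cls_scale)
qed

lemma der_ann_par: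
  assumes "u \<in> ann_par q"
  shows "der c u \<in> ann_par q"
proof -
  have der_cls_par: "der c (cls x) \<in> ann_par q" if "x \<in> sym.span {tsym a f | a f. a \<in> re38_parity q}" for x
    using that
  proof (induction rule: sym.span_induct_alt)
    case base
    show ?case by (simp add: cls.zero der.zero ann.subspace_0[OF ann_par_subspace])
  next
    case (step k x y)
    then obtain a f where x: "x = tsym a f" "a \<in> re38_parity q" by blast
    have "tens a g \<in> ann_par q" for g
      unfolding ann_par_def tens_def using x(2) by (intro imageI sym.span_base) blast
    then have "der c (cls x) \<in> ann_par q"
      unfolding x(1) tens_def[symmetric] der_tens
      by (intro ann.subspace_sum[OF ann_par_subspace] ann.subspace_scale[OF ann_par_subspace])
    with step show ?case
      unfolding cls_add cls_scale der_add der_scale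
      by (intro ann.subspace_add[OF ann_par_subspace] ann.subspace_scale[OF ann_par_subspace])
  qed
  obtain x where x: "u = cls x" "x \<in> sym.span {tsym a f | a f. a \<in> re38_parity q}"
    using assms unfolding ann_par_def by (elim imageE)
  from der_cls_par[OF x(2)] show ?thesis by (simp only: x(1))
qed

lemma ann_superderivationsI:
  fixes D :: "'f::field_char_0 ann \<Rightarrow> 'f ann"
  assumes D_add: "\<And>u v. D (u + v) = D u + D v"
    and D_scale: "\<And>k u. D (ann_smult k u) = ann_smult k (D u)"
    and D_par: "\<And>q u. u \<in> ann_par q \<Longrightarrow> D u \<in> ann_par (p + q)"
    and D_brk: "\<And>q u v. D (brk u v) = brk (D u) v + ann_smult (koszul p q 1) (brk u (D v))"
    and \<phi>: "\<And>u. \<phi> (cl u) = cl (D u)"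
    and ext: "\<phi> \<in> extensional (ann_carrier re38_act)"
  shows "\<phi> \<in> ann_superderivations re38_act re38_parity rbr p"
  unfolding ann_superderivations_def
proof (intro CollectI conjI allI ballI)
  have "\<phi> X \<in> ann_carrier re38_act" if X: "X \<in> ann_carrier re38_act" for X
    using X by (elim ann_carrierE) (simp add: \<phi> cl_carrier)
  then show "\<phi> \<in> ann_carrier re38_act \<rightarrow>\<^sub>E ann_carrier re38_act"
    using ext by (simp add: PiE_def)
next
  fix X Y :: "('f, 'f re38) presym set"
  assume "X \<in> ann_carrier re38_act" "Y \<in> ann_carrier re38_act"
  then obtain u v where "X = cl u" "Y = cl v" by (elim ann_carrierE) blast
  then show "\<phi> (ann_add re38_act X Y) = ann_add re38_act (\<phi> X) (\<phi> Y)"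
    by (simp add: ann_add_cl \<phi> D_add)
next
  fix c and X :: "('f, 'f re38) presym set"
  assume "X \<in> ann_carrier re38_act"
  then obtain u where "X = cl u" by (elim ann_carrierE) blast
  then show "\<phi> (ann_scale re38_act c X) = ann_scale re38_act c (\<phi> X)"
    by (simp add: ann_scale_cl \<phi> D_scale)
next
  fix q and X :: "('f, 'f re38) presym set"
  assume "X \<in> ann_parity re38_act re38_parity q"
  then obtain u where "X = cl u" "u \<in> ann_par q" unfolding ann_parity_cl by blast
  then show "\<phi> X \<in> ann_parity re38_act re38_parity (p + q)"
    using D_par unfolding ann_parity_cl by (simp add: \<phi>)
next
  fix q and X Y :: "('f, 'f re38) presym set"
  assume "X \<in> ann_parity re38_act re38_parity q" "Y \<in> ann_carrier re38_act"
  then obtain u v where "X = cl u" "Y = cl v"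
    unfolding ann_parity_cl by (elim ann_carrierE imageE) blast
  then show "\<phi> (ann_bracket re38_act rbr X Y) = ann_add re38_act (ann_bracket re38_act rbr (\<phi> X) Y)
      (ann_scale re38_act (koszul p q 1) (ann_bracket re38_act rbr X (\<phi> Y)))"
    by (simp only: ann_bracket_cl ann_scale_cl ann_add_cl \<phi> D_brk[of u v q])
qed

definition dmap :: "(3 \<Rightarrow> 'f::field) \<Rightarrow> ('f, 'f re38) presym set \<Rightarrow> ('f, 'f re38) presym set"
  where "dmap c = (\<lambda>X\<in>ann_carrier re38_act.
    ann_map re38_act (\<lambda>x. \<Sum>i\<in>UNIV. sym_scale (c i) (sym_deriv i x)) X)"

lemma dmap_cl: "dmap c (cl u) = cl (der c u)"
  by (simp add: dmap_def cl_carrier ann_deriv_cl)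

lemma dmap_superderivation:
  "dmap c \<in> ann_superderivations re38_act re38_parity (rbr :: 'f::field_char_0 re38 lbracket) 0"
proof (rule ann_superderivationsI[where D = "der c"])
  have k: "koszul 0 q (1 :: 'f) = 1" for q
    by (simp add: koszul_def)
  show "der c (brk u v) = brk (der c u) v + ann_smult (koszul 0 q 1) (brk u (der c v))" for q u v
    by (simp only: der_brk k ann.scale_one)
  show "der c u \<in> ann_par (0 + q)" if "u \<in> ann_par q" for q u
    using der_ann_par[OF that] by (simp only: add_0_left)
  show "dmap c \<in> extensional (ann_carrier re38_act)"
    unfolding dmap_def by (rule restrict_extensional)
qed (rule der_add der_scale dmap_cl)+

lemma zero_superderivation:
  "(\<lambda>X\<in>ann_carrier re38_act. cl 0) \<in> ann_superderivations re38_act re38_parity (rbr :: 'f::field_char_0 re38 lbracket) p"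
  by (rule ann_superderivationsI[where D = "\<lambda>_. 0"])
    (simp_all add: brk_left.zero brk_right.zero ann.subspace_0[OF ann_par_subspace] cl_carrier)

lemma dmap_ann_der: "dmap c \<in> ann_der re38_act re38_parity (rbr :: 'f::field_char_0 re38 lbracket)"
proof -
  let ?\<psi> = "\<lambda>X\<in>ann_carrier (re38_act :: 'f dpoly \<Rightarrow> _). cl 0"
  have "dmap c X = (\<lambda>X\<in>ann_carrier re38_act. ann_add re38_act (dmap c X) (?\<psi> X)) X" for X
  proof (cases "X \<in> ann_carrier (re38_act :: 'f dpoly \<Rightarrow> _)")
    case True
    then obtain u where "X = cl u" by (rule ann_carrierE)
    then show ?thesis by (simp add: cl_carrier dmap_cl ann_add_cl)
  qed (simp add: dmap_def)
  then have eq: "dmap c = (\<lambda>X\<in>ann_carrier re38_act. ann_add re38_act (dmap c X) (?\<psi> X))"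
    by (rule ext)
  show ?thesis
    unfolding ann_der_def
    by (intro CollectI exI conjI) (rule eq, rule dmap_superderivation, rule zero_superderivation)
qed

lemma dmap_inj:
  assumes "dmap c = dmap (c' :: 3 \<Rightarrow> 'f::field_char_0)"
  shows "c = c'"
proof (rule der_inj, rule ext)
  fix u
  have "dmap c (cl u) = dmap c' (cl u)" by (simp only: assms)
  then show "der c u = der c' u" by (simp only: dmap_cl cl_inject)
qed

lemma ann_D_dmap: "ann_D re38_act = range (dmap :: (3 \<Rightarrow> 'f::field) \<Rightarrow> _)"
proof -
  have "ann_D re38_act = {dmap c | c :: 3 \<Rightarrow> 'f. True}"
    by (simp only: ann_D_def dmap_def)
  then show ?thesis by auto
qed

lemma ann_ad_uvec: "ann_ad re38_act rbr (cl (uvec c)) = dmap c"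
  unfolding ann_ad_def dmap_def
proof (rule restrict_ext)
  fix X :: "('a, 'a re38) presym set"
  assume "X \<in> ann_carrier re38_act"
  then obtain v where "X = cl v" by (rule ann_carrierE)
  then show "ann_bracket re38_act rbr (cl (uvec c)) X =
      ann_map re38_act (\<lambda>x. \<Sum>i\<in>UNIV. sym_scale (c i) (sym_deriv i x)) X"
    by (simp only: ann_bracket_cl brk_uvec ann_deriv_cl)
qed

section \<open>The conditions on the gradation\<close>

lemma ann_degree_cl: "ann_degree re38_act re38_degree d = cl ` cls ` sym.span (degree_syms d)"
  by (simp only: ann_degree_def ann_class_image)

lemma gen_a_degree: "gen (Ga j) \<in> re38_degree (- 2)"
  using re38_degree_monom[of 0 1 "Ga j"] by (simp add: msize_def)

lemma ann_degree_m2: "ann_degree re38_act re38_degree (- 2) = range (\<lambda>c :: 3 \<Rightarrow> 'f::field. cl (uvec c))"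
proof
  have "cls ` sym.span (degree_syms (- 2)) \<subseteq> range (uvec :: (3 \<Rightarrow> 'f) \<Rightarrow> _)"
    by (rule image_subsetI) (rule subsetD[OF uspan_m2 cls_degree_uspan])
  from image_mono[OF this, of cl]
  show "ann_degree re38_act re38_degree (- 2) \<subseteq> range (\<lambda>c :: 3 \<Rightarrow> 'f. cl (uvec c))"
    unfolding ann_degree_cl by (simp only: image_image)
  have "uvec c \<in> cls ` sym.span (degree_syms (- 2))" for c :: "3 \<Rightarrow> 'f"
  proof -
    have "tsym (gen (Ga j)) (ps_monom 0) \<in> (degree_syms (- 2) :: ('f, 'f re38) presym set)" for j
      by (intro CollectI exI conjI) (rule refl, rule gen_a_degree, simp add: msize_def)
    then have "(\<Sum>j\<in>UNIV. sym_scale (c j) (tsym (gen (Ga j)) (ps_monom 0))) \<in> sym.span (degree_syms (- 2))"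
      by (intro sym.span_sum sym.span_scale sym.span_base)
    moreover have "uvec c = cls (\<Sum>j\<in>UNIV. sym_scale (c j) (tsym (gen (Ga j)) (ps_monom 0)))"
      by (simp add: uvec_def cls.sum cls_scale tens_def)
    ultimately show ?thesis by (rule rev_image_eqI)
  qed
  then have "range (uvec :: (3 \<Rightarrow> 'f) \<Rightarrow> _) \<subseteq> cls ` sym.span (degree_syms (- 2))"
    by (rule image_subsetI)
  from image_mono[OF this, of cl]
  show "range (\<lambda>c :: 3 \<Rightarrow> 'f. cl (uvec c)) \<subseteq> ann_degree re38_act re38_degree (- 2)"
    unfolding ann_degree_cl by (simp only: image_image)
qed

lemma re38_depth: "depth_at_most_3 (re38_act :: 'f::field dpoly \<Rightarrow> _) re38_degree"
  unfolding depth_at_most_3_def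
proof (intro allI impI)
  fix d :: int
  assume d: "d < - 3"
  have "cls ` sym.span (degree_syms d) \<subseteq> {0 :: 'f ann}"
  proof (rule image_subsetI)
    fix x :: "('f, 'f re38) presym"
    assume "x \<in> sym.span (degree_syms d)"
    from cls_degree_uspan[OF this] show "cls x \<in> {0}" by (simp only: uspan_low[OF d])
  qed
  moreover have "0 \<in> cls ` sym.span (degree_syms d :: ('f, 'f re38) presym set)"
    by (rule image_eqI[where x = 0]) (rule cls.zero[symmetric], rule sym.span_zero)
  ultimately have "cls ` sym.span (degree_syms d) = {0 :: 'f ann}"
    by blast
  then show "ann_degree re38_act re38_degree d = {ann_class (re38_act :: 'f dpoly \<Rightarrow> _) 0}"
    by (simp only: ann_degree_cl ann_class_cl cls.zero image_insert image_empty)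
qed

lemma re38_degree_odd:
  assumes "odd n"
  shows "re38_degree n \<subseteq> (re38_parity 1 :: 'f::field re38 set)"
  unfolding re38_degree_def
proof (rule fre38.span_minimal)
  have parity: "gen_parity g = 1" if "odd (gen_degree g)" for g
    using that by (cases g) simp_all
  have "re38_act (Poly_Mapping.single M 1) (gen g) \<in> (re38_parity 1 :: 'f re38 set)"
    if "gen_degree g - 2 * int (msize M) = n" for M g
  proof -
    have "odd (gen_degree g)" using that assms by presburger
    then have "gen g \<in> {gen g :: 'f re38 | g. gen_parity g = 1}" using parity[of g] by blast
    then show ?thesis unfolding re38_parity_def by (intro re38.span_scale re38.span_base)
  qed
  then show "{re38_act (Poly_Mapping.single M 1) (gen g) | M g. gen_degree g - 2 * int (msize M) = n} \<subseteq> (re38_parity 1 :: 'f re38 set)"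
    by blast
  show "fre38.subspace (re38_parity 1 :: 'f re38 set)"
    by (intro fre38.subspaceI re38.subspace_0[OF re38_parity_subspace]
        re38.subspace_add[OF re38_parity_subspace] re38.subspace_scale[OF re38_parity_subspace])
qed

lemma re38_ann_degree_odd:
  assumes "odd d"
  shows "ann_degree re38_act re38_degree d \<subseteq> ann_parity (re38_act :: 'f::field dpoly \<Rightarrow> _) re38_parity 1"
proof -
  have odd_parity: "a \<in> re38_parity 1" if "a \<in> re38_degree n" "n + 2 * int (msize M) = d" for a :: "'f re38" and n M
  proof -
    have "odd n" using that(2) assms by presburger
    from subsetD[OF re38_degree_odd[OF this] that(1)] show ?thesis .
  qed
  have "degree_syms d \<subseteq> {tsym a f | a (f :: 'f pser). a \<in> re38_parity 1}"
  proof
    fix x :: "('f, 'f re38) presym"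
    assume "x \<in> degree_syms d"
    then obtain a M n where x: "x = tsym a (ps_monom M)" "a \<in> re38_degree n" "n + 2 * int (msize M) = d"
      by blast
    from odd_parity[OF x(2,3)] show "x \<in> {tsym a f | a (f :: 'f pser). a \<in> re38_parity 1}"
      unfolding x(1) by blast
  qed
  then show ?thesis
    unfolding ann_degree_cl ann_parity_cl ann_par_def by (intro image_mono sym.span_mono)
qed

lemma re38_odd_degrees:
  "odd_in_degrees_m1_m3 (re38_act :: 'f::field dpoly \<Rightarrow> _) re38_parity re38_degree"
  unfolding odd_in_degrees_m1_m3_def by (intro conjI re38_ann_degree_odd) simp_all

lemma rbr_degree_m2:
  "degree_m2_is_D re38_act re38_parity (rbr :: 'f::field_char_0 re38 lbracket) re38_degree"
proof -
  have image: "ann_ad re38_act (rbr :: 'f re38 lbracket) ` ann_degree re38_act re38_degree (- 2) = range dmap"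
    unfolding ann_degree_m2 image_image ann_ad_uvec by (rule refl)
  have inj: "inj_on (ann_ad re38_act (rbr :: 'f re38 lbracket)) (ann_degree re38_act re38_degree (- 2))"
  proof (rule inj_onI)
    fix X Y :: "('f, 'f re38) presym set"
    assume "X \<in> ann_degree re38_act re38_degree (- 2)" "Y \<in> ann_degree re38_act re38_degree (- 2)"
    then obtain c c' where XY: "X = cl (uvec c)" "Y = cl (uvec c')"
      unfolding ann_degree_m2 by blast
    assume "ann_ad re38_act rbr X = ann_ad re38_act rbr Y"
    then have "c = c'" unfolding XY ann_ad_uvec by (rule dmap_inj)
    then show "X = Y" unfolding XY by (rule arg_cong)
  qed
  show ?thesis
    unfolding degree_m2_is_D_def image ann_D_dmap
    by (intro conjI image_subsetI dmap_ann_der inj refl)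
qed

theorem proposition8p2:
  shows "(\<exists>!br :: 'f::{alg_closed_field, field_char_0} re38 lbracket. re38_bracket br) \<and>
    (\<forall>br :: 'f re38 lbracket. re38_bracket br \<longrightarrow>
       lie_conformal_superalgebra re38_act re38_parity br \<and>
       Z_graded re38_act br re38_degree \<and>
       depth_at_most_3 (re38_act :: 'f dpoly \<Rightarrow> _) re38_degree \<and>
       odd_in_degrees_m1_m3 (re38_act :: 'f dpoly \<Rightarrow> _) re38_parity re38_degree \<and>
       degree_m2_is_D re38_act re38_parity br re38_degree)"
proof (rule conjI)
  show "\<exists>!br :: 'f re38 lbracket. re38_bracket br"
    by (rule ex1I) (rule rbr_re38_bracket, erule re38_bracket_unique)
  show "\<forall>br :: 'f re38 lbracket. re38_bracket br \<longrightarrow>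
       lie_conformal_superalgebra re38_act re38_parity br \<and>
       Z_graded re38_act br re38_degree \<and>
       depth_at_most_3 (re38_act :: 'f dpoly \<Rightarrow> _) re38_degree \<and>
       odd_in_degrees_m1_m3 (re38_act :: 'f dpoly \<Rightarrow> _) re38_parity re38_degree \<and>
       degree_m2_is_D re38_act re38_parity br re38_degree"
  proof (intro allI impI)
    fix br :: "'f re38 lbracket"
    assume "re38_bracket br"
    then have br: "br = rbr" by (rule re38_bracket_unique)
    show "lie_conformal_superalgebra re38_act re38_parity br \<and>
       Z_graded re38_act br re38_degree \<and>
       depth_at_most_3 (re38_act :: 'f dpoly \<Rightarrow> _) re38_degree \<and>
       odd_in_degrees_m1_m3 (re38_act :: 'f dpoly \<Rightarrow> _) re38_parity re38_degree \<and>
       degree_m2_is_D re38_act re38_parity br re38_degree"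
      unfolding br by (intro conjI rbr_lie_conformal rbr_Z_graded re38_depth re38_odd_degrees rbr_degree_m2)
  qed
qed

end
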